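(* Let $(X,g)$ be a strongly causal space-time. Then the (possibly empty) set $\{x\in X : (X,g) \text{ is refocusing at } x\}$ is a closed subset of $X$.
   Context: All manifolds are smooth ($C^\infty$). A space-time $(X,g)$ is a connected, time-oriented smooth Lorentz manifold (signature $(+,\dots,+,-)$) of dimension at least $2$; its points are called events. A nonzero tangent vector $v$ is timelike, null or nonspacelike if $g(v,v)<0$, $g(v,v)=0$ or $g(v,v)\le 0$, respectively. A nonspacelike curve is a piecewise-smooth curve whose velocity vectors are nonspacelike and all future-directed (or all past-directed). An open set $U\subset X$ is causally convex if no nonspacelike curve in $X$ intersects $U$ in a disconnected set. $(X,g)$ is strongly causal at $p$ if every open neighborhood of $p$ contains a causally convex open neighborhood of $p$; it is strongly causal if this holds at every event. Null-geodesics are geodesics with null velocity and are taken to be inextendible in $X$; a null-geodesic enters a set $U$ if its image meets $U$. A strongly causal space-time $(X,g)$ is refocusing at $x\in X$ if one (equivalently, all) of the following conditions holds. (i) There is an open neighborhood $V$ of $x$ such that for all open $U$ with $x\in U\subset V$ there is an event $y\notin U$ such that all null-geodesics through $y$ enter $U$. (ii) There is an open neighborhood $V$ of $x$ such that for all open $U$ with $x\in U\subset V$ there is an event $y\notin V$ such that all null-geodesics through $y$ enter $U$. (iii) There are an open neighborhood $V$ of $x$ and a sequence $\{y_n\}_{n=1}^\infty$ in $X\setminus V$ such that for all open $U$ with $x\in U\subset V$ there is $K\in\mathbb{N}$ such that for all $n\ge K$ all null-geodesics through $y_n$ enter $U$. *)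

theory Defs
  imports "HOL-Analysis.Analysis"
begin

section \<open>Smooth maps between open subsets of Euclidean spaces\<close>

text \<open>The notions below are meant for open \<open>S\<close>. All spaces are finite dimensional, so that
  \<open>C\<^sup>k\<close> can be phrased through directional derivatives of a Frechet differentiable map.\<close>

primrec Ck_on ::
  "nat \<Rightarrow> ('a::euclidean_space \<Rightarrow> 'b::euclidean_space) \<Rightarrow> 'a set \<Rightarrow> bool" where
  "Ck_on 0 f S \<longleftrightarrow> continuous_on S f"
| "Ck_on (Suc k) f S \<longleftrightarrow> (\<forall>x\<in>S. f differentiable (at x)) \<and>
     (\<forall>v. Ck_on k (\<lambda>x. frechet_derivative f (at x) v) S)"

definition smooth_on ::
  "'a::euclidean_space set \<Rightarrow> ('a \<Rightarrow> 'b::euclidean_space) \<Rightarrow> bool" where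
  "smooth_on S f \<longleftrightarrow> (\<forall>k. Ck_on k f S)"


section \<open>Smooth manifolds\<close>

text \<open>A chart is a pair of its domain and its coordinate map; the values of the coordinate map
  outside the domain are irrelevant. The manifold is the whole type \<open>'a\<close>, with the
  topology of the type, and \<open>\<A>\<close> is any (not necessarily maximal) smooth atlas.\<close>

type_synonym ('a, 'e) chart = "'a set \<times> ('a \<Rightarrow> 'e)"

abbreviation (input) chart_dom :: "('a, 'e) chart \<Rightarrow> 'a set" where
  "chart_dom \<equiv> fst"

abbreviation (input) coord :: "('a, 'e) chart \<Rightarrow> 'a \<Rightarrow> 'e" where
  "coord \<equiv> snd"

definition codom :: "('a, 'e) chart \<Rightarrow> 'e set" where
  "codom c = coord c ` chart_dom c"

definition inv_coord :: "('a, 'e) chart \<Rightarrow> 'e \<Rightarrow> 'a" where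
  "inv_coord c = inv_into (chart_dom c) (coord c)"

text \<open>The differential at \<open>p\<close> of the change of coordinates from \<open>c\<close> to \<open>d\<close>.\<close>

definition transition_deriv ::
  "('a, 'e::euclidean_space) chart \<Rightarrow> ('a, 'e) chart \<Rightarrow> 'a \<Rightarrow> 'e \<Rightarrow> 'e" where
  "transition_deriv c d p = frechet_derivative (coord d \<circ> inv_coord c) (at (coord c p))"

locale smooth_manifold =
  fixes \<A> :: "('a::{t2_space, second_countable_topology}, 'e::euclidean_space) chart set"
  assumes open_dom: "c \<in> \<A> \<Longrightarrow> open (chart_dom c)"
    and open_codom: "c \<in> \<A> \<Longrightarrow> open (codom c)"
    and chart_homeomorphism:
      "c \<in> \<A> \<Longrightarrow> homeomorphism (chart_dom c) (codom c) (coord c) (inv_coord c)"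
    and atlas_covers: "(\<Union>c\<in>\<A>. chart_dom c) = UNIV"
    and smooth_transition:
      "c \<in> \<A> \<Longrightarrow> d \<in> \<A> \<Longrightarrow>
        smooth_on (coord c ` (chart_dom c \<inter> chart_dom d)) (coord d \<circ> inv_coord c)"
begin

text \<open>Smoothness on an interval \<open>J\<close> that need not be open: in every chart the curve is,
  locally, the restriction of a smooth map defined on an open set of parameters.\<close>

definition smooth_curve_on :: "real set \<Rightarrow> (real \<Rightarrow> 'a) \<Rightarrow> bool" where
  "smooth_curve_on J \<gamma> \<longleftrightarrow>
     (\<forall>t\<in>J. \<forall>c\<in>\<A>. \<gamma> t \<in> chart_dom c \<longrightarrow>
        (\<exists>N f. open N \<and> t \<in> N \<and> smooth_on N f \<and>
           (\<forall>s\<in>J \<inter> N. \<gamma> s \<in> chart_dom c \<and> coord c (\<gamma> s) = f s)))"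

text \<open>Components in the chart \<open>c\<close> of the velocity at \<open>t\<close> (one-sided at end points of \<open>J\<close>).\<close>

definition velocity :: "('a, 'e) chart \<Rightarrow> real set \<Rightarrow> (real \<Rightarrow> 'a) \<Rightarrow> real \<Rightarrow> 'e" where
  "velocity c J \<gamma> t = vector_derivative (coord c \<circ> \<gamma>) (at t within J)"

end


section \<open>Lorentz metrics\<close>

text \<open>Signature \<open>(+,\<dots>,+,-)\<close>: there is an orthonormal basis with exactly one vector of
  square \<open>-1\<close>.\<close>

definition lorentz_form :: "('e::euclidean_space \<Rightarrow> 'e \<Rightarrow> real) \<Rightarrow> bool" where
  "lorentz_form b \<longleftrightarrow> bilinear b \<and> (\<forall>u v. b u v = b v u) \<and>
     (\<exists>B e. independent B \<and> span B = UNIV \<and> e \<in> B \<and> b e e = -1 \<and>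
        (\<forall>u\<in>B - {e}. b u u = 1) \<and> (\<forall>u\<in>B. \<forall>v\<in>B. u \<noteq> v \<longrightarrow> b u v = 0))"

text \<open>Tensor fields are given by their components in the charts, subject to the usual
  transformation law: \<open>g c p u v\<close> is the value of the metric on the tangent vectors at \<open>p\<close>
  whose components in the chart \<open>c\<close> are \<open>u\<close> and \<open>v\<close>. It is only meaningful
  for \<open>c \<in> \<A>\<close> and \<open>p \<in> chart_dom c\<close>.\<close>

locale lorentz_manifold = smooth_manifold \<A>
  for \<A> :: "('a::{t2_space, second_countable_topology}, 'e::euclidean_space) chart set" +
  fixes g :: "('a, 'e) chart \<Rightarrow> 'a \<Rightarrow> 'e \<Rightarrow> 'e \<Rightarrow> real"
  assumes lorentz: "c \<in> \<A> \<Longrightarrow> p \<in> chart_dom c \<Longrightarrow> lorentz_form (g c p)"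
    and smooth_metric:
      "c \<in> \<A> \<Longrightarrow> smooth_on (codom c) (\<lambda>x. g c (inv_coord c x) u v)"
    and metric_transform:
      "c \<in> \<A> \<Longrightarrow> d \<in> \<A> \<Longrightarrow> p \<in> chart_dom c \<inter> chart_dom d \<Longrightarrow>
        g c p u v = g d p (transition_deriv c d p u) (transition_deriv c d p v)"
begin

definition timelike :: "('a, 'e) chart \<Rightarrow> 'a \<Rightarrow> 'e \<Rightarrow> bool" where
  "timelike c p v \<longleftrightarrow> v \<noteq> 0 \<and> g c p v v < 0"

definition null :: "('a, 'e) chart \<Rightarrow> 'a \<Rightarrow> 'e \<Rightarrow> bool" where
  "null c p v \<longleftrightarrow> v \<noteq> 0 \<and> g c p v v = 0"

definition nonspacelike :: "('a, 'e) chart \<Rightarrow> 'a \<Rightarrow> 'e \<Rightarrow> bool" where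
  "nonspacelike c p v \<longleftrightarrow> v \<noteq> 0 \<and> g c p v v \<le> 0"

text \<open>\<open>metric_deriv c p w u v\<close> is the partial derivative of \<open>g(u, v)\<close> in direction
  \<open>w\<close>, for constant coordinate fields \<open>u\<close>, \<open>v\<close>, \<open>w\<close>.\<close>

definition metric_deriv :: "('a, 'e) chart \<Rightarrow> 'a \<Rightarrow> 'e \<Rightarrow> 'e \<Rightarrow> 'e \<Rightarrow> real" where
  "metric_deriv c p w u v =
     frechet_derivative (\<lambda>x. g c (inv_coord c x) u v) (at (coord c p)) w"

text \<open>Christoffel symbols of the Levi-Civita connection: \<open>christoffel c p u v\<close> is the vector
  \<open>\<Gamma>\<^sup>k\<^sub>i\<^sub>j u\<^sup>i v\<^sup>j\<close>, determined by the Koszul formula for coordinate fields. It exists uniquely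
  since \<open>g\<close> is nondegenerate.\<close>

definition christoffel :: "('a, 'e) chart \<Rightarrow> 'a \<Rightarrow> 'e \<Rightarrow> 'e \<Rightarrow> 'e" where
  "christoffel c p u v = (THE z. \<forall>w. g c p z w =
     (metric_deriv c p u v w + metric_deriv c p v u w - metric_deriv c p w u v) / 2)"

definition geodesic_on :: "real set \<Rightarrow> (real \<Rightarrow> 'a) \<Rightarrow> bool" where
  "geodesic_on I \<gamma> \<longleftrightarrow>
     open I \<and> is_interval I \<and> I \<noteq> {} \<and> smooth_curve_on I \<gamma> \<and>
     (\<forall>t\<in>I. \<forall>c\<in>\<A>. \<gamma> t \<in> chart_dom c \<longrightarrow>
        vector_derivative (velocity c I \<gamma>) (at t) +
          christoffel c (\<gamma> t) (velocity c I \<gamma> t) (velocity c I \<gamma> t) = 0)"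

definition inextendible_geodesic_on :: "real set \<Rightarrow> (real \<Rightarrow> 'a) \<Rightarrow> bool" where
  "inextendible_geodesic_on I \<gamma> \<longleftrightarrow> geodesic_on I \<gamma> \<and>
     (\<forall>J \<eta>. geodesic_on J \<eta> \<and> I \<subseteq> J \<and> (\<forall>t\<in>I. \<eta> t = \<gamma> t) \<longrightarrow> J = I)"

definition null_geodesic_on :: "real set \<Rightarrow> (real \<Rightarrow> 'a) \<Rightarrow> bool" where
  "null_geodesic_on I \<gamma> \<longleftrightarrow> inextendible_geodesic_on I \<gamma> \<and>
     (\<forall>t\<in>I. \<forall>c\<in>\<A>. \<gamma> t \<in> chart_dom c \<longrightarrow> null c (\<gamma> t) (velocity c I \<gamma> t))"

definition all_null_geodesics_enter :: "'a \<Rightarrow> 'a set \<Rightarrow> bool" where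
  "all_null_geodesics_enter y U \<longleftrightarrow>
     (\<forall>I \<gamma>. null_geodesic_on I \<gamma> \<and> y \<in> \<gamma> ` I \<longrightarrow> \<gamma> ` I \<inter> U \<noteq> {})"

text \<open>Of the equivalent definitions of refocusing for strongly causal space-times, this is the
  one with \<open>y \<notin> V\<close>; the others require \<open>y \<notin> U\<close>, or a single sequence
  of events outside \<open>V\<close> that eventually works for each \<open>U\<close>.\<close>

definition refocusing_at :: "'a \<Rightarrow> bool" where
  "refocusing_at x \<longleftrightarrow>
     (\<exists>V. open V \<and> x \<in> V \<and>
        (\<forall>U. open U \<and> x \<in> U \<and> U \<subseteq> V \<longrightarrow>
           (\<exists>y. y \<notin> V \<and> all_null_geodesics_enter y U)))"

end


section \<open>Space-times\<close>

text \<open>The time orientation is given by a continuous timelike vector field, \<open>T c p\<close> being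
  its components in the chart \<open>c\<close> at \<open>p\<close>.\<close>

locale spacetime = lorentz_manifold \<A> g
  for \<A> :: "('a::{t2_space, second_countable_topology}, 'e::euclidean_space) chart set"
    and g :: "('a, 'e) chart \<Rightarrow> 'a \<Rightarrow> 'e \<Rightarrow> 'e \<Rightarrow> real" +
  fixes T :: "('a, 'e) chart \<Rightarrow> 'a \<Rightarrow> 'e"
  assumes dim_ge_2: "DIM('e) \<ge> 2"
    and connected: "connected (UNIV :: 'a set)"
    and T_continuous: "c \<in> \<A> \<Longrightarrow> continuous_on (chart_dom c) (T c)"
    and T_timelike: "c \<in> \<A> \<Longrightarrow> p \<in> chart_dom c \<Longrightarrow> timelike c p (T c p)"
    and T_transform:
      "c \<in> \<A> \<Longrightarrow> d \<in> \<A> \<Longrightarrow> p \<in> chart_dom c \<inter> chart_dom d \<Longrightarrow>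
        T d p = transition_deriv c d p (T c p)"
begin

text \<open>With signature \<open>(+,\<dots>,+,-)\<close>, a nonspacelike vector lies in the same half of the
  cone as \<open>T\<close> iff its product with \<open>T\<close> is negative.\<close>

definition future_directed :: "('a, 'e) chart \<Rightarrow> 'a \<Rightarrow> 'e \<Rightarrow> bool" where
  "future_directed c p v \<longleftrightarrow> nonspacelike c p v \<and> g c p (T c p) v < 0"

definition past_directed :: "('a, 'e) chart \<Rightarrow> 'a \<Rightarrow> 'e \<Rightarrow> bool" where
  "past_directed c p v \<longleftrightarrow> nonspacelike c p v \<and> g c p (T c p) v > 0"

text \<open>Piecewise smooth curves on an interval \<open>I\<close> of any kind. The set \<open>S\<close> of break points is
  locally finite; at a break point both one-sided velocities are considered.\<close>

definition piecewise_smooth_with ::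
  "(('a, 'e) chart \<Rightarrow> 'a \<Rightarrow> 'e \<Rightarrow> bool) \<Rightarrow> real set \<Rightarrow> (real \<Rightarrow> 'a) \<Rightarrow> bool" where
  "piecewise_smooth_with P I \<gamma> \<longleftrightarrow> continuous_on I \<gamma> \<and>
     (\<exists>S. (\<forall>a b. {a..b} \<subseteq> I \<longrightarrow> finite (S \<inter> {a..b})) \<and>
        (\<forall>a b. a < b \<and> {a..b} \<subseteq> I \<and> {a<..<b} \<inter> S = {} \<longrightarrow>
           smooth_curve_on {a..b} \<gamma> \<and>
           (\<forall>t\<in>{a..b}. \<forall>c\<in>\<A>. \<gamma> t \<in> chart_dom c \<longrightarrow>
              P c (\<gamma> t) (velocity c {a..b} \<gamma> t))))"

definition nonspacelike_curve :: "real set \<Rightarrow> (real \<Rightarrow> 'a) \<Rightarrow> bool" where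
  "nonspacelike_curve I \<gamma> \<longleftrightarrow> is_interval I \<and> interior I \<noteq> {} \<and>
     (piecewise_smooth_with future_directed I \<gamma> \<or> piecewise_smooth_with past_directed I \<gamma>)"

definition causally_convex :: "'a set \<Rightarrow> bool" where
  "causally_convex U \<longleftrightarrow> open U \<and>
     (\<forall>I \<gamma>. nonspacelike_curve I \<gamma> \<longrightarrow> connected (\<gamma> ` I \<inter> U))"

definition strongly_causal_at :: "'a \<Rightarrow> bool" where
  "strongly_causal_at p \<longleftrightarrow>
     (\<forall>W. open W \<and> p \<in> W \<longrightarrow> (\<exists>U. causally_convex U \<and> p \<in> U \<and> U \<subseteq> W))"

definition strongly_causal :: bool where
  "strongly_causal \<longleftrightarrow> (\<forall>p. strongly_causal_at p)"

end

end

(* Let x be a limit of refocusing points. Near x the geodesic equation bends null geodesics so little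
   that, measured by a linear time function, they are almost straight lines. Through every event y near x
   pass two null geodesics with uniformly separated directions. If both return to a coordinate ball of
   radius r around a point p near x, then comparing the two almost straight lines gives that y has
   coordinate distance at most K r from p, with K depending on x only. Strong causality provides a
   neighbourhood V of x, inside a chart, in which the relevant segments of these geodesics stay.
   Hence events y that focus into arbitrarily small balls around a refocusing point p in V, but avoid a fixed
   neighbourhood of p, lie outside V. So V is a neighbourhood as required for refocusing at x, although the
   neighbourhoods belonging to the points p may shrink as p tends to x.

   The definition of refocusing quantifies over all null geodesics through y, so their existence is
   essential: by Picard iteration in a chart, covariance of the geodesic equation, Zorn's lemma, and
   the persistence of the null condition. *)

theory Submission
  imports Defs
begin

section \<open>Calculus of iterated derivatives\<close>

text \<open>The argument is run on the complement. If \<open>x\<close> is not refocusing, a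
  candidate neighbourhood \<open>V\<close> must fail, and the failure yields one open
  \<open>U\<close> such that every event focusing into \<open>U\<close> lies in \<open>V\<close>;
  this single \<open>U\<close> then excludes refocusing at each of its points. Causal convexity
  controls only the image of a curve, not its parameters. A geodesic that leaves and re-enters
  through one and the same boundary event is the delicate case, and it is the local time function
  that excludes it. Three constants are balanced: the null directions \<open>T0 + s w\<close> are
  used with two values of \<open>s\<close> at distance at least 1, each geodesic may deviate from
  its tangent line by \<open>norm w / 4\<close> per unit of time, and the coordinate ball is so
  small that the coordinate acceleration of null geodesics respects this tolerance. The metric is
  smooth only for constant vectors and the Christoffel symbols are given only implicitly by the
  Koszul formula. Hence the recurring expansions in a basis, and the regularity theory for solutions
  of linear systems.\<close>

lemma linear_eq_sum_Basis:
  fixes f :: "'a::euclidean_space \<Rightarrow> 'b::real_vector"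
  assumes "linear f"
  shows "f v = (\<Sum>b\<in>Basis. (v \<bullet> b) *\<^sub>R f b)"
proof -
  have "f v = f (\<Sum>b\<in>Basis. (v \<bullet> b) *\<^sub>R b)" by (simp add: euclidean_representation)
  then show ?thesis using assms by (simp add: linear_sum linear_cmul)
qed

lemma frechet_derivative_cong_open:
  assumes "open S" "x \<in> S" "\<And>y. y \<in> S \<Longrightarrow> f y = h y"
  shows "frechet_derivative f (at x) = frechet_derivative h (at x)"
proof -
  have "(f has_derivative D) (at x) \<longleftrightarrow> (h has_derivative D) (at x)" for D
    using has_derivative_transform_within_open[OF _ assms(1,2), of f D UNIV h]
      has_derivative_transform_within_open[OF _ assms(1,2), of h D UNIV f] assms(3) by auto
  then show ?thesis unfolding frechet_derivative_def by simp
qed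

lemma Ck_on_cong:
  assumes "open S" "\<And>y. y \<in> S \<Longrightarrow> f y = h y"
  shows "Ck_on k f S \<longleftrightarrow> Ck_on k h S"
  using assms(2)
proof (induction k arbitrary: f h)
  case 0
  then show ?case using continuous_on_cong[of S S f h] by simp
next
  case (Suc k)
  have d: "f differentiable (at x) \<longleftrightarrow> h differentiable (at x)" if "x \<in> S" for x
    unfolding differentiable_def
    using has_derivative_transform_within_open[OF _ assms(1) that, of f _ UNIV h]
      has_derivative_transform_within_open[OF _ assms(1) that, of h _ UNIV f] Suc.prems by auto
  have "Ck_on k (\<lambda>x. frechet_derivative f (at x) v) S \<longleftrightarrow>
      Ck_on k (\<lambda>x. frechet_derivative h (at x) v) S" for v
    by (rule Suc.IH) (simp add: frechet_derivative_cong_open[OF assms(1) _ Suc.prems])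
  then show ?case using d by simp
qed

lemma Ck_on_SucD:
  assumes "Ck_on (Suc k) f S"
  shows "Ck_on k f S"
  using assms
proof (induction k arbitrary: f)
  case 0
  then show ?case
    by (auto intro!: continuous_at_imp_continuous_on differentiable_imp_continuous_within)
next
  case (Suc k)
  then have "\<forall>x\<in>S. f differentiable (at x)"
    and "Ck_on (Suc k) (\<lambda>x. frechet_derivative f (at x) v) S" for v
    unfolding Ck_on.simps(2)[of "Suc k"] by blast+
  with Suc.IH show ?case unfolding Ck_on.simps(2)[of k f] by blast
qed

lemma Ck_on_subset:
  assumes "Ck_on k f S" "R \<subseteq> S"
  shows "Ck_on k f R"
  using assms(1)
proof (induction k arbitrary: f)
  case 0 then show ?case using assms(2) by (auto intro: continuous_on_subset)
next
  case (Suc k) then show ?case using assms(2) by auto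
qed

text \<open>Replaces the chosen value \<open>frechet_derivative\<close> by any explicit derivative
  \<open>D\<close>, so that the closure properties below reduce to the usual differentiation
  rules.\<close>

lemma Ck_on_SucI:
  assumes "open S" "\<And>x. x \<in> S \<Longrightarrow> (f has_derivative D x) (at x)"
    and "\<And>v. Ck_on k (\<lambda>x. D x v) S"
  shows "Ck_on (Suc k) f S"
proof -
  have fd: "frechet_derivative f (at x) = D x" if "x \<in> S" for x
    using frechet_derivative_at[OF assms(2)[OF that]] by simp
  have "Ck_on k (\<lambda>x. frechet_derivative f (at x) v) S" for v
    using Ck_on_cong[OF assms(1), of "\<lambda>x. frechet_derivative f (at x) v" "\<lambda>x. D x v"] fd assms(3)
    by auto
  moreover have "\<forall>x\<in>S. f differentiable (at x)" using assms(2) by (auto simp: differentiable_def)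
  ultimately show ?thesis by simp
qed

lemma Ck_on_Suc_has_derivative:
  assumes "Ck_on (Suc k) f S" "x \<in> S"
  shows "(f has_derivative frechet_derivative f (at x)) (at x)"
  using assms by (simp add: frechet_derivative_works)

lemma Ck_on_const:
  assumes "open S"
  shows "Ck_on k (\<lambda>x. c) S"
proof (induction k arbitrary: c)
  case 0 show ?case by simp
next
  case (Suc k)
  show ?case
    by (rule Ck_on_SucI[OF assms, where D="\<lambda>x v. 0"]) (auto intro: Suc.IH)
qed

lemma Ck_on_bounded_linear:
  assumes "open S" "bounded_linear L"
  shows "Ck_on k L S"
proof (cases k)
  case 0 then show ?thesis
    using assms(2) by (simp add: linear_continuous_on)
next
  case (Suc j)
  show ?thesis unfolding Suc
    by (rule Ck_on_SucI[OF assms(1), where D="\<lambda>x. L"])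
      (auto intro: Ck_on_const[OF assms(1)] bounded_linear_imp_has_derivative assms(2))
qed

lemma Ck_on_add:
  assumes "open S" "Ck_on k f S" "Ck_on k h S"
  shows "Ck_on k (\<lambda>x. f x + h x) S"
  using assms(2,3)
proof (induction k arbitrary: f h)
  case 0 then show ?case by (auto intro: continuous_intros)
next
  case (Suc k)
  show ?case
    by (rule Ck_on_SucI[OF assms(1), where
          D="\<lambda>x v. frechet_derivative f (at x) v + frechet_derivative h (at x) v"])
      (use Suc in \<open>auto intro!: has_derivative_add simp: frechet_derivative_works\<close>)
qed

lemma Ck_on_sum:
  assumes "open S" "finite A" "\<And>i. i \<in> A \<Longrightarrow> Ck_on k (f i) S"
  shows "Ck_on k (\<lambda>x. \<Sum>i\<in>A. f i x) S"
  using assms(2,3)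
  by (induction A rule: finite_induct) (auto intro: Ck_on_const Ck_on_add assms(1))

lemma Ck_on_bilinear:
  fixes f :: "'a::euclidean_space \<Rightarrow> 'b::euclidean_space"
    and h :: "'a \<Rightarrow> 'c::euclidean_space"
    and prod :: "'b \<Rightarrow> 'c \<Rightarrow> 'd::euclidean_space"
  assumes "bounded_bilinear prod" "open S" "Ck_on k f S" "Ck_on k h S"
  shows "Ck_on k (\<lambda>x. prod (f x) (h x)) S"
  using assms(3,4)
proof (induction k arbitrary: f h)
  case 0 then show ?case
    using bounded_bilinear.continuous_on[OF assms(1)] by auto
next
  case (Suc k)
  have f: "Ck_on k f S" and h: "Ck_on k h S" using Suc.prems Ck_on_SucD by blast+
  show ?case
  proof (rule Ck_on_SucI[OF assms(2), where
          D="\<lambda>x v. prod (f x) (frechet_derivative h (at x) v) + prod (frechet_derivative f (at x) v) (h x)"])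
    show "((\<lambda>x. prod (f x) (h x)) has_derivative
        (\<lambda>v. prod (f x) (frechet_derivative h (at x) v) + prod (frechet_derivative f (at x) v) (h x))) (at x)"
      if "x \<in> S" for x
      using Suc.prems[THEN Ck_on_Suc_has_derivative, OF that]
      by (rule bounded_bilinear.FDERIV[OF assms(1)])
    show "Ck_on k (\<lambda>x. prod (f x) (frechet_derivative h (at x) v) +
        prod (frechet_derivative f (at x) v) (h x)) S" for v
      using Suc.prems f h by (intro Ck_on_add[OF assms(2)] Suc.IH) auto
  qed
qed

lemmas Ck_on_scaleR = Ck_on_bilinear[OF bounded_bilinear_scaleR]
lemmas Ck_on_mult = Ck_on_bilinear[OF bounded_bilinear_mult[where 'a=real]]
lemmas Ck_on_inner = Ck_on_bilinear[OF bounded_bilinear_inner]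

text \<open>In the chain rule the direction fed to the derivative of \<open>f\<close> varies with
  \<open>x\<close>, while \<open>Ck_on\<close> only speaks of fixed directions. Expanding that
  direction in the basis turns the derivative into a sum of products, to which the induction
  hypothesis and the product rule apply.\<close>

lemma Ck_on_compose:
  fixes f :: "'b::euclidean_space \<Rightarrow> 'c::euclidean_space"
    and h :: "'a::euclidean_space \<Rightarrow> 'b"
  assumes "open S" "open R" "h ` S \<subseteq> R" "Ck_on k f R" "Ck_on k h S"
  shows "Ck_on k (\<lambda>x. f (h x)) S"
  using assms(4,5)
proof (induction k arbitrary: f)
  case 0 then show ?case
    using continuous_on_compose2[of R f S h] assms(3) by auto
next
  case (Suc k)
  define D where "D x v = (\<Sum>b\<in>Basis. (frechet_derivative h (at x) v \<bullet> b) *\<^sub>R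
      frechet_derivative f (at (h x)) b)" for x v
  show ?case
  proof (rule Ck_on_SucI[OF assms(1), where D=D])
    fix x assume x: "x \<in> S"
    have h: "(h has_derivative frechet_derivative h (at x)) (at x)"
      using Ck_on_Suc_has_derivative Suc.prems(2) x by blast
    have f: "(f has_derivative frechet_derivative f (at (h x))) (at (h x))"
      using Ck_on_Suc_has_derivative Suc.prems(1) x assms(3) by blast
    have "D x = (\<lambda>v. frechet_derivative f (at (h x)) (frechet_derivative h (at x) v))"
      unfolding D_def using linear_eq_sum_Basis[OF has_derivative_linear[OF f]] by metis
    then show "((\<lambda>x. f (h x)) has_derivative D x) (at x)"
      using has_derivative_compose[OF h f] by simp
  next
    fix v
    have "Ck_on k (\<lambda>x. frechet_derivative f (at (h x)) b) S" for b
      using Suc.IH[of "\<lambda>y. frechet_derivative f (at y) b"] Suc.prems Ck_on_SucD by auto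
    moreover have "Ck_on k (\<lambda>x. frechet_derivative h (at x) v \<bullet> b) S" for b
      using Suc.prems(2) by (intro Ck_on_inner Ck_on_const assms(1)) simp
    ultimately show "Ck_on k (\<lambda>x. D x v) S"
      unfolding D_def by (intro Ck_on_sum Ck_on_scaleR assms(1)) auto
  qed
qed

lemma Ck_on_linear_compose:
  assumes "bounded_linear L" "open S" "Ck_on k f S"
  shows "Ck_on k (\<lambda>x. L (f x)) S"
  by (rule Ck_on_compose[OF assms(2) open_UNIV _ Ck_on_bounded_linear[OF open_UNIV assms(1)] assms(3)]) simp

lemma Ck_on_Pair:
  assumes "open S" "Ck_on k f S" "Ck_on k h S"
  shows "Ck_on k (\<lambda>x. (f x, h x)) S"
proof -
  have "Ck_on k (\<lambda>x. (f x, 0) + (0, h x)) S"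
    using assms by (intro Ck_on_add Ck_on_linear_compose[where L="\<lambda>x. (x, 0)"]
        Ck_on_linear_compose[where L="\<lambda>x. (0, x)"] bounded_linear_Pair bounded_linear_ident bounded_linear_zero)
  then show ?thesis by simp
qed

section \<open>Smooth maps\<close>

lemma smooth_on_derivative:
  assumes "smooth_on S f"
  shows "smooth_on S (\<lambda>x. frechet_derivative f (at x) v)"
  using assms unfolding smooth_on_def by (metis Ck_on.simps(2))

lemma smooth_on_has_derivative:
  assumes "smooth_on S f" "x \<in> S"
  shows "(f has_derivative frechet_derivative f (at x)) (at x)"
  using assms Ck_on_Suc_has_derivative unfolding smooth_on_def by blast

lemma smooth_on_imp_continuous_on: "smooth_on S f \<Longrightarrow> continuous_on S f"
  unfolding smooth_on_def using Ck_on.simps(1) by blast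

lemma smooth_on_subset: "smooth_on S f \<Longrightarrow> R \<subseteq> S \<Longrightarrow> smooth_on R f"
  unfolding smooth_on_def using Ck_on_subset by blast

lemma smooth_on_compose:
  assumes "open S" "open R" "h ` S \<subseteq> R" "smooth_on R f" "smooth_on S h"
  shows "smooth_on S (\<lambda>x. f (h x))"
  using assms Ck_on_compose unfolding smooth_on_def by blast

lemma Ck_on_SucI_vector:
  fixes f :: "real \<Rightarrow> 'b::euclidean_space"
  assumes "open S" "\<And>t. t \<in> S \<Longrightarrow> (f has_vector_derivative f' t) (at t)" "Ck_on k f' S"
  shows "Ck_on (Suc k) f S"
  by (rule Ck_on_SucI[OF assms(1), where D="\<lambda>t h. h *\<^sub>R f' t"])
    (use assms in \<open>auto simp: has_vector_derivative_def intro: Ck_on_scaleR Ck_on_const\<close>)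

lemma smooth_on_has_vector_derivative:
  fixes f :: "real \<Rightarrow> 'b::euclidean_space"
  assumes "smooth_on S f" "t \<in> S"
  shows "(f has_vector_derivative frechet_derivative f (at t) 1) (at t)"
proof -
  have "(f has_derivative frechet_derivative f (at t)) (at t)"
    using smooth_on_has_derivative assms by blast
  moreover from this have "frechet_derivative f (at t) = (\<lambda>h. h *\<^sub>R frechet_derivative f (at t) 1)"
    by (metis (no_types, opaque_lifting) has_derivative_linear linear_cmul mult.right_neutral real_scaleR_def)
  ultimately show ?thesis unfolding has_vector_derivative_def by metis
qed


section \<open>Ordinary differential equations\<close>

text \<open>The Picard operator is written with two integrals over \<open>[-\<delta>, t]\<close> and \<open>[-\<delta>, 0]\<close> so that
  the sign of \<open>t\<close> plays no role; clamping the upper limit keeps its values bounded.\<close>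

lemma lipschitz_ode_exists:
  fixes G :: "'b::euclidean_space \<Rightarrow> 'b"
  assumes L: "L > 0" and lip: "\<And>x y. norm (G x - G y) \<le> L * norm (x - y)"
  obtains \<delta> y where "\<delta> > 0" "y 0 = y0" "continuous_on UNIV y"
    "\<And>t. t \<in> {-\<delta><..<\<delta>} \<Longrightarrow> (y has_vector_derivative G (y t)) (at t)"
proof -
  \<comment> \<open>With this length the two integrals together change by at most
    \<open>3 * L * \<delta>\<close>, that is 1/2, times the distance of the arguments, so the Picard
    operator is a contraction.\<close>
  define \<delta> where "\<delta> = 1 / (6 * L)"
  have \<delta>: "\<delta> > 0" using L by (simp add: \<delta>_def)
  define c where "c t = max (-\<delta>) (min \<delta> t)" for t :: real
  have c: "c t \<in> {-\<delta>..\<delta>}" for t using \<delta> by (auto simp: c_def)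
  have contc: "continuous_on UNIV c" unfolding c_def by (intro continuous_intros)
  have "L-lipschitz_on UNIV G"
    using lip L by (intro lipschitz_onI) (auto simp: dist_norm)
  then have contG: "continuous_on UNIV G" by (rule lipschitz_on_continuous_on)
  have conth: "continuous_on A (\<lambda>s. G (apply_bcontfun \<phi> s))" for \<phi> :: "real \<Rightarrow>\<^sub>C 'b" and A
    by (rule continuous_on_compose2[OF contG]) (auto intro: continuous_on_apply_bcontfun)
  let ?h = "\<lambda>(\<phi> :: real \<Rightarrow>\<^sub>C 'b) s. G (apply_bcontfun \<phi> s)"
  let ?J = "\<lambda>(\<phi> :: real \<Rightarrow>\<^sub>C 'b) t. integral {-\<delta>..t} (?h \<phi>)"
  define P where "P \<phi> t = y0 + ?J \<phi> (c t)
      - ?J \<phi> 0" for \<phi> :: "real \<Rightarrow>\<^sub>C 'b" and t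
  have int: "(?h \<phi>) integrable_on {a..b}" for \<phi> :: "real \<Rightarrow>\<^sub>C 'b" and a b
    using conth by (rule integrable_continuous_real)
  have contI: "continuous_on {-\<delta>..\<delta>} (\<lambda>t. ?J \<phi> t)"
    for \<phi> :: "real \<Rightarrow>\<^sub>C 'b"
    by (rule indefinite_integral_continuous_1[OF int])
  have contP: "continuous_on UNIV (P \<phi>)" for \<phi>
    unfolding P_def
    by (intro continuous_intros continuous_on_compose2[OF contI contc]) (use c in auto)
  have "P \<phi> \<in> bcontfun" for \<phi>
  proof -
    have "compact ((\<lambda>t. ?J \<phi> t) ` {-\<delta>..\<delta>})"
      using contI by (intro compact_continuous_image) auto
    then have "bounded ((\<lambda>z. y0 + z - ?J \<phi> 0) `
        ((\<lambda>t. ?J \<phi> t) ` {-\<delta>..\<delta>}))"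
      by (intro compact_imp_bounded[OF compact_continuous_image] continuous_intros)
    moreover have "range (P \<phi>) \<subseteq> ((\<lambda>z. y0 + z - ?J \<phi> 0) `
        ((\<lambda>t. ?J \<phi> t) ` {-\<delta>..\<delta>}))"
      unfolding P_def using c by blast
    ultimately have "bounded (range (P \<phi>))" using bounded_subset by blast
    then show ?thesis using contP by (simp add: bcontfun_def)
  qed
  then have appP: "apply_bcontfun (Bcontfun (P \<phi>)) = P \<phi>" for \<phi> by (rule Bcontfun_inverse)
  have bound: "norm (?J \<phi> t -
      ?J \<psi> t) \<le> L * dist \<phi> \<psi> * (t + \<delta>)"
    if "t \<in> {-\<delta>..\<delta>}" for \<phi> \<psi> :: "real \<Rightarrow>\<^sub>C 'b" and t
  proof -
    have "?J \<phi> t -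
        ?J \<psi> t =
        integral {-\<delta>..t} (\<lambda>s. G (apply_bcontfun \<phi> s) - G (apply_bcontfun \<psi> s))"
      by (rule integral_diff[symmetric]) (rule int)+
    also have "norm \<dots> \<le> L * dist \<phi> \<psi> * (t - (-\<delta>))"
    proof (rule integral_bound)
      show "-\<delta> \<le> t" using that by auto
      show "continuous_on {- \<delta>..t} (\<lambda>s. G (apply_bcontfun \<phi> s) - G (apply_bcontfun \<psi> s))"
        by (intro continuous_on_diff conth)
      show "norm (G (apply_bcontfun \<phi> s) - G (apply_bcontfun \<psi> s)) \<le> L * dist \<phi> \<psi>" for s
        using lip[of "apply_bcontfun \<phi> s" "apply_bcontfun \<psi> s"] dist_bounded[of \<phi> s \<psi>] L
        by (simp add: dist_norm) (meson mult_left_mono less_imp_le order_trans)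
    qed
    finally show ?thesis by simp
  qed
  have "dist (Bcontfun (P \<phi>)) (Bcontfun (P \<psi>)) \<le> 1/2 * dist \<phi> \<psi>" for \<phi> \<psi>
  proof (rule dist_bound)
    fix t
    have "P \<phi> t - P \<psi> t = (?J \<phi> (c t) -
        ?J \<psi> (c t)) -
        (?J \<phi> 0 -
        ?J \<psi> 0)"
      unfolding P_def by simp
    also have "norm \<dots> \<le> L * dist \<phi> \<psi> * (c t + \<delta>) + L * dist \<phi> \<psi> * (0 + \<delta>)"
      by (rule order_trans[OF norm_triangle_ineq4])
        (intro add_mono bound c, use \<delta> in auto)
    also have "\<dots> \<le> L * dist \<phi> \<psi> * (2 * \<delta>) + L * dist \<phi> \<psi> * \<delta>"
      using c[of t] L by (intro add_mono mult_left_mono) auto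
    also have "\<dots> = 1/2 * dist \<phi> \<psi>" using L by (simp add: \<delta>_def field_simps)
    finally show "dist (apply_bcontfun (Bcontfun (P \<phi>)) t) (apply_bcontfun (Bcontfun (P \<psi>)) t)
        \<le> 1/2 * dist \<phi> \<psi>"
      by (simp add: appP dist_norm)
  qed
  then have "\<exists>!\<phi>. Bcontfun (P \<phi>) = \<phi>"
    by (intro banach_fix_type[where c="1/2"]) auto
  then obtain \<phi> where "Bcontfun (P \<phi>) = \<phi>" by blast
  then have \<phi>: "apply_bcontfun \<phi> = P \<phi>" using appP by metis
  show thesis
  proof (rule that[of \<delta> "apply_bcontfun \<phi>"])
    show "\<delta> > 0" by fact
    show "continuous_on UNIV (apply_bcontfun \<phi>)" by (rule continuous_on_apply_bcontfun)
    have "c 0 = 0" using \<delta> by (simp add: c_def)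
    then have "P \<phi> 0 = y0" by (simp add: P_def)
    then show "apply_bcontfun \<phi> 0 = y0" using \<phi> by metis
    fix t assume t: "t \<in> {-\<delta><..<\<delta>}"
    have "((\<lambda>t. ?J \<phi> t) has_vector_derivative
        G (apply_bcontfun \<phi> t)) (at t within {-\<delta>..\<delta>})"
      by (rule integral_has_vector_derivative[OF conth]) (use t in simp)
    then have "((\<lambda>t. ?J \<phi> t) has_vector_derivative
        G (apply_bcontfun \<phi> t)) (at t)"
      using t at_within_Icc_at[of "-\<delta>" t \<delta>] by simp
    then have "((\<lambda>t. y0 + ?J \<phi> t -
        ?J \<phi> 0) has_vector_derivative
        G (apply_bcontfun \<phi> t)) (at t)"
      using has_vector_derivative_diff[OF has_vector_derivative_add[OF has_vector_derivative_const]
          has_vector_derivative_const, of _ "G (apply_bcontfun \<phi> t)" "at t" y0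
          "?J \<phi> 0"] by simp
    then show "(apply_bcontfun \<phi> has_vector_derivative G (apply_bcontfun \<phi> t)) (at t)"
    proof (rule has_vector_derivative_transform_within_open[of _ _ _ "{-\<delta><..<\<delta>}"])
      fix s assume "s \<in> {-\<delta><..<\<delta>}"
      then have "c s = s" by (simp add: c_def)
      then have "P \<phi> s = y0 + ?J \<phi> s -
          ?J \<phi> 0"
        by (simp add: P_def)
      then show "y0 + ?J \<phi> s -
          ?J \<phi> 0 = apply_bcontfun \<phi> s"
        using \<phi> by metis
    qed (use t in auto)
  qed
qed

text \<open>On the compact ball each derivative along a basis vector is bounded; the sum of these
  bounds dominates the operator norm, and the mean value inequality applies since the ball is
  convex.\<close>

lemma smooth_on_lipschitz_cball:
  fixes F :: "'b::euclidean_space \<Rightarrow> 'c::euclidean_space"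
  assumes "smooth_on S F" "cball y0 r \<subseteq> S"
  obtains L where "L > 0" "\<And>x y. x \<in> cball y0 r \<Longrightarrow> y \<in> cball y0 r \<Longrightarrow>
      norm (F x - F y) \<le> L * norm (x - y)"
proof -
  have "\<exists>M. \<forall>x\<in>cball y0 r. norm (frechet_derivative F (at x) b) \<le> M" for b
  proof -
    have "continuous_on (cball y0 r) (\<lambda>x. frechet_derivative F (at x) b)"
      using smooth_on_imp_continuous_on[OF smooth_on_derivative[OF assms(1)]] assms(2)
        continuous_on_subset by blast
    then have "bounded ((\<lambda>x. frechet_derivative F (at x) b) ` cball y0 r)"
      by (intro compact_imp_bounded compact_continuous_image) auto
    then show ?thesis unfolding bounded_iff by auto
  qed
  then obtain M where M: "\<And>b x. x \<in> cball y0 r \<Longrightarrow> norm (frechet_derivative F (at x) b) \<le> M b"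
    by metis
  define L where "L = 1 + (\<Sum>b\<in>Basis. \<bar>M b\<bar>)"
  have L: "L > 0" unfolding L_def by (simp add: add_pos_nonneg sum_nonneg)
  have on: "onorm (frechet_derivative F (at x)) \<le> L" if x: "x \<in> cball y0 r" for x
  proof (rule onorm_le)
    fix v
    have lin: "linear (frechet_derivative F (at x))"
      using smooth_on_has_derivative[OF assms(1)] x assms(2) has_derivative_linear by blast
    have "norm (frechet_derivative F (at x) v) =
        norm (\<Sum>b\<in>Basis. (v \<bullet> b) *\<^sub>R frechet_derivative F (at x) b)"
      using linear_eq_sum_Basis[OF lin, of v] by simp
    also have "\<dots> \<le> (\<Sum>b\<in>Basis. norm v * \<bar>M b\<bar>)"
    proof (rule order_trans[OF norm_sum sum_mono])
      fix b :: 'b assume b: "b \<in> Basis"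
      let ?l = "norm ((v \<bullet> b) *\<^sub>R frechet_derivative F (at x) b)"
      have "?l = \<bar>v \<bullet> b\<bar> * norm (frechet_derivative F (at x) b)"
        by simp
      also have "\<dots> \<le> norm v * \<bar>M b\<bar>"
        by (intro mult_mono) (use Basis_le_norm[OF b, of v] M[OF x, of b] in auto)
      finally show "?l \<le> norm v * \<bar>M b\<bar>" .
    qed
    also have "\<dots> \<le> L * norm v"
      unfolding L_def by (simp add: sum_distrib_left[symmetric] algebra_simps)
    finally show "norm (frechet_derivative F (at x) v) \<le> L * norm v" .
  qed
  have "norm (F x - F y) \<le> L * norm (x - y)" if "x \<in> cball y0 r" "y \<in> cball y0 r" for x y
  proof (rule differentiable_bound[OF convex_cball _ on that])
    show "(F has_derivative frechet_derivative F (at z)) (at z within cball y0 r)"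
      if "z \<in> cball y0 r" for z
      using smooth_on_has_derivative[OF assms(1)] that assms(2) has_derivative_at_withinI by blast
  qed
  then show thesis using L that by blast
qed

text \<open>Precomposing \<open>F\<close> with the nearest-point projection onto a closed ball makes
  it globally Lipschitz and leaves it unchanged on the ball, where the solution remains for a short
  time. Smoothness follows by bootstrapping: the derivative \<open>F (y t)\<close> is as regular as
  \<open>y\<close>.\<close>

lemma smooth_ode_exists:
  fixes F :: "'b::euclidean_space \<Rightarrow> 'b"
  assumes S: "open S" and y0: "y0 \<in> S" and F: "smooth_on S F"
  obtains \<delta> y where "\<delta> > 0" "y 0 = y0" "smooth_on {-\<delta><..<\<delta>} y"
    "\<And>t. t \<in> {-\<delta><..<\<delta>} \<Longrightarrow> y t \<in> S"
    "\<And>t. t \<in> {-\<delta><..<\<delta>} \<Longrightarrow> (y has_vector_derivative F (y t)) (at t)"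
proof -
  obtain r where r: "r > 0" "cball y0 r \<subseteq> S" using S y0 open_contains_cball by blast
  obtain L where L: "L > 0" "\<And>x y. x \<in> cball y0 r \<Longrightarrow> y \<in> cball y0 r \<Longrightarrow>
      norm (F x - F y) \<le> L * norm (x - y)"
    using smooth_on_lipschitz_cball[OF F r(2)] by blast
  define p where "p = closest_point (cball y0 r)"
  have p: "p x \<in> cball y0 r" for x
    unfolding p_def using r by (intro closest_point_in_set) auto
  have "norm (F (p x) - F (p y)) \<le> L * norm (x - y)" for x y
  proof -
    have "dist (p x) (p y) \<le> dist x y"
      unfolding p_def using r by (intro closest_point_lipschitz) auto
    then show ?thesis
      using L(2)[OF p p, of x y] L(1) by (simp add: dist_norm) (meson mult_left_mono less_imp_le order_trans)
  qed
  then obtain \<delta> y where y: "\<delta> > 0" "y 0 = y0" "continuous_on UNIV y"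
    "\<And>t. t \<in> {-\<delta><..<\<delta>} \<Longrightarrow> (y has_vector_derivative F (p (y t))) (at t)"
    using lipschitz_ode_exists[OF L(1), of "\<lambda>x. F (p x)" y0] by blast
  have "open (y -` ball y0 r)" using y(3) continuous_open_vimage[of "ball y0 r" y]
    by (simp add: continuous_on_eq_continuous_at)
  moreover have "0 \<in> y -` ball y0 r" using y(2) r by simp
  ultimately obtain \<eta> where \<eta>: "\<eta> > 0" "ball 0 \<eta> \<subseteq> y -` ball y0 r"
    using open_contains_ball by blast
  define d where "d = min \<delta> \<eta>"
  have d: "d > 0" using y(1) \<eta>(1) by (simp add: d_def)
  have ball: "y t \<in> ball y0 r" if "t \<in> {-d<..<d}" for t
    using that \<eta>(2) unfolding d_def by (force simp: dist_real_def)
  then have yS: "y t \<in> S" if "t \<in> {-d<..<d}" for t using that r(2) ball_subset_cball by blast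
  have deriv: "(y has_vector_derivative F (y t)) (at t)" if "t \<in> {-d<..<d}" for t
  proof -
    have "p (y t) = y t" unfolding p_def
      using ball[OF that] by (intro closest_point_self) (auto intro: less_imp_le)
    then show ?thesis using y(4)[of t] that by (auto simp: d_def)
  qed
  have "Ck_on k y {-d<..<d}" for k
  proof (induction k)
    case 0 then show ?case using y(3) continuous_on_subset by auto
  next
    case (Suc k)
    show ?case
    proof (rule Ck_on_SucI_vector)
      show "Ck_on k (\<lambda>t. F (y t)) {-d<..<d}"
        by (rule Ck_on_compose[OF _ S]) (use yS F Suc in \<open>auto simp: smooth_on_def\<close>)
    qed (use deriv in auto)
  qed
  then have "smooth_on {-d<..<d} y" by (simp add: smooth_on_def)
  then show thesis using that[OF d y(2) _ yS deriv] by blast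
qed


section \<open>Lorentz forms and symmetry of second derivatives\<close>

lemma lorentz_form_bilinear: "lorentz_form b \<Longrightarrow> bilinear b"
  and lorentz_form_sym: "lorentz_form b \<Longrightarrow> b u v = b v u"
  by (auto simp: lorentz_form_def)

text \<open>\<open>e\<close> is the negative vector of the orthonormal basis. A vector orthogonal to
  it has no \<open>e\<close>-coordinate, so its square is the sum of the squares of the remaining
  coordinates.\<close>

lemma lorentz_form_time_vector:
  assumes "lorentz_form b"
  obtains e where "b e e = -1" "\<And>w. b w e = 0 \<Longrightarrow> w \<noteq> 0 \<Longrightarrow> b w w > 0"
proof -
  from assms have bilinear_G: "bilinear b" by (auto simp: lorentz_form_def)
  from assms obtain B e where B: "independent B" "span B = UNIV" "e \<in> B" "b e e = -1"
    "\<And>u. u \<in> B - {e} \<Longrightarrow> b u u = 1" "\<And>u v. u \<in> B \<Longrightarrow> v \<in> B \<Longrightarrow> u \<noteq> v \<Longrightarrow> b u v = 0"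
    by (auto simp: lorentz_form_def)
  have fin: "finite B" using B(1) by (rule finiteI_independent)
  have "b w w > 0" if w: "b w e = 0" "w \<noteq> 0" for w
  proof -
    have "w \<in> span B" using B(2) by simp
    then obtain r where r: "w = (\<Sum>u\<in>B. r u *\<^sub>R u)"
      unfolding span_finite[OF fin] by auto
    have bw: "b w v = r v * b v v" if v: "v \<in> B" for v
    proof -
      have lin: "linear (\<lambda>x. b x v)" using bilinear_G by (simp add: bilinear_def)
      have "b w v = (\<Sum>u\<in>B. r u * b u v)"
        unfolding r by (simp add: linear_sum[OF lin] linear_cmul[OF lin])
      also have "\<dots> = (\<Sum>u\<in>B. if u = v then r v * b v v else 0)"
        by (rule sum.cong) (use B(6) v in auto)
      finally show ?thesis using v fin by simp
    qed
    have re: "r e = 0" using bw[OF B(3)] w(1) B(4) by simp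
    have lin: "linear (b w)" using bilinear_G by (simp add: bilinear_def)
    have "b w w = (\<Sum>u\<in>B. r u * b w u)"
      by (subst (2) r) (simp add: linear_sum[OF lin] linear_cmul[OF lin])
    also have "\<dots> = (\<Sum>u\<in>B. (r u)\<^sup>2)"
      by (rule sum.cong) (use bw re B(5) in \<open>force simp: power2_eq_square\<close>)+
    finally have eq: "b w w = (\<Sum>u\<in>B. (r u)\<^sup>2)" .
    moreover have "(\<Sum>u\<in>B. (r u)\<^sup>2) \<noteq> 0"
    proof
      assume "(\<Sum>u\<in>B. (r u)\<^sup>2) = 0"
      then have "\<forall>u\<in>B. r u = 0" using fin by (simp add: sum_nonneg_eq_0_iff)
      then have "w = 0" by (simp add: r)
      then show False using w(2) by simp
    qed
    ultimately show ?thesis by (simp add: sum_nonneg order_less_le)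
  qed
  then show thesis using that B(4) by blast
qed

text \<open>If \<open>T\<close> and \<open>v\<close> were orthogonal, every combination of them
  would have nonpositive square. The combination \<open>w\<close> orthogonal to \<open>e\<close>
  would then vanish, making \<open>T\<close> and \<open>v\<close> parallel, which contradicts
  \<open>b T v = 0\<close> and \<open>b T T < 0\<close>.\<close>

lemma lorentz_form_timelike_nonspacelike:
  assumes b: "lorentz_form b" and T: "b T T < 0" and v: "b v v \<le> 0" "v \<noteq> 0"
  shows "b T v \<noteq> 0"
proof
  assume 0: "b T v = 0"
  obtain e where e: "b e e = -1" "\<And>w. b w e = 0 \<Longrightarrow> w \<noteq> 0 \<Longrightarrow> b w w > 0"
    using lorentz_form_time_vector[OF b] by blast
  note bilinear_G = lorentz_form_bilinear[OF b]
  note simps = bilinear_lsub[OF bilinear_G] bilinear_rsub[OF bilinear_G] bilinear_lmul[OF bilinear_G] bilinear_rmul[OF bilinear_G]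
  define w where "w = b v e *\<^sub>R T - b T e *\<^sub>R v"
  have T0: "T \<noteq> 0" using T bilinear_lzero[OF bilinear_G] by auto
  have "b w e = 0" unfolding w_def by (simp add: simps)
  moreover have "b w w = (b v e)\<^sup>2 * b T T + (b T e)\<^sup>2 * b v v"
    unfolding w_def using 0 lorentz_form_sym[OF b, of v T] by (simp add: simps power2_eq_square algebra_simps)
  then have "b w w \<le> 0" using T v by (simp add: add_nonpos_nonpos mult_nonneg_nonpos)
  ultimately have "w = 0" using e(2)[of w] by fastforce
  then have eq: "b v e *\<^sub>R T = b T e *\<^sub>R v" by (simp add: w_def)
  have "b T e \<noteq> 0" using e(2)[of T] T T0 by fastforce
  then have "b v e \<noteq> 0" using eq v(2) by auto
  moreover have "b v e * b T T = b T e * b T v"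
    using arg_cong[OF eq, of "b T"] by (simp add: simps)
  ultimately show False using 0 T by simp
qed

lemma lorentz_form_orthogonal_pos:
  assumes "lorentz_form b" "b T T < 0" "b T w = 0" "w \<noteq> 0"
  shows "b w w > 0"
  using lorentz_form_timelike_nonspacelike[OF assms(1,2), of w] assms(3,4) by force

lemma lorentz_form_nondegenerate:
  assumes b: "lorentz_form b" and z: "\<And>w. b z w = 0"
  shows "z = 0"
proof -
  obtain e where e: "b e e = -1" "\<And>w. b w e = 0 \<Longrightarrow> w \<noteq> 0 \<Longrightarrow> b w w > 0"
    using lorentz_form_time_vector[OF b] by blast
  show ?thesis using e(2)[of z] z[of e] z[of z] by fastforce
qed

lemma lorentz_form_eqI:
  assumes b: "lorentz_form b" and "\<And>w. b y w = b z w"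
  shows "y = z"
proof -
  have "b (y - z) w = 0" for w
    using assms(2) bilinear_lsub[OF lorentz_form_bilinear[OF b]] by simp
  then show ?thesis using lorentz_form_nondegenerate[OF b, of "y - z"] by simp
qed

text \<open>The lowering of an index: the covector \<open>b z\<close>, identified with a vector by
  means of the Euclidean inner product. This makes nondegeneracy a statement about an endomorphism,
  for which injective and surjective are the same.\<close>

definition flat_map :: "('e::euclidean_space \<Rightarrow> 'e \<Rightarrow> real) \<Rightarrow> 'e \<Rightarrow> 'e" where
  "flat_map b z = (\<Sum>w\<in>Basis. b z w *\<^sub>R w)"

lemma flat_map_inner: "w \<in> Basis \<Longrightarrow> flat_map b z \<bullet> w = b z w"
  unfolding flat_map_def by simp

lemma linear_flat_map: "bilinear b \<Longrightarrow> linear (flat_map b)"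
  unfolding flat_map_def
  by (auto intro!: linearI simp: bilinear_ladd bilinear_lmul scaleR_add_left sum.distrib scaleR_sum_right)

lemma bilinear_right_Basis:
  fixes b :: "'e::euclidean_space \<Rightarrow> 'e \<Rightarrow> real"
  shows "bilinear b \<Longrightarrow> b z w = (\<Sum>j\<in>Basis. (w \<bullet> j) * b z j)"
  using linear_eq_sum_Basis[of "b z" w] by (simp add: bilinear_def)

lemma inj_flat_map:
  assumes b: "lorentz_form b"
  shows "inj (flat_map b)"
proof (rule injI)
  fix y z assume "flat_map b y = flat_map b z"
  then have "b y w = b z w" if "w \<in> Basis" for w using that flat_map_inner by metis
  then have "b y w = b z w" for w
    using bilinear_right_Basis[OF lorentz_form_bilinear[OF b], of y w]
      bilinear_right_Basis[OF lorentz_form_bilinear[OF b], of z w] by simp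
  then show "y = z" by (rule lorentz_form_eqI[OF b])
qed

lemma lorentz_form_represent:
  assumes b: "lorentz_form b" and k: "linear k"
  shows "\<exists>!z. \<forall>w. b z w = k w"
proof -
  have "surj (flat_map b)"
    using linear_injective_imp_surjective[OF linear_flat_map[OF lorentz_form_bilinear[OF b]] inj_flat_map[OF b]]
    by simp
  then obtain z where z: "flat_map b z = (\<Sum>w\<in>Basis. k w *\<^sub>R w)" by (metis surjD)
  have "b z w = k w" if "w \<in> Basis" for w
    using flat_map_inner[OF that, of b z] that by (simp add: z)
  then have "b z w = k w" for w
    using bilinear_right_Basis[OF lorentz_form_bilinear[OF b], of z w] linear_eq_sum_Basis[OF k, of w] by simp
  then show ?thesis using lorentz_form_eqI[OF b] by metis
qed

text \<open>The first factor is of the order of the distance to \<open>x\<close> and the second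
  tends to zero. Asking only continuity of \<open>h\<close> is the point: in
  \<open>solution_has_derivative\<close> it is the vector field whose differentiability is still to
  be shown.\<close>

lemma has_derivative_mult_zero:
  fixes f h :: "'a::euclidean_space \<Rightarrow> real"
  assumes f: "(f has_derivative f') (at x)" "f x = 0" and h: "isCont h x" "h x = 0"
  shows "((\<lambda>y. f y * h y) has_derivative (\<lambda>_. 0)) (at x)"
  unfolding has_derivative_at_alt
proof (intro conjI allI impI)
  show "bounded_linear (\<lambda>_::'a. 0 :: real)" by (rule bounded_linear_zero)
  fix e :: real assume e: "e > 0"
  obtain K where K: "K \<ge> 0" "\<And>v. norm (f' v) \<le> norm v * K"
    using bounded_linear.nonneg_bounded[OF has_derivative_bounded_linear[OF f(1)]] by blast
  obtain d1 where d1: "d1 > 0" "\<And>y. norm (y - x) < d1 \<Longrightarrow> norm (f y - f x - f' (y - x)) \<le> 1 * norm (y - x)"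
    using f(1) unfolding has_derivative_at_alt by (metis zero_less_one)
  obtain d2 where d2: "d2 > 0" "\<And>y. dist y x < d2 \<Longrightarrow> dist (h y) (h x) < e / (1 + K)"
    using h(1) e K(1) unfolding continuous_at_eps_delta by (metis add_pos_nonneg divide_pos_pos zero_less_one)
  show "\<exists>d>0. \<forall>y. norm (y - x) < d \<longrightarrow> norm (f y * h y - f x * h x - 0) \<le> e * norm (y - x)"
  proof (intro exI[of _ "min d1 d2"] conjI allI impI)
    fix y assume y: "norm (y - x) < min d1 d2"
    have "norm (f y) \<le> norm (f y - f x - f' (y - x)) + norm (f' (y - x))"
      using norm_triangle_ineq[of "f y - f x - f' (y - x)" "f' (y - x)"] f(2) by simp
    also have "\<dots> \<le> (1 + K) * norm (y - x)"
      using d1(2)[of y] y K(2)[of "y - x"] by (simp add: algebra_simps)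
    finally have "norm (f y) * norm (h y) \<le> ((1 + K) * norm (y - x)) * (e / (1 + K))"
      using d2(2)[of y] y h(2) K(1) by (intro mult_mono) (auto simp: dist_norm)
    then show "norm (f y * h y - f x * h x - 0) \<le> e * norm (y - x)"
      using f(2) K(1) by (simp add: abs_mult mult.commute)
  qed (use d1 d2 in auto)
qed

text \<open>The second difference of \<open>f\<close> along \<open>s u\<close> and
  \<open>s v\<close> is symmetric in \<open>u\<close> and \<open>v\<close>. Two applications of the
  mean value theorem write it as \<open>s\<^sup>2\<close> times either mixed derivative at some
  point near \<open>x\<close>, and continuity at \<open>x\<close> brings the two values together as
  \<open>s\<close> shrinks.\<close>

lemma second_derivative_symmetric_real:
  fixes f :: "'a::euclidean_space \<Rightarrow> real"
  assumes S: "open S" "x \<in> S" and f: "smooth_on S f"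
  shows "frechet_derivative (\<lambda>y. frechet_derivative f (at y) u) (at x) v =
    frechet_derivative (\<lambda>y. frechet_derivative f (at y) v) (at x) u"
proof (rule ccontr)
  define D where "D u y = frechet_derivative f (at y) u" for u y
  define DD where "DD u v y = frechet_derivative (D u) (at y) v" for u v y
  have sD: "smooth_on S (D u)" for u unfolding D_def using smooth_on_derivative[OF f] .
  have cDD: "isCont (DD u v) x" for u v
    using smooth_on_imp_continuous_on[OF smooth_on_derivative[OF sD], of u v] S
    unfolding DD_def by (simp add: continuous_on_eq_continuous_at)
  obtain r where r: "r > 0" "ball x r \<subseteq> S" using S open_contains_ball by blast
  have dirD: "((\<lambda>t. k (p + t *\<^sub>R a)) has_real_derivative frechet_derivative k (at (p + t *\<^sub>R a)) a) (at t)"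
    if k: "smooth_on S k" and p: "p + t *\<^sub>R a \<in> S" for k p a t
  proof -
    have "(k has_derivative frechet_derivative k (at (p + t *\<^sub>R a))) (at (p + t *\<^sub>R a))"
      by (rule smooth_on_has_derivative[OF k p])
    moreover have "((\<lambda>t. p + t *\<^sub>R a) has_derivative (\<lambda>h. h *\<^sub>R a)) (at t)"
      by (auto intro!: derivative_eq_intros)
    ultimately have "((\<lambda>t. k (p + t *\<^sub>R a)) has_derivative
        (\<lambda>h. frechet_derivative k (at (p + t *\<^sub>R a)) (h *\<^sub>R a))) (at t)"
      by (rule has_derivative_compose[rotated])
    moreover have "linear (frechet_derivative k (at (p + t *\<^sub>R a)))"
      using smooth_on_has_derivative[OF k p] has_derivative_linear by blast
    ultimately show ?thesis by (simp add: has_field_derivative_def linear_cmul mult.commute[of _ "frechet_derivative k _ a"] mult_commute_abs)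
  qed
  have key: "\<exists>p. norm (p - x) \<le> s * (norm a + norm b) \<and>
      f (x + s *\<^sub>R a + s *\<^sub>R b) - f (x + s *\<^sub>R a) - f (x + s *\<^sub>R b) + f x = s\<^sup>2 * DD a b p"
    if s: "s > 0" "s * (norm a + norm b) < r" for s a b
  proof -
    have inS: "x + t *\<^sub>R a + t' *\<^sub>R b \<in> S" and nrm: "norm (t *\<^sub>R a + t' *\<^sub>R b) \<le> s * (norm a + norm b)"
      if "0 \<le> t" "t \<le> s" "0 \<le> t'" "t' \<le> s" for t t'
    proof -
      have "norm (t *\<^sub>R a + t' *\<^sub>R b) \<le> t * norm a + t' * norm b"
        using norm_triangle_ineq[of "t *\<^sub>R a" "t' *\<^sub>R b"] that by simp
      also have "\<dots> \<le> s * norm a + s * norm b" by (intro add_mono mult_right_mono) (use that in auto)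
      finally show n: "norm (t *\<^sub>R a + t' *\<^sub>R b) \<le> s * (norm a + norm b)" by (simp add: algebra_simps)
      have "dist x (x + t *\<^sub>R a + t' *\<^sub>R b) < r" using n s(2) by (simp add: dist_norm add.assoc norm_minus_commute add.commute)
      then show "x + t *\<^sub>R a + t' *\<^sub>R b \<in> S" using r(2) by (auto simp: mem_ball)
    qed
    have "\<exists>z>0. z < s \<and> (f ((x + s *\<^sub>R b) + s *\<^sub>R a) - f (x + s *\<^sub>R a)) - (f ((x + s *\<^sub>R b) + 0 *\<^sub>R a) - f (x + 0 *\<^sub>R a))
        = (s - 0) * (D a ((x + s *\<^sub>R b) + z *\<^sub>R a) - D a (x + z *\<^sub>R a))"
    proof (rule MVT2[OF s(1)])
      fix t assume t: "0 \<le> t" "t \<le> s"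
      have "(x + s *\<^sub>R b) + t *\<^sub>R a \<in> S" using inS[of t s] t s by (simp add: add_ac)
      moreover have "x + t *\<^sub>R a \<in> S" using inS[of t 0] t s by simp
      ultimately show "((\<lambda>t. f ((x + s *\<^sub>R b) + t *\<^sub>R a) - f (x + t *\<^sub>R a)) has_real_derivative
          D a ((x + s *\<^sub>R b) + t *\<^sub>R a) - D a (x + t *\<^sub>R a)) (at t)"
        unfolding D_def by (intro DERIV_diff dirD[OF f])
    qed
    then obtain z where z: "0 < z" "z < s"
      "f (x + s *\<^sub>R b + s *\<^sub>R a) - f (x + s *\<^sub>R a) - (f (x + s *\<^sub>R b) - f x)
        = s * (D a (x + s *\<^sub>R b + z *\<^sub>R a) - D a (x + z *\<^sub>R a))" by auto
    have "\<exists>z'>0. z' < s \<and> D a ((x + z *\<^sub>R a) + s *\<^sub>R b) - D a ((x + z *\<^sub>R a) + 0 *\<^sub>R b)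
        = (s - 0) * DD a b ((x + z *\<^sub>R a) + z' *\<^sub>R b)"
    proof (rule MVT2[OF s(1)])
      fix t assume t: "0 \<le> t" "t \<le> s"
      then show "((\<lambda>t. D a ((x + z *\<^sub>R a) + t *\<^sub>R b)) has_real_derivative
          DD a b ((x + z *\<^sub>R a) + t *\<^sub>R b)) (at t)"
        unfolding DD_def using inS[of z t] z by (intro dirD[OF sD]) auto
    qed
    then obtain z' where z': "0 < z'" "z' < s" "D a (x + z *\<^sub>R a + s *\<^sub>R b) - D a (x + z *\<^sub>R a)
        = s * DD a b (x + z *\<^sub>R a + z' *\<^sub>R b)" by auto
    have e: "x + s *\<^sub>R b + z *\<^sub>R a = x + z *\<^sub>R a + s *\<^sub>R b" "x + s *\<^sub>R b + s *\<^sub>R a = x + s *\<^sub>R a + s *\<^sub>R b"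
      by (simp_all add: add_ac)
    have "f (x + s *\<^sub>R a + s *\<^sub>R b) - f (x + s *\<^sub>R a) - f (x + s *\<^sub>R b) + f x
        = s * (s * DD a b (x + z *\<^sub>R a + z' *\<^sub>R b))"
      using z(3) z'(3) unfolding e by simp
    moreover have "norm (x + z *\<^sub>R a + z' *\<^sub>R b - x) \<le> s * (norm a + norm b)"
      using nrm[of z z'] z z' by (simp add: algebra_simps)
    ultimately show ?thesis by (metis power2_eq_square mult.assoc)
  qed
  assume "frechet_derivative (\<lambda>y. frechet_derivative f (at y) u) (at x) v \<noteq>
    frechet_derivative (\<lambda>y. frechet_derivative f (at y) v) (at x) u"
  then have ne: "DD u v x \<noteq> DD v u x" by (simp add: DD_def D_def[abs_def])
  \<comment> \<open>Half of the supposed gap: one common value cannot lie strictly within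
    \<open>e\<close> of both mixed derivatives.\<close>
  define e where "e = \<bar>DD u v x - DD v u x\<bar> / 2"
  have e: "e > 0" using ne by (simp add: e_def)
  obtain d1 where d1: "d1 > 0" "\<And>p. dist p x < d1 \<Longrightarrow> dist (DD u v p) (DD u v x) < e"
    using cDD e unfolding continuous_at_eps_delta by metis
  obtain d2 where d2: "d2 > 0" "\<And>p. dist p x < d2 \<Longrightarrow> dist (DD v u p) (DD v u x) < e"
    using cDD e unfolding continuous_at_eps_delta by metis
  define m where "m = Min {r, d1, d2}"
  have m: "m > 0" "m \<le> r" "m \<le> d1" "m \<le> d2" using r d1 d2 by (auto simp: m_def)
  define s where "s = m / (2 * (1 + norm u + norm v))"
  have den: "1 + norm u + norm v > 0" by (simp add: add_pos_nonneg)
  have s: "s > 0" using m den by (simp add: s_def)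
  have "norm u + norm v < 2 * (1 + norm u + norm v)" using den by (simp add: algebra_simps)
  then have "s * (norm u + norm v) < s * (2 * (1 + norm u + norm v))"
    using s by (rule mult_strict_left_mono)
  also have "\<dots> = m" using den by (simp add: s_def)
  finally have sm: "s * (norm u + norm v) < m" .
  then have sm': "s * (norm v + norm u) < m" by (simp add: add.commute)
  obtain p where p: "norm (p - x) \<le> s * (norm u + norm v)"
    "f (x + s *\<^sub>R u + s *\<^sub>R v) - f (x + s *\<^sub>R u) - f (x + s *\<^sub>R v) + f x = s\<^sup>2 * DD u v p"
    using key[of s u v] s sm m by auto
  obtain q where q: "norm (q - x) \<le> s * (norm v + norm u)"
    "f (x + s *\<^sub>R v + s *\<^sub>R u) - f (x + s *\<^sub>R v) - f (x + s *\<^sub>R u) + f x = s\<^sup>2 * DD v u q"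
    using key[of s v u] s sm' m by auto
  have e1: "x + s *\<^sub>R v + s *\<^sub>R u = x + s *\<^sub>R u + s *\<^sub>R v" by (simp add: add_ac)
  have "s\<^sup>2 * DD u v p = s\<^sup>2 * DD v u q" using p(2) q(2) unfolding e1 by linarith
  then have "DD u v p = DD v u q" using s by simp
  moreover have "dist (DD u v p) (DD u v x) < e" using d1(2)[of p] p(1) sm m by (simp add: dist_norm)
  moreover have "dist (DD v u q) (DD v u x) < e" using d2(2)[of q] q(1) sm' m by (simp add: dist_norm)
  ultimately show False by (simp add: e_def dist_real_def abs_if split: if_splits)
qed

lemma frechet_derivative_inner:
  assumes "(f has_derivative f') (at x)"
  shows "frechet_derivative (\<lambda>y. f y \<bullet> b) (at x) v = f' v \<bullet> b"
  using frechet_derivative_at[OF has_derivative_inner_left[OF assms, of b]] by metis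

lemma second_derivative_symmetric:
  fixes f :: "'a::euclidean_space \<Rightarrow> 'b::euclidean_space"
  assumes S: "open S" "x \<in> S" and f: "smooth_on S f"
  shows "frechet_derivative (\<lambda>y. frechet_derivative f (at y) u) (at x) v =
    frechet_derivative (\<lambda>y. frechet_derivative f (at y) v) (at x) u"
proof (rule euclidean_eqI)
  fix b :: 'b assume "b \<in> Basis"
  have sb: "smooth_on S (\<lambda>y. f y \<bullet> b)"
    using f Ck_on_linear_compose[OF bounded_linear_inner_left S(1)] unfolding smooth_on_def by blast
  have eq: "frechet_derivative (\<lambda>y. frechet_derivative f (at y) u) (at x) v \<bullet> b =
      frechet_derivative (\<lambda>y. frechet_derivative (\<lambda>y. f y \<bullet> b) (at y) u) (at x) v" for u v
  proof -
    have "frechet_derivative (\<lambda>y. frechet_derivative (\<lambda>y. f y \<bullet> b) (at y) u) (at x) =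
        frechet_derivative (\<lambda>y. frechet_derivative f (at y) u \<bullet> b) (at x)"
      by (rule frechet_derivative_cong_open[OF S])
        (use frechet_derivative_inner[OF smooth_on_has_derivative[OF f]] in auto)
    then show ?thesis
      using frechet_derivative_inner[OF smooth_on_has_derivative[OF smooth_on_derivative[OF f] S(2)]]
      by metis
  qed
  show "frechet_derivative (\<lambda>y. frechet_derivative f (at y) u) (at x) v \<bullet> b =
      frechet_derivative (\<lambda>y. frechet_derivative f (at y) v) (at x) u \<bullet> b"
    unfolding eq by (rule second_derivative_symmetric_real[OF S sb])
qed


section \<open>Christoffel symbols in coordinates\<close>

text \<open>Reduces bilinear fields along a varying base point to their finitely many components
  with constant arguments, the only ones whose smoothness is given.\<close>

abbreviation (input) bilinear_extension :: "('e::euclidean_space \<Rightarrow> 'e \<Rightarrow> 'f::real_vector) \<Rightarrow> 'e \<Rightarrow> 'e \<Rightarrow> 'f" where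
  "bilinear_extension c u v \<equiv> \<Sum>i\<in>Basis. \<Sum>j\<in>Basis. ((u \<bullet> i) * (v \<bullet> j)) *\<^sub>R c i j"

lemma bilinear_eq_sum_Basis:
  fixes b :: "'e::euclidean_space \<Rightarrow> 'e \<Rightarrow> 'f::real_vector"
  assumes b: "bilinear b"
  shows "b u v = bilinear_extension b u v"
proof -
  have "b u v = (\<Sum>i\<in>Basis. (u \<bullet> i) *\<^sub>R b i v)"
    using linear_eq_sum_Basis[of "\<lambda>u. b u v" u] b by (simp add: bilinear_def)
  also have "\<dots> = (\<Sum>i\<in>Basis. (u \<bullet> i) *\<^sub>R (\<Sum>j\<in>Basis. (v \<bullet> j) *\<^sub>R b i j))"
    by (intro sum.cong refl arg_cong2[where f=scaleR] linear_eq_sum_Basis)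
      (use b in \<open>simp_all add: bilinear_def\<close>)
  finally show ?thesis by (simp add: scaleR_sum_right)
qed

lemma bilinear_sum_Basis:
  fixes c :: "'e::euclidean_space \<Rightarrow> 'e \<Rightarrow> 'f::real_vector"
  shows "bilinear (\<lambda>u v. bilinear_extension c u v)"
  unfolding bilinear_def
  by (auto intro!: linearI simp: inner_simps algebra_simps sum.distrib scaleR_sum_right)

text \<open>Separates the calculus in one coordinate domain from atlases; every chart provides an
  instance through \<open>coord_metric_chart\<close>.\<close>

locale coord_metric =
  fixes S :: "'e::euclidean_space set" and G :: "'e \<Rightarrow> 'e \<Rightarrow> 'e \<Rightarrow> real"
  assumes open_S: "open S"
    and lorentz_G: "x \<in> S \<Longrightarrow> lorentz_form (G x)"
    and smooth_G: "smooth_on S (\<lambda>x. G x u v)"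
begin

definition dG :: "'e \<Rightarrow> 'e \<Rightarrow> 'e \<Rightarrow> 'e \<Rightarrow> real" where
  "dG x w u v = frechet_derivative (\<lambda>x. G x u v) (at x) w"

definition Gam :: "'e \<Rightarrow> 'e \<Rightarrow> 'e \<Rightarrow> 'e" where
  "Gam x u v = (THE z. \<forall>w. G x z w = (dG x u v w + dG x v u w - dG x w u v) / 2)"

lemma bilinear_G: "x \<in> S \<Longrightarrow> bilinear (G x)" and G_sym: "x \<in> S \<Longrightarrow> G x u v = G x v u"
  using lorentz_G lorentz_form_bilinear lorentz_form_sym by blast+

lemma G_expand:
  "x \<in> S \<Longrightarrow> G x u v = bilinear_extension (G x) u v"
  by (rule bilinear_eq_sum_Basis[OF bilinear_G])

lemma G_has_derivative: "x \<in> S \<Longrightarrow> ((\<lambda>x. G x u v) has_derivative (\<lambda>w. dG x w u v)) (at x)"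
  unfolding dG_def using smooth_on_has_derivative[OF smooth_G] .

lemma dG_expand:
  assumes x: "x \<in> S"
  shows "dG x w u v = bilinear_extension (dG x w) u v"
proof -
  have "((\<lambda>x. bilinear_extension (G x) u v) has_derivative
      (\<lambda>w. bilinear_extension (dG x w) u v)) (at x)"
    by (intro has_derivative_sum has_derivative_scaleR_right G_has_derivative x)
  moreover have "((\<lambda>x. bilinear_extension (G x) u v) has_derivative
      (\<lambda>w. dG x w u v)) (at x)"
    by (rule has_derivative_transform_within_open[OF G_has_derivative[OF x, of u v] open_S x])
      (rule G_expand)
  ultimately have "(\<lambda>w. bilinear_extension (dG x w) u v) = (\<lambda>w. dG x w u v)"
    by (rule has_derivative_unique)
  from fun_cong[OF this, of w] show ?thesis by (rule sym)
qed

lemma bilinear_dG: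
  assumes "x \<in> S"
  shows "bilinear (dG x w)"
proof -
  have eq: "dG x w = (\<lambda>u v. bilinear_extension (dG x w) u v)"
    by (intro ext dG_expand assms)
  show ?thesis by (subst eq) (rule bilinear_sum_Basis)
qed

lemma linear_dG: "x \<in> S \<Longrightarrow> linear (\<lambda>w. dG x w u v)"
  using G_has_derivative has_derivative_linear by blast

lemma smooth_dG: "smooth_on S (\<lambda>x. dG x w u v)"
  unfolding dG_def by (rule smooth_on_derivative[OF smooth_G])

lemma has_derivative_G:
  assumes X: "(X has_derivative X') (at r)" and U: "(U has_derivative U') (at r)"
    and V: "(V has_derivative V') (at r)" and r: "X r \<in> S"
  shows "((\<lambda>r. G (X r) (U r) (V r)) has_derivative
    (\<lambda>h. dG (X r) (X' h) (U r) (V r) + G (X r) (U' h) (V r) + G (X r) (U r) (V' h))) (at r)"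
proof -
  have "\<forall>\<^sub>F s in nhds r. X s \<in> S"
    using has_derivative_continuous[OF X] topological_tendstoD[OF _ open_S r, of X "nhds r"]
    by (simp add: isCont_def tendsto_at_iff_tendsto_nhds)
  then obtain N where N: "open N" "r \<in> N" "\<And>s. s \<in> N \<Longrightarrow> X s \<in> S"
    unfolding eventually_nhds by blast
  have "((\<lambda>r. G (X r) i j) has_derivative (\<lambda>h. dG (X r) (X' h) i j)) (at r)" for i j
    using has_derivative_compose[OF X G_has_derivative[OF r]] .
  then have "((\<lambda>r. bilinear_extension (G (X r)) (U r) (V r)) has_derivative
      (\<lambda>h. \<Sum>i\<in>Basis. \<Sum>j\<in>Basis. ((U r \<bullet> i) * (V r \<bullet> j)) *\<^sub>R dG (X r) (X' h) i j +
        ((U r \<bullet> i) * (V' h \<bullet> j) + (U' h \<bullet> i) * (V r \<bullet> j)) *\<^sub>R G (X r) i j)) (at r)"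
    by (intro has_derivative_sum has_derivative_scaleR has_derivative_mult
        has_derivative_inner_left U V)
  also have "(\<lambda>h. \<Sum>i\<in>Basis. \<Sum>j\<in>Basis. ((U r \<bullet> i) * (V r \<bullet> j)) *\<^sub>R dG (X r) (X' h) i j +
        ((U r \<bullet> i) * (V' h \<bullet> j) + (U' h \<bullet> i) * (V r \<bullet> j)) *\<^sub>R G (X r) i j) =
      (\<lambda>h. dG (X r) (X' h) (U r) (V r) + G (X r) (U' h) (V r) + G (X r) (U r) (V' h))"
    unfolding dG_expand[OF r, of _ "U r" "V r"] G_expand[OF r, of _ "V r"] G_expand[OF r, of "U r"]
    by (simp add: sum.distrib algebra_simps)
  finally show ?thesis
    by (rule has_derivative_transform_within_open[OF _ N(1,2)]) (rule G_expand[symmetric, OF N(3)])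
qed

lemma Ck_G:
  assumes "open R" "X ` R \<subseteq> S" "Ck_on k X R" "Ck_on k U R" "Ck_on k V R"
  shows "Ck_on k (\<lambda>r. G (X r) (U r) (V r)) R"
proof -
  have "Ck_on k (\<lambda>r. bilinear_extension (G (X r)) (U r) (V r)) R"
    using smooth_G unfolding smooth_on_def
    by (intro Ck_on_sum Ck_on_scaleR Ck_on_mult Ck_on_inner Ck_on_const assms finite_Basis
        Ck_on_compose[OF assms(1) open_S assms(2)]) auto
  moreover have "G (X r) (U r) (V r) = bilinear_extension (G (X r)) (U r) (V r)"
    if "r \<in> R" for r by (rule G_expand) (use that assms(2) in auto)
  ultimately show ?thesis using Ck_on_cong[OF assms(1)] by (metis (no_types, lifting))
qed

text \<open>Perturbation of an invertible linear system. \<open>B\<close> inverts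
  \<open>flat_map (G x)\<close>, and \<open>c y\<close> bounds the distance of
  \<open>flat_map (G y)\<close> from it. As soon as \<open>c y < 1 / (2 * \<beta>)\<close>, the
  error term is at most half of \<open>norm (Z y - Z x)\<close> and can be absorbed, leaving a bound
  by \<open>flat_map (G y) (Z y - Z x)\<close>, which tends to zero.\<close>

lemma solution_continuous:
  assumes x: "x \<in> S" and Z: "\<And>y w. y \<in> S \<Longrightarrow> G y (Z y) w = K y w"
    and K: "\<And>w. isCont (\<lambda>y. K y w) x"
  shows "isCont Z x"
    and "\<exists>B. linear B \<and> (\<forall>z. B (flat_map (G x) z) = z)"
proof -
  show ex: "\<exists>B. linear B \<and> (\<forall>z. B (flat_map (G x) z) = z)"
    using linear_injective_left_inverse[OF linear_flat_map[OF bilinear_G[OF x]] inj_flat_map[OF lorentz_G[OF x]]]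
    by (auto simp: o_def fun_eq_iff)
  then obtain B where B: "linear B" "\<And>z. B (flat_map (G x) z) = z" by blast
  obtain \<beta> where \<beta>: "\<beta> > 0" "\<And>z. norm (B z) \<le> \<beta> * norm z"
    using linear_bounded_pos[OF B(1)] by blast
  define c where "c y = (\<Sum>i\<in>Basis. \<Sum>j\<in>Basis. \<bar>G y i j - G x i j\<bar>)" for y
  have cG: "isCont (\<lambda>y. G y i j) x" for i j
    using smooth_on_imp_continuous_on[OF smooth_G] open_S x by (simp add: continuous_on_eq_continuous_at)
  have c: "(c \<longlongrightarrow> 0) (at x)"
  proof -
    have "isCont c x" unfolding c_def by (intro continuous_intros cG)
    moreover have "c x = 0" by (simp add: c_def)
    ultimately show ?thesis by (metis isCont_def)
  qed
  have flat_diff: "norm (flat_map (G y) z - flat_map (G x) z) \<le> c y * norm z" if y: "y \<in> S" for y z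
  proof -
    have "norm (flat_map (G y) z - flat_map (G x) z) = norm (\<Sum>j\<in>Basis. (G y z j - G x z j) *\<^sub>R j)"
      by (simp add: flat_map_def sum_subtractf scaleR_left_diff_distrib)
    also have "\<dots> \<le> (\<Sum>j\<in>Basis. \<bar>G y z j - G x z j\<bar>)"
      by (rule order_trans[OF norm_sum]) (simp add: sum_mono)
    also have "\<dots> \<le> (\<Sum>j\<in>Basis. \<Sum>i\<in>Basis. norm z * \<bar>G y i j - G x i j\<bar>)"
    proof (rule sum_mono)
      fix j :: 'e assume j: "j \<in> Basis"
      have "G y' z j = (\<Sum>i\<in>Basis. (z \<bullet> i) * G y' i j)" if "y' \<in> S" for y'
        using linear_eq_sum_Basis[of "\<lambda>z. G y' z j" z] bilinear_G[OF that] by (simp add: bilinear_def)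
      then have "G y z j - G x z j = (\<Sum>i\<in>Basis. (z \<bullet> i) * (G y i j - G x i j))"
        using x y by (simp add: sum_subtractf right_diff_distrib)
      also have "\<bar>\<dots>\<bar> \<le> (\<Sum>i\<in>Basis. norm z * \<bar>G y i j - G x i j\<bar>)"
        by (rule order_trans[OF sum_abs sum_mono]) (auto simp: abs_mult Basis_le_norm intro!: mult_right_mono)
      finally show "\<bar>G y z j - G x z j\<bar> \<le> (\<Sum>i\<in>Basis. norm z * \<bar>G y i j - G x i j\<bar>)" .
    qed
    also have "\<dots> = c y * norm z"
      unfolding c_def by (subst sum.swap) (simp add: sum_distrib_left[symmetric] mult.commute)
    finally show ?thesis .
  qed
  have flatZ: "flat_map (G y) (Z y) = (\<Sum>w\<in>Basis. K y w *\<^sub>R w)" if "y \<in> S" for y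
    unfolding flat_map_def using Z[OF that] by simp
  let ?d = "\<lambda>y. flat_map (G y) (Z y) - flat_map (G y) (Z x)"
  have "(?d \<longlongrightarrow> 0) (at x)"
  proof -
    have "isCont (\<lambda>y. (\<Sum>w\<in>Basis. K y w *\<^sub>R w) - flat_map (G y) (Z x)) x"
      unfolding flat_map_def using smooth_on_imp_continuous_on[OF smooth_G] open_S x
      by (intro continuous_intros K) (simp add: continuous_on_eq_continuous_at)
    then have "((\<lambda>y. (\<Sum>w\<in>Basis. K y w *\<^sub>R w) - flat_map (G y) (Z x)) \<longlongrightarrow> 0) (at x)"
      using flatZ[OF x] by (simp add: isCont_def)
    then show ?thesis
      by (rule Lim_transform_within_open[OF _ open_S x]) (simp add: flatZ)
  qed
  then have lim: "((\<lambda>y. 2 * \<beta> * norm (?d y)) \<longlongrightarrow> 0) (at x)"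
    using tendsto_mult_right_zero tendsto_norm_zero by blast
  have "\<forall>\<^sub>F y in at x. norm (Z y - Z x) \<le> 2 * \<beta> * norm (?d y)"
  proof -
    have "\<forall>\<^sub>F y in at x. c y < 1 / (2 * \<beta>)"
      using order_tendstoD(2)[OF c, of "1 / (2 * \<beta>)"] \<beta>(1) by simp
    moreover have "\<forall>\<^sub>F y in at x. y \<in> S" using open_S x by (rule eventually_at_in_open')
    ultimately show ?thesis
    proof eventually_elim
      case (elim y)
      let ?z = "Z y - Z x"
      have lin: "flat_map (G y) ?z = ?d y"
        using linear_diff[OF linear_flat_map[OF bilinear_G[OF elim(2)]]] .
      have "?z = B (flat_map (G y) ?z) - B (flat_map (G y) ?z - flat_map (G x) ?z)"
        using B linear_diff[OF B(1)] by simp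
      then have "norm ?z \<le> norm (B (flat_map (G y) ?z)) + norm (B (flat_map (G y) ?z - flat_map (G x) ?z))"
        by (metis norm_triangle_ineq4)
      also have "\<dots> \<le> \<beta> * norm (flat_map (G y) ?z) + \<beta> * (c y * norm ?z)"
        using \<beta> flat_diff[OF elim(2)] by (intro add_mono) (meson mult_left_mono less_imp_le order_trans)+
      also have "\<beta> * (c y * norm ?z) \<le> \<beta> * (1 / (2 * \<beta>) * norm ?z)"
        using elim(1) \<beta>(1) by (intro mult_left_mono mult_right_mono) auto
      also have "\<dots> = norm ?z / 2" using \<beta>(1) by simp
      finally have "norm ?z \<le> 2 * \<beta> * norm (flat_map (G y) ?z)" by simp
      then show ?case unfolding lin .
    qed
  qed
  then have "((\<lambda>y. Z y - Z x) \<longlongrightarrow> 0) (at x)" by (rule Lim_null_comparison[OF _ lim])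
  then show "isCont Z x" unfolding isCont_def by (rule Lim_null[THEN iffD2])
qed

text \<open>Freezing the metric at \<open>x\<close> gives
  \<open>flat_map (G x) (Z y - Z x) = R y - E y\<close>. Here \<open>R\<close> contains only known
  differentiable data, while each summand of \<open>E\<close> is a product of a metric difference
  and a component of \<open>Z y - Z x\<close>; both vanish at \<open>x\<close>, so \<open>E\<close>
  has derivative zero although \<open>Z\<close> is so far only continuous. The inverse
  \<open>B\<close> carries this over to \<open>Z\<close>.\<close>

lemma solution_has_derivative:
  assumes x: "x \<in> S" and Z: "\<And>y w. y \<in> S \<Longrightarrow> G y (Z y) w = K y w"
    and K: "\<And>w. ((\<lambda>y. K y w) has_derivative K' w) (at x)"
  shows "\<exists>D. (Z has_derivative D) (at x)"
proof -
  have contZ: "isCont Z x" and "\<exists>B. linear B \<and> (\<forall>z. B (flat_map (G x) z) = z)"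
    using solution_continuous[OF x Z] has_derivative_continuous[OF K] by blast+
  then obtain B where B: "linear B" "\<And>z. B (flat_map (G x) z) = z" by blast
  define R where "R y = (\<Sum>w\<in>Basis. (K y w - G y (Z x) w) *\<^sub>R w)" for y
  define E where "E y = (\<Sum>w\<in>Basis. (\<Sum>i\<in>Basis. (G y i w - G x i w) * ((Z y - Z x) \<bullet> i)) *\<^sub>R w)" for y
  have R: "(R has_derivative (\<lambda>h. \<Sum>w\<in>Basis. (K' w h - dG x h (Z x) w) *\<^sub>R w)) (at x)"
    unfolding R_def
    by (intro has_derivative_sum has_derivative_scaleR_left has_derivative_diff K G_has_derivative x)
  have "((\<lambda>y. (G y i w - G x i w) * ((Z y - Z x) \<bullet> i)) has_derivative (\<lambda>_. 0)) (at x)" for i w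
  proof (rule has_derivative_mult_zero)
    show "((\<lambda>y. G y i w - G x i w) has_derivative (\<lambda>h. dG x h i w - 0)) (at x)"
      by (intro has_derivative_diff G_has_derivative x has_derivative_const)
    show "isCont (\<lambda>y. (Z y - Z x) \<bullet> i) x" by (intro continuous_intros contZ)
  qed auto
  then have "((\<lambda>y. \<Sum>i\<in>Basis. (G y i w - G x i w) * ((Z y - Z x) \<bullet> i)) has_derivative
      (\<lambda>_. \<Sum>i\<in>(Basis::'e set). 0)) (at x)" for w
    by (rule has_derivative_sum)
  then have "(E has_derivative (\<lambda>h. \<Sum>w\<in>Basis. (\<Sum>i\<in>(Basis::'e set). 0) *\<^sub>R w)) (at x)"
    unfolding E_def by (rule has_derivative_sum[OF has_derivative_scaleR_left])
  then have E: "(E has_derivative (\<lambda>h. 0)) (at x)" by simp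
  have eq: "Z y = Z x + B (R y - E y)" if y: "y \<in> S" for y
  proof -
    have "G x (Z y - Z x) w = (K y w - G y (Z x) w) - (\<Sum>i\<in>Basis. (G y i w - G x i w) * ((Z y - Z x) \<bullet> i))" for w
    proof -
      have "(\<Sum>i\<in>Basis. (G y i w - G x i w) * ((Z y - Z x) \<bullet> i)) =
          (\<Sum>i\<in>Basis. ((Z y - Z x) \<bullet> i) *\<^sub>R G y i w) - (\<Sum>i\<in>Basis. ((Z y - Z x) \<bullet> i) *\<^sub>R G x i w)"
        by (simp only: sum_subtractf[symmetric] real_scaleR_def right_diff_distrib mult.commute)
      also have "\<dots> = G y (Z y - Z x) w - G x (Z y - Z x) w"
        by (intro arg_cong2[where f="(-)"] linear_eq_sum_Basis[symmetric])
          (use bilinear_G[OF y] bilinear_G[OF x] in \<open>simp_all add: bilinear_def\<close>)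
      finally show ?thesis using Z[OF y, of w] bilinear_lsub[OF bilinear_G[OF y]] by simp
    qed
    then have "flat_map (G x) (Z y - Z x) = R y - E y"
      unfolding flat_map_def R_def E_def by (simp add: sum_subtractf scaleR_left_diff_distrib)
    then have "Z y - Z x = B (R y - E y)" using B(2) by metis
    then show ?thesis by (simp add: algebra_simps)
  qed
  have "bounded_linear B" using B(1) by (simp add: linear_conv_bounded_linear)
  then have "\<exists>D. ((\<lambda>y. Z x + B (R y - E y)) has_derivative D) (at x)"
    using has_derivative_add[OF has_derivative_const bounded_linear.has_derivative[OF _ has_derivative_diff[OF R E]]]
    by blast
  then show ?thesis using has_derivative_transform_within_open[OF _ open_S x] eq by (metis (no_types, lifting))
qed

text \<open>Differentiating \<open>G y (Z y) w = K y w\<close> along \<open>v\<close> shows that the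
  derivative of \<open>Z\<close> solves a system of the same shape, whose right side is the
  derivative of \<open>K\<close> minus \<open>dG y v (Z y) w\<close>. The induction therefore has to
  range over all \<open>Z\<close> and \<open>K\<close>.\<close>

lemma solution_Ck:
  assumes "\<And>y w. y \<in> S \<Longrightarrow> G y (Z y) w = K y w" and "\<And>w. Ck_on k (\<lambda>y. K y w) S"
  shows "Ck_on k Z S"
  using assms
proof (induction k arbitrary: Z K)
  case 0
  then have "isCont Z x" if "x \<in> S" for x
    using solution_continuous(1)[OF that, of Z K] that open_S
    by (simp add: continuous_on_eq_continuous_at)
  then show ?case by (simp add: continuous_at_imp_continuous_on)
next
  case (Suc k)
  have Kd: "((\<lambda>y. K y w) has_derivative frechet_derivative (\<lambda>y. K y w) (at x)) (at x)" if "x \<in> S" for x w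
    using Ck_on_Suc_has_derivative[OF Suc.prems(2) that] .
  have Zd: "(Z has_derivative frechet_derivative Z (at x)) (at x)" if "x \<in> S" for x
    using solution_has_derivative[OF that Suc.prems(1) Kd[OF that]] frechet_derivative_works
    by (auto simp: differentiable_def)
  have Zk: "Ck_on k Z S" using Suc.IH[OF Suc.prems(1)] Suc.prems(2) Ck_on_SucD by blast
  show ?case
  proof (rule Ck_on_SucI[OF open_S Zd])
    fix v
    show "Ck_on k (\<lambda>x. frechet_derivative Z (at x) v) S"
    proof (rule Suc.IH)
      fix y w assume y: "y \<in> S"
      have "((\<lambda>y. G y (Z y) w) has_derivative
          (\<lambda>h. dG y h (Z y) w + G y (frechet_derivative Z (at y) h) w + G y (Z y) 0)) (at y)"
        by (rule has_derivative_G[OF has_derivative_ident Zd[OF y] has_derivative_const y])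
      moreover have "((\<lambda>y. G y (Z y) w) has_derivative frechet_derivative (\<lambda>y. K y w) (at y)) (at y)"
        by (rule has_derivative_transform_within_open[OF Kd[OF y] open_S y]) (simp add: Suc.prems(1))
      ultimately have "(\<lambda>h. dG y h (Z y) w + G y (frechet_derivative Z (at y) h) w + G y (Z y) 0) =
          frechet_derivative (\<lambda>y. K y w) (at y)"
        by (rule has_derivative_unique)
      from fun_cong[OF this, of v] show "G y (frechet_derivative Z (at y) v) w =
          frechet_derivative (\<lambda>y. K y w) (at y) v + (\<Sum>i\<in>Basis. (Z y \<bullet> i) *\<^sub>R (-1) *\<^sub>R dG y v i w)"
        using linear_eq_sum_Basis[of "\<lambda>z. dG y v z w" "Z y"] bilinear_dG[OF y, of v] bilinear_rzero[OF bilinear_G[OF y]]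
        by (simp add: bilinear_def sum_negf)
    next
      fix w
      show "Ck_on k (\<lambda>y. frechet_derivative (\<lambda>y. K y w) (at y) v +
          (\<Sum>i\<in>Basis. (Z y \<bullet> i) *\<^sub>R (-1) *\<^sub>R dG y v i w)) S"
        using Suc.prems(2)[of w] smooth_dG unfolding smooth_on_def
        by (intro Ck_on_add Ck_on_sum Ck_on_scaleR Ck_on_inner Ck_on_const Zk open_S) auto
    qed
  qed
qed

section \<open>Existence, smoothness and bilinearity of the Christoffel symbols\<close>

lemma Gam_spec:
  assumes x: "x \<in> S"
  shows "G x (Gam x u v) w = (dG x u v w + dG x v u w - dG x w u v) / 2"
proof -
  have lin: "linear (dG x u v)" "linear (dG x v u)"
    using bilinear_dG[OF x] by (auto simp: bilinear_def)
  have "linear (\<lambda>w. (dG x u v w + dG x v u w - dG x w u v) / 2)"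
    by (rule linearI)
      (simp_all add: linear_add[OF lin(1)] linear_add[OF lin(2)] linear_add[OF linear_dG[OF x]]
        linear_cmul[OF lin(1)] linear_cmul[OF lin(2)] linear_cmul[OF linear_dG[OF x]] field_simps)
  then have "\<exists>!z. \<forall>w. G x z w = (dG x u v w + dG x v u w - dG x w u v) / 2"
    by (rule lorentz_form_represent[OF lorentz_G[OF x]])
  from theI'[OF this] show ?thesis unfolding Gam_def by blast
qed

lemma smooth_Gam: "smooth_on S (\<lambda>x. Gam x u v)"
  unfolding smooth_on_def
proof
  fix k
  have "Ck_on k (\<lambda>x. (1/2) *\<^sub>R (dG x u v w + dG x v u w + (-1) *\<^sub>R dG x w u v)) S" for w
    using smooth_dG unfolding smooth_on_def
    by (intro Ck_on_add Ck_on_scaleR Ck_on_const open_S) auto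
  then show "Ck_on k (\<lambda>x. Gam x u v) S"
    by (rule solution_Ck[rotated]) (simp add: Gam_spec)
qed

lemma bilinear_Gam:
  assumes x: "x \<in> S"
  shows "bilinear (Gam x)"
  unfolding bilinear_def
proof (intro conjI allI)
  note s = Gam_spec[OF x] bilinear_ladd[OF bilinear_G[OF x]] bilinear_lmul[OF bilinear_G[OF x]]
    bilinear_ladd[OF bilinear_dG[OF x]] bilinear_lmul[OF bilinear_dG[OF x]]
    bilinear_radd[OF bilinear_dG[OF x]] bilinear_rmul[OF bilinear_dG[OF x]]
    linear_add[OF linear_dG[OF x]] linear_cmul[OF linear_dG[OF x]]
  show "linear (\<lambda>y. Gam x u y)" for u
    by (intro linearI lorentz_form_eqI[OF lorentz_G[OF x]]) (simp_all add: s field_simps)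
  show "linear (\<lambda>y. Gam x y v)" for v
    by (intro linearI lorentz_form_eqI[OF lorentz_G[OF x]]) (simp_all add: s field_simps)
qed

lemma Gam_expand:
  "x \<in> S \<Longrightarrow> Gam x u v = bilinear_extension (Gam x) u v"
  by (rule bilinear_eq_sum_Basis[OF bilinear_Gam])

text \<open>The Euler--Lagrange form of the geodesic equation, which is manifestly covariant.\<close>

lemma geodesic_iff:
  assumes x: "x \<in> S"
  shows "a + Gam x v v = 0 \<longleftrightarrow> (\<forall>w. G x a w + dG x v v w - dG x w v v / 2 = 0)"
proof -
  have eq: "G x (a + Gam x v v) w = G x a w + dG x v v w - dG x w v v / 2" for w
    by (simp add: bilinear_ladd[OF bilinear_G[OF x]] Gam_spec[OF x])
  show ?thesis
  proof
    assume "a + Gam x v v = 0"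
    then show "\<forall>w. G x a w + dG x v v w - dG x w v v / 2 = 0"
      using eq bilinear_lzero[OF bilinear_G[OF x]] by metis
  next
    assume "\<forall>w. G x a w + dG x v v w - dG x w v v / 2 = 0"
    then show "a + Gam x v v = 0"
      using lorentz_form_nondegenerate[OF lorentz_G[OF x]] eq by metis
  qed
qed

end

text \<open>Both equations are compared in Euler--Lagrange form. Differentiating the isometry
  relation creates terms with second derivatives of \<open>\<phi>\<close>: one of them joins
  \<open>P a\<close>, and the other, \<open>G2 (P v) (Q w v)\<close>, cancels against half of those
  in \<open>dG x w v v\<close> by symmetry of second derivatives. Testing with vectors
  \<open>P w\<close> is enough because nondegeneracy makes \<open>P\<close> injective, hence
  onto.\<close>

lemma geodesic_covariant:
  fixes \<phi> :: "'e::euclidean_space \<Rightarrow> 'e"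
  assumes c1: "coord_metric S1 G1" and c2: "coord_metric S2 G2"
    and R: "open R" "R \<subseteq> S1" "\<phi> ` R \<subseteq> S2" "smooth_on R \<phi>" "x \<in> R"
    and iso: "\<And>y u w. y \<in> R \<Longrightarrow> G1 y u w =
        G2 (\<phi> y) (frechet_derivative \<phi> (at y) u) (frechet_derivative \<phi> (at y) w)"
    and geo: "a + coord_metric.Gam G1 x v v = 0"
  shows "frechet_derivative \<phi> (at x) a +
      frechet_derivative (\<lambda>y. frechet_derivative \<phi> (at y) v) (at x) v +
      coord_metric.Gam G2 (\<phi> x) (frechet_derivative \<phi> (at x) v) (frechet_derivative \<phi> (at x) v) = 0"
proof -
  interpret M1: coord_metric S1 G1 by fact
  interpret M2: coord_metric S2 G2 by fact
  define P where "P = frechet_derivative \<phi> (at x)"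
  define Q where "Q u = frechet_derivative (\<lambda>y. frechet_derivative \<phi> (at y) u) (at x)" for u
  have x1: "x \<in> S1" and x2: "\<phi> x \<in> S2" using R by auto
  note b2 = M2.bilinear_G[OF x2] and b1 = M1.bilinear_G[OF x1]
  have \<phi>: "(\<phi> has_derivative P) (at x)" unfolding P_def by (rule smooth_on_has_derivative[OF R(4,5)])
  have d\<phi>: "((\<lambda>y. frechet_derivative \<phi> (at y) u) has_derivative Q u) (at x)" for u
    unfolding Q_def by (rule smooth_on_has_derivative[OF smooth_on_derivative[OF R(4)] R(5)])
  have Qsym: "Q u w = Q w u" for u w
    unfolding Q_def by (rule second_derivative_symmetric[OF R(1,5,4)])
  have isox: "G1 x u w = G2 (\<phi> x) (P u) (P w)" for u w unfolding P_def using iso[OF R(5)] .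
  have d: "M1.dG x h u w = M2.dG (\<phi> x) (P h) (P u) (P w) + G2 (\<phi> x) (Q u h) (P w) + G2 (\<phi> x) (P u) (Q w h)"
    for h u w
  proof -
    have "((\<lambda>y. G2 (\<phi> y) (frechet_derivative \<phi> (at y) u) (frechet_derivative \<phi> (at y) w)) has_derivative
      (\<lambda>h. M2.dG (\<phi> x) (P h) (P u) (P w) + G2 (\<phi> x) (Q u h) (P w) + G2 (\<phi> x) (P u) (Q w h))) (at x)"
      using M2.has_derivative_G[OF \<phi> d\<phi> d\<phi> x2, of u w] unfolding P_def by simp
    then have "((\<lambda>y. G1 y u w) has_derivative
      (\<lambda>h. M2.dG (\<phi> x) (P h) (P u) (P w) + G2 (\<phi> x) (Q u h) (P w) + G2 (\<phi> x) (P u) (Q w h))) (at x)"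
      by (rule has_derivative_transform_within_open[OF _ R(1,5)]) (simp add: iso)
    from fun_cong[OF has_derivative_unique[OF M1.G_has_derivative[OF x1] this]] show ?thesis .
  qed
  have linP: "linear P" using \<phi> has_derivative_linear by blast
  have "inj P"
  proof (rule injI)
    fix y z assume "P y = P z"
    then have "G1 x y w = G1 x z w" for w using isox by simp
    then show "y = z" by (rule lorentz_form_eqI[OF M1.lorentz_G[OF x1]])
  qed
  then have "surj P" using linear_injective_imp_surjective linP by blast
  have "G2 (\<phi> x) (P a + Q v v) (P w) + M2.dG (\<phi> x) (P v) (P v) (P w) - M2.dG (\<phi> x) (P w) (P v) (P v) / 2 = 0"
    for w
  proof -
    have "G1 x a w + M1.dG x v v w - M1.dG x w v v / 2 = 0"
      using geo M1.geodesic_iff[OF x1] by blast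
    then show ?thesis
      unfolding d isox bilinear_ladd[OF b2] using Qsym[of w v] M2.G_sym[OF x2, of "P v" "Q v w"] by simp
  qed
  then have "G2 (\<phi> x) (P a + Q v v) w + M2.dG (\<phi> x) (P v) (P v) w - M2.dG (\<phi> x) w (P v) (P v) / 2 = 0" for w
    using \<open>surj P\<close> by (metis surjD)
  then have "(P a + Q v v) + M2.Gam (\<phi> x) (P v) (P v) = 0"
    using M2.geodesic_iff[OF x2] by blast
  then show ?thesis unfolding P_def Q_def .
qed


section \<open>Geodesics in charts\<close>

context smooth_manifold
begin

lemma inv_coord_coord: "c \<in> \<A> \<Longrightarrow> p \<in> fst c \<Longrightarrow> inv_coord c (snd c p) = p"
  using chart_homeomorphism homeomorphism_apply1 by blast

lemma coord_inv_coord: "c \<in> \<A> \<Longrightarrow> x \<in> codom c \<Longrightarrow> snd c (inv_coord c x) = x"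
  using chart_homeomorphism homeomorphism_apply2 by blast

lemma coord_in_codom: "p \<in> fst c \<Longrightarrow> snd c p \<in> codom c"
  unfolding codom_def by blast

lemma inv_coord_in_dom: "c \<in> \<A> \<Longrightarrow> x \<in> codom c \<Longrightarrow> inv_coord c x \<in> fst c"
  using chart_homeomorphism homeomorphism_image2 by blast

lemma continuous_on_coord: "c \<in> \<A> \<Longrightarrow> continuous_on (fst c) (snd c)"
  using chart_homeomorphism homeomorphism_cont1 by blast

lemma continuous_on_inv_coord: "c \<in> \<A> \<Longrightarrow> continuous_on (codom c) (inv_coord c)"
  using chart_homeomorphism homeomorphism_cont2 by blast

lemma chart_at:
  obtains c where "c \<in> \<A>" "p \<in> fst c"
  using atlas_covers by blast

lemma open_coord_vimage: "c \<in> \<A> \<Longrightarrow> open B \<Longrightarrow> open (snd c -` B \<inter> fst c)"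
  using continuous_on_open_vimage[OF open_dom] continuous_on_coord by blast

lemma open_inv_coord_vimage: "c \<in> \<A> \<Longrightarrow> open W \<Longrightarrow> open (inv_coord c -` W \<inter> codom c)"
  using continuous_on_open_vimage[OF open_codom] continuous_on_inv_coord by blast

lemma coord_overlap:
  "c \<in> \<A> \<Longrightarrow> snd c ` (fst c \<inter> fst d) = {x \<in> codom c. inv_coord c x \<in> fst d}"
  unfolding codom_def by (auto simp: inv_coord_coord)

lemma open_overlap:
  assumes "c \<in> \<A>" "d \<in> \<A>"
  shows "open (snd c ` (fst c \<inter> fst d))"
proof -
  have "open (inv_coord c -` fst d \<inter> codom c)"
    by (rule open_inv_coord_vimage[OF assms(1) open_dom[OF assms(2)]])
  moreover have "{x \<in> codom c. inv_coord c x \<in> fst d} = inv_coord c -` fst d \<inter> codom c" by auto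
  ultimately show ?thesis by (simp only: coord_overlap[OF assms(1)])
qed

end

section \<open>The geodesic equation in one chart and its change of coordinates\<close>

context lorentz_manifold
begin

definition coord_g :: "('a, 'e) chart \<Rightarrow> 'e \<Rightarrow> 'e \<Rightarrow> 'e \<Rightarrow> real" where
  "coord_g c x u v = g c (inv_coord c x) u v"

abbreviation Gamma :: "('a, 'e) chart \<Rightarrow> 'e \<Rightarrow> 'e \<Rightarrow> 'e \<Rightarrow> 'e" where
  "Gamma c \<equiv> coord_metric.Gam (coord_g c)"

lemma coord_g_coord: "c \<in> \<A> \<Longrightarrow> p \<in> fst c \<Longrightarrow> coord_g c (snd c p) = g c p"
  by (simp add: coord_g_def fun_eq_iff inv_coord_coord)

lemma coord_metric_chart:
  assumes c: "c \<in> \<A>"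
  shows "coord_metric (codom c) (coord_g c)"
proof
  show "open (codom c)" by (rule open_codom[OF c])
  show "lorentz_form (coord_g c x)" if "x \<in> codom c" for x
    using lorentz[OF c inv_coord_in_dom[OF c that]] by (simp add: coord_g_def[abs_def])
  show "smooth_on (codom c) (\<lambda>x. coord_g c x u v)" for u v
    unfolding coord_g_def by (rule smooth_metric[OF c])
qed

lemma christoffel_eq:
  assumes c: "c \<in> \<A>" and p: "p \<in> fst c"
  shows "christoffel c p u v = Gamma c (snd c p) u v"
proof -
  interpret coord_metric "codom c" "coord_g c" by (rule coord_metric_chart[OF c])
  have "metric_deriv c p w u v = dG (snd c p) w u v" for w u v
    unfolding metric_deriv_def dG_def coord_g_def ..
  then show ?thesis
    unfolding christoffel_def Gam_def coord_g_coord[OF c p] by simp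
qed

text \<open>The geodesic equation in a single chart, as a first order system for coordinates
  \<open>X\<close> and velocity \<open>V\<close>. In contrast to \<open>geodesic_on\<close>, the
  derivatives are stated as relations, only one chart occurs, and \<open>N\<close> is any open set
  of parameters.\<close>

definition geodesic_in ::
  "('a, 'e) chart \<Rightarrow> real set \<Rightarrow> (real \<Rightarrow> 'a) \<Rightarrow> (real \<Rightarrow> 'e) \<Rightarrow> (real \<Rightarrow> 'e) \<Rightarrow> bool" where
  "geodesic_in c N \<gamma> X V \<longleftrightarrow> c \<in> \<A> \<and> open N \<and> smooth_on N X \<and>
     (\<forall>s\<in>N. \<gamma> s \<in> fst c \<and> snd c (\<gamma> s) = X s \<and> (X has_vector_derivative V s) (at s) \<and>
        (V has_vector_derivative - Gamma c (X s) (V s) (V s)) (at s))"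

lemma geodesic_inD:
  assumes "geodesic_in c N \<gamma> X V"
  shows "c \<in> \<A>" "open N" "smooth_on N X"
    and "s \<in> N \<Longrightarrow> \<gamma> s \<in> fst c" "s \<in> N \<Longrightarrow> snd c (\<gamma> s) = X s" "s \<in> N \<Longrightarrow> X s \<in> codom c"
    and "s \<in> N \<Longrightarrow> (X has_vector_derivative V s) (at s)"
    and "s \<in> N \<Longrightarrow> (V has_vector_derivative - Gamma c (X s) (V s) (V s)) (at s)"
    and "s \<in> N \<Longrightarrow> \<gamma> s = inv_coord c (X s)"
  using assms coord_in_codom[of "\<gamma> s" c] inv_coord_coord unfolding geodesic_in_def by metis+

lemma geodesic_in_cong:
  "geodesic_in c N \<gamma> X V \<Longrightarrow> (\<And>s. s \<in> N \<Longrightarrow> \<eta> s = \<gamma> s) \<Longrightarrow> geodesic_in c N \<eta> X V"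
  unfolding geodesic_in_def by simp

lemma geodesic_in_change_chart:
  assumes geo: "geodesic_in c N \<gamma> X V" and d: "d \<in> \<A>" and M: "open M" "M \<subseteq> N" "\<And>s. s \<in> M \<Longrightarrow> \<gamma> s \<in> fst d"
  shows "geodesic_in d M \<gamma> (\<lambda>s. (snd d \<circ> inv_coord c) (X s)) (\<lambda>s. transition_deriv c d (\<gamma> s) (V s))"
proof -
  note D = geodesic_inD[OF geo]
  have c: "c \<in> \<A>" by (rule D)
  define \<phi> where "\<phi> = snd d \<circ> inv_coord c"
  define R where "R = snd c ` (fst c \<inter> fst d)"
  have oR: "open R" unfolding R_def by (rule open_overlap[OF c d])
  have R1: "R \<subseteq> codom c" unfolding R_def codom_def by blast
  have R2: "\<phi> ` R \<subseteq> codom d"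
    unfolding R_def \<phi>_def codom_def using inv_coord_coord[OF c] by auto
  have s\<phi>: "smooth_on R \<phi>" unfolding R_def \<phi>_def by (rule smooth_transition[OF c d])
  have XR: "X s \<in> R" if "s \<in> M" for s
    using D(4,5)[of s] M that unfolding R_def by (metis IntI imageI subsetD)
  have iso: "coord_g c y u w = coord_g d (\<phi> y) (frechet_derivative \<phi> (at y) u) (frechet_derivative \<phi> (at y) w)"
    if y: "y \<in> R" for y u w
  proof -
    obtain p where p: "p \<in> fst c \<inter> fst d" "y = snd c p" using y unfolding R_def by blast
    have "\<phi> y = snd d p" unfolding \<phi>_def p(2) using inv_coord_coord[OF c] p(1) by simp
    then show ?thesis
      using metric_transform[OF c d p(1), of u w] coord_g_coord[OF c, of p] coord_g_coord[OF d, of p] p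
      by (simp add: transition_deriv_def \<phi>_def)
  qed
  have td: "transition_deriv c d (\<gamma> s) = frechet_derivative \<phi> (at (X s))" if "s \<in> M" for s
    unfolding transition_deriv_def \<phi>_def using D(5)[of s] M that by auto
  show ?thesis unfolding geodesic_in_def
  proof (intro conjI ballI)
    show "d \<in> \<A>" "open M" by fact+
    have "smooth_on M X" using D(3) M smooth_on_subset by blast
    then have "smooth_on M (\<lambda>s. \<phi> (X s))"
      by (intro smooth_on_compose[OF M(1) oR _ s\<phi>]) (use XR in auto)
    then show "smooth_on M (\<lambda>s. (snd d \<circ> inv_coord c) (X s))" unfolding \<phi>_def .
    fix s assume s: "s \<in> M"
    then have sN: "s \<in> N" using M by blast
    show "\<gamma> s \<in> fst d" using M s by blast
    show "snd d (\<gamma> s) = (snd d \<circ> inv_coord c) (X s)" using D(9)[OF sN] by simp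
    have X': "(X has_derivative (\<lambda>h. h *\<^sub>R V s)) (at s)"
      using D(7)[OF sN] by (simp add: has_vector_derivative_def)
    have \<phi>': "(\<phi> has_derivative frechet_derivative \<phi> (at (X s))) (at (X s))"
      by (rule smooth_on_has_derivative[OF s\<phi> XR[OF s]])
    have lin: "linear (frechet_derivative \<phi> (at (X s)))" using \<phi>' has_derivative_linear by blast
    have "((\<lambda>s. \<phi> (X s)) has_vector_derivative transition_deriv c d (\<gamma> s) (V s)) (at s)"
      using has_derivative_compose[OF X' \<phi>'] unfolding td[OF s]
      by (simp add: has_vector_derivative_def linear_cmul[OF lin])
    then show "((\<lambda>s. (snd d \<circ> inv_coord c) (X s)) has_vector_derivative transition_deriv c d (\<gamma> s) (V s)) (at s)"
      unfolding \<phi>_def .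
    let ?P = "frechet_derivative \<phi> (at (X s))"
    define Q where "Q u = frechet_derivative (\<lambda>y. frechet_derivative \<phi> (at y) u) (at (X s))" for u
    have Q: "((\<lambda>y. frechet_derivative \<phi> (at y) u) has_derivative Q u) (at (X s))" for u
      unfolding Q_def by (rule smooth_on_has_derivative[OF smooth_on_derivative[OF s\<phi>] XR[OF s]])
    have Qsym: "Q u w = Q w u" for u w
      unfolding Q_def by (rule second_derivative_symmetric[OF oR XR[OF s] s\<phi>])
    define a where "a = - Gamma c (X s) (V s) (V s)"
    have V': "(V has_derivative (\<lambda>h. h *\<^sub>R a)) (at s)"
      using D(8)[OF sN] by (simp add: has_vector_derivative_def a_def)
    \<comment> \<open>This sum is the velocity in chart \<open>d\<close>. With \<open>V r\<close>
      expanded in the basis, the Jacobian of \<open>\<phi>\<close> is differentiated in fixed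
      directions only; symmetry of \<open>Q\<close> afterwards collects the second order terms into
      \<open>Q (V s) (V s)\<close>.\<close>
    have "((\<lambda>r. \<Sum>i\<in>Basis. (V r \<bullet> i) *\<^sub>R frechet_derivative \<phi> (at (X r)) i) has_derivative
        (\<lambda>h. \<Sum>i\<in>Basis. (V s \<bullet> i) *\<^sub>R Q i (h *\<^sub>R V s) + ((h *\<^sub>R a) \<bullet> i) *\<^sub>R ?P i)) (at s)"
      by (intro has_derivative_sum has_derivative_scaleR has_derivative_inner_left V'
          has_derivative_compose[OF X' Q])
    also have "(\<lambda>h. \<Sum>i\<in>Basis. (V s \<bullet> i) *\<^sub>R Q i (h *\<^sub>R V s) + ((h *\<^sub>R a) \<bullet> i) *\<^sub>R ?P i)
        = (\<lambda>h. h *\<^sub>R (?P a + Q (V s) (V s)))"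
    proof
      fix h
      have linQ: "linear (Q u)" for u using Q has_derivative_linear by blast
      have "(\<Sum>i\<in>Basis. (V s \<bullet> i) *\<^sub>R Q i (h *\<^sub>R V s)) = (\<Sum>i\<in>Basis. (V s \<bullet> i) *\<^sub>R Q (h *\<^sub>R V s) i)"
        by (intro sum.cong refl) (simp add: Qsym)
      also have "\<dots> = Q (h *\<^sub>R V s) (V s)" by (rule linear_eq_sum_Basis[OF linQ, symmetric])
      also have "\<dots> = h *\<^sub>R Q (V s) (V s)" by (subst Qsym) (simp add: linear_cmul[OF linQ])
      finally have 1: "(\<Sum>i\<in>Basis. (V s \<bullet> i) *\<^sub>R Q i (h *\<^sub>R V s)) = h *\<^sub>R Q (V s) (V s)" .
      have "(\<Sum>i\<in>Basis. ((h *\<^sub>R a) \<bullet> i) *\<^sub>R ?P i) = h *\<^sub>R ?P a"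
        using linear_eq_sum_Basis[OF lin, of "h *\<^sub>R a"] linear_cmul[OF lin, of h a] by simp
      with 1 show "(\<Sum>i\<in>Basis. (V s \<bullet> i) *\<^sub>R Q i (h *\<^sub>R V s) + ((h *\<^sub>R a) \<bullet> i) *\<^sub>R ?P i)
          = h *\<^sub>R (?P a + Q (V s) (V s))"
        by (simp add: sum.distrib scaleR_add_right)
    qed
    finally have "((\<lambda>r. \<Sum>i\<in>Basis. (V r \<bullet> i) *\<^sub>R frechet_derivative \<phi> (at (X r)) i) has_vector_derivative
        (?P a + Q (V s) (V s))) (at s)"
      by (simp add: has_vector_derivative_def)
    then have "((\<lambda>r. transition_deriv c d (\<gamma> r) (V r)) has_vector_derivative
        (?P a + Q (V s) (V s))) (at s)"
    proof (rule has_vector_derivative_transform_within_open[OF _ M(1) s])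
      fix r assume r: "r \<in> M"
      have "linear (frechet_derivative \<phi> (at (X r)))"
        using smooth_on_has_derivative[OF s\<phi> XR[OF r]] has_derivative_linear by blast
      then show "(\<Sum>i\<in>Basis. (V r \<bullet> i) *\<^sub>R frechet_derivative \<phi> (at (X r)) i) = transition_deriv c d (\<gamma> r) (V r)"
        unfolding td[OF r] by (rule linear_eq_sum_Basis[symmetric])
    qed
    moreover have "?P a + Q (V s) (V s) +
        Gamma d (\<phi> (X s)) (transition_deriv c d (\<gamma> s) (V s)) (transition_deriv c d (\<gamma> s) (V s)) = 0"
      unfolding td[OF s] Q_def
      by (rule geodesic_covariant[OF coord_metric_chart[OF c] coord_metric_chart[OF d] oR R1 R2 s\<phi> XR[OF s]])
        (use iso in \<open>auto simp: a_def\<close>)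
    ultimately show "((\<lambda>r. transition_deriv c d (\<gamma> r) (V r)) has_vector_derivative
        - Gamma d ((snd d \<circ> inv_coord c) (X s)) (transition_deriv c d (\<gamma> s) (V s)) (transition_deriv c d (\<gamma> s) (V s))) (at s)"
      unfolding \<phi>_def by (simp only: eq_neg_iff_add_eq_0[symmetric])
  qed
qed

lemma geodesic_in_coord:
  assumes geo: "geodesic_in c N \<gamma> X V" and s: "s \<in> N"
  shows "((snd c \<circ> \<gamma>) has_vector_derivative V s) (at s)"
  by (rule has_vector_derivative_transform_within_open[OF geodesic_inD(7)[OF geo s] geodesic_inD(2)[OF geo] s])
    (simp add: geodesic_inD(5)[OF geo])

lemma geodesic_in_velocity_within:
  assumes geo: "geodesic_in c N \<gamma> X V" and s: "s \<in> N" "s \<in> J" and "at s within J \<noteq> bot"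
  shows "velocity c J \<gamma> s = V s"
  unfolding velocity_def
  by (rule vector_derivative_within[OF assms(4)])
    (rule has_vector_derivative_at_within[OF geodesic_in_coord[OF geo s(1)]])

lemma geodesic_in_velocity:
  assumes geo: "geodesic_in c N \<gamma> X V" and s: "s \<in> N" "s \<in> I" "open I"
  shows "velocity c I \<gamma> s = V s"
  by (rule geodesic_in_velocity_within[OF geo s(1,2)])
    (use s in \<open>simp add: at_within_open[of s I]\<close>)

lemma geodesic_on_imp_in:
  assumes geo: "geodesic_on I \<gamma>" and t: "t \<in> I" and c: "c \<in> \<A>" "\<gamma> t \<in> fst c"
  obtains N X V where "geodesic_in c N \<gamma> X V" "t \<in> N" "N \<subseteq> I"
proof -
  have I: "open I" "smooth_curve_on I \<gamma>" using geo unfolding geodesic_on_def by auto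
  from I(2)[unfolded smooth_curve_on_def, rule_format, OF t c]
  obtain N f where N: "open N" "t \<in> N" "smooth_on N f"
    "\<And>s. s \<in> I \<inter> N \<Longrightarrow> \<gamma> s \<in> fst c \<and> snd c (\<gamma> s) = f s" by auto
  define V where "V s = frechet_derivative f (at s) 1" for s
  have f: "(f has_vector_derivative V s) (at s)" if "s \<in> N" for s
    unfolding V_def by (rule smooth_on_has_vector_derivative[OF N(3) that])
  have sV: "smooth_on N V" unfolding V_def by (rule smooth_on_derivative[OF N(3)])
  have oIN: "open (I \<inter> N)" using I N by blast
  have vel: "velocity c I \<gamma> s = V s" if s: "s \<in> I \<inter> N" for s
  proof -
    have "((snd c \<circ> \<gamma>) has_vector_derivative V s) (at s)"
      by (rule has_vector_derivative_transform_within_open[of f _ _ "I \<inter> N"])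
        (use s f oIN N(4) in auto)
    then have "((snd c \<circ> \<gamma>) has_vector_derivative V s) (at s within I)" by (rule has_vector_derivative_at_within)
    then show ?thesis unfolding velocity_def
      using s I(1) by (intro vector_derivative_within) (auto simp: at_within_open[of s I])
  qed
  have "geodesic_in c (I \<inter> N) \<gamma> f V" unfolding geodesic_in_def
  proof (intro conjI ballI)
    show "smooth_on (I \<inter> N) f" using N(3) smooth_on_subset by blast
    fix s assume s: "s \<in> I \<inter> N"
    then show "\<gamma> s \<in> fst c" "snd c (\<gamma> s) = f s" "(f has_vector_derivative V s) (at s)"
      using N(4) f by auto
    define A where "A = frechet_derivative V (at s) 1"
    have A: "(V has_vector_derivative A) (at s)"
      unfolding A_def using smooth_on_has_vector_derivative[OF sV] s by blast
    have "(velocity c I \<gamma> has_vector_derivative A) (at s)"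
      by (rule has_vector_derivative_transform_within_open[OF A oIN s]) (simp add: vel)
    then have "vector_derivative (velocity c I \<gamma>) (at s) = A" by (rule vector_derivative_at)
    moreover have "vector_derivative (velocity c I \<gamma>) (at s) +
        christoffel c (\<gamma> s) (velocity c I \<gamma> s) (velocity c I \<gamma> s) = 0"
      using geo s c N(4) unfolding geodesic_on_def by blast
    ultimately have "A + Gamma c (f s) (V s) (V s) = 0"
      using vel[OF s] christoffel_eq[OF c(1)] N(4)[OF s] by simp
    then show "(V has_vector_derivative - Gamma c (f s) (V s) (V s)) (at s)"
      using A by (metis eq_neg_iff_add_eq_0)
  qed (use c oIN in auto)
  then show thesis using that[of "I \<inter> N" f V] t N(2) by blast
qed

text \<open>By covariance it suffices to check the equation in one chart around each parameter,
  whereas \<open>geodesic_on\<close> demands it in every chart of the atlas.\<close>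

lemma geodesic_onI:
  assumes I: "open I" "is_interval I" "I \<noteq> {}"
    and loc: "\<And>t. t \<in> I \<Longrightarrow> \<exists>c N X V. geodesic_in c N \<gamma> X V \<and> t \<in> N"
  shows "geodesic_on I \<gamma>"
proof -
  have loc': "\<exists>N X V. geodesic_in d N \<gamma> X V \<and> t \<in> N \<and> N \<subseteq> I" if t: "t \<in> I" and d: "d \<in> \<A>" "\<gamma> t \<in> fst d" for t d
  proof -
    obtain c N X V where g: "geodesic_in c N \<gamma> X V" "t \<in> N" using loc[OF t] by blast
    define R where "R = snd c ` (fst c \<inter> fst d)"
    have c: "c \<in> \<A>" using geodesic_inD[OF g(1)] by blast
    define M where "M = N \<inter> I \<inter> X -` R"
    have "continuous_on N X" using geodesic_inD(3)[OF g(1)] smooth_on_imp_continuous_on by blast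
    then have "open (X -` R \<inter> N)"
      using geodesic_inD(2)[OF g(1)] open_overlap[OF c d(1)] continuous_on_open_vimage
      unfolding R_def by blast
    then have M: "open M" unfolding M_def using I(1) by (metis Int_assoc Int_commute open_Int)
    have "t \<in> M" using g(2) t d geodesic_inD(4,5)[OF g] unfolding M_def R_def by (auto intro: rev_image_eqI)
    moreover have "\<gamma> s \<in> fst d" if "s \<in> M" for s
      using that geodesic_inD(4,9)[OF g(1), of s] coord_overlap[OF c, of d]
      unfolding M_def R_def by auto
    ultimately show ?thesis
      using geodesic_in_change_chart[OF g(1) d(1) M] unfolding M_def by blast
  qed
  show ?thesis unfolding geodesic_on_def
  proof (intro conjI ballI impI)
    show "smooth_curve_on I \<gamma>" unfolding smooth_curve_on_def
    proof (intro ballI impI)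
      fix t d assume "t \<in> I" "d \<in> \<A>" "\<gamma> t \<in> fst d"
      then obtain N X V where N: "geodesic_in d N \<gamma> X V" "t \<in> N" "N \<subseteq> I" using loc' by blast
      then show "\<exists>N f. open N \<and> t \<in> N \<and> smooth_on N f \<and> (\<forall>s\<in>I \<inter> N. \<gamma> s \<in> fst d \<and> snd d (\<gamma> s) = f s)"
        using geodesic_inD[OF N(1)] by (intro exI[of _ N] exI[of _ X]) auto
    qed
    fix t d assume t: "t \<in> I" and d: "d \<in> \<A>" "\<gamma> t \<in> fst d"
    then obtain N X V where N: "geodesic_in d N \<gamma> X V" "t \<in> N" "N \<subseteq> I" using loc' by blast
    have vel: "velocity d I \<gamma> s = V s" if "s \<in> N" for s
      using geodesic_in_velocity[OF N(1) that] N(3) I(1) that by blast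
    have "(velocity d I \<gamma> has_vector_derivative - Gamma d (X t) (V t) (V t)) (at t)"
      by (rule has_vector_derivative_transform_within_open[OF geodesic_inD(8)[OF N(1,2)] geodesic_inD(2)[OF N(1)] N(2)])
        (simp add: vel)
    then have "vector_derivative (velocity d I \<gamma>) (at t) = - Gamma d (X t) (V t) (V t)"
      by (rule vector_derivative_at)
    then show "vector_derivative (velocity d I \<gamma>) (at t) +
        christoffel d (\<gamma> t) (velocity d I \<gamma> t) (velocity d I \<gamma> t) = 0"
      using vel[OF N(2)] christoffel_eq[OF d] geodesic_inD(5)[OF N(1,2)] by simp
  qed (use I in auto)
qed

lemma velocity_transform:
  assumes geo: "geodesic_on I \<gamma>" and t: "t \<in> I" and c: "c \<in> \<A>" "\<gamma> t \<in> fst c" and d: "d \<in> \<A>" "\<gamma> t \<in> fst d"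
  shows "velocity d I \<gamma> t = transition_deriv c d (\<gamma> t) (velocity c I \<gamma> t)"
proof -
  have I: "open I" using geo by (simp add: geodesic_on_def)
  obtain N X V where N: "geodesic_in c N \<gamma> X V" "t \<in> N" "N \<subseteq> I"
    by (rule geodesic_on_imp_in[OF geo t c])
  obtain N' X' V' where N': "geodesic_in d N' \<gamma> X' V'" "t \<in> N'" "N' \<subseteq> I"
    by (rule geodesic_on_imp_in[OF geo t d])
  have "geodesic_in d (N \<inter> N') \<gamma> (\<lambda>s. (snd d \<circ> inv_coord c) (X s)) (\<lambda>s. transition_deriv c d (\<gamma> s) (V s))"
    by (rule geodesic_in_change_chart[OF N(1) d(1)]) (use geodesic_inD(2)[OF N(1)] geodesic_inD(2,4)[OF N'(1)] in auto)
  from geodesic_in_velocity[OF this _ t I] geodesic_in_velocity[OF N(1,2) t I] N(2) N'(2) show ?thesis by simp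
qed

end


section \<open>Existence of inextendible null geodesics\<close>

text \<open>The squared norm of \<open>V\<close> times \<open>exp (- 2 * K * s)\<close> is
  nonincreasing and times \<open>exp (2 * K * s)\<close> nondecreasing. The first settles parameters
  after \<open>t0\<close>, the second those before, as both products vanish at
  \<open>t0\<close>.\<close>

lemma gronwall_zero:
  fixes V :: "real \<Rightarrow> 'b::euclidean_space"
  assumes V: "\<And>s. s \<in> {a..b} \<Longrightarrow> (V has_vector_derivative V' s) (at s)"
    and bound: "\<And>s. s \<in> {a..b} \<Longrightarrow> norm (V' s) \<le> K * norm (V s)"
    and t0: "t0 \<in> {a..b}" "V t0 = 0" and s: "s \<in> {a..b}"
  shows "V s = 0"
proof -
  have der: "((\<lambda>s. V s \<bullet> V s) has_real_derivative 2 * (V r \<bullet> V' r)) (at r)" if "r \<in> {a..b}" for r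
    using has_derivative_inner[OF V[OF that, unfolded has_vector_derivative_def] V[OF that, unfolded has_vector_derivative_def]]
    by (simp add: has_field_derivative_def inner_commute algebra_simps mult_commute_abs)
  have le: "\<bar>2 * (V r \<bullet> V' r)\<bar> \<le> 2 * K * (V r \<bullet> V r)" if "r \<in> {a..b}" for r
  proof -
    have "\<bar>V r \<bullet> V' r\<bar> \<le> norm (V r) * norm (V' r)" by (rule Cauchy_Schwarz_ineq2)
    also have "\<dots> \<le> norm (V r) * (K * norm (V r))" using bound[OF that] by (intro mult_left_mono) auto
    also have "\<dots> = K * (V r \<bullet> V r)" by (simp add: dot_square_norm power2_eq_square)
    finally show ?thesis by simp
  qed
  let ?F = "\<lambda>\<sigma> s. exp (\<sigma> * 2 * K * s) * (V s \<bullet> V s)" and ?F' = "\<lambda>\<sigma> r. exp (\<sigma> * 2 * K * r) * (2 * (V r \<bullet> V' r) + \<sigma> * 2 * K * (V r \<bullet> V r))"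
  have F: "(?F \<sigma> has_real_derivative ?F' \<sigma> r) (at r)" if "r \<in> {a..b}" for \<sigma> r
    by (rule derivative_eq_intros der[OF that] refl | simp add: algebra_simps)+
  have "V s \<bullet> V s \<le> 0"
  proof (cases "t0 \<le> s")
    case True
    have "?F (-1) s \<le> ?F (-1) t0"
    proof (rule DERIV_nonpos_imp_nonincreasing[OF True])
      fix r assume "t0 \<le> r" "r \<le> s"
      then have r: "r \<in> {a..b}" using t0 s by auto
      have "?F' (-1) r \<le> 0" using le[OF r] by (intro mult_nonneg_nonpos) auto
      then show "\<exists>y. (?F (-1) has_real_derivative y) (at r) \<and> y \<le> 0" using F[OF r, of "-1"] by blast
    qed
    then show ?thesis using t0(2) by (simp add: mult_le_0_iff)
  next
    case False
    then have le': "s \<le> t0" by simp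
    have "?F 1 s \<le> ?F 1 t0"
    proof (rule DERIV_nonneg_imp_nondecreasing[OF le'])
      fix r assume "s \<le> r" "r \<le> t0"
      then have r: "r \<in> {a..b}" using t0 s by auto
      have "?F' 1 r \<ge> 0" using le[OF r] by (intro mult_nonneg_nonneg) auto
      then show "\<exists>y. (?F 1 has_real_derivative y) (at r) \<and> y \<ge> 0" using F[OF r, of 1] by blast
    qed
    then show ?thesis using t0(2) by (simp add: mult_le_0_iff)
  qed
  then show ?thesis by (metis inner_eq_zero_iff inner_ge_zero order_antisym)
qed

section \<open>Conserved quantities and local existence of geodesics in coordinates\<close>

context coord_metric
begin

text \<open>The Euler--Lagrange form tested with \<open>w = V s\<close> is exactly half of the
  derivative of \<open>G (X s) (V s) (V s)\<close>.\<close>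

lemma geodesic_norm_derivative:
  assumes x: "X s \<in> S" and X: "(X has_vector_derivative V s) (at s)"
    and V: "(V has_vector_derivative - Gam (X s) (V s) (V s)) (at s)"
  shows "((\<lambda>s. G (X s) (V s) (V s)) has_real_derivative 0) (at s)"
proof -
  define a where "a = - Gam (X s) (V s) (V s)"
  let ?E = "dG (X s) (V s) (V s) (V s) + G (X s) a (V s) + G (X s) (V s) a"
  let ?D = "\<lambda>h. dG (X s) (h *\<^sub>R V s) (V s) (V s) + G (X s) (h *\<^sub>R a) (V s) + G (X s) (V s) (h *\<^sub>R a)"
  have "a + Gam (X s) (V s) (V s) = 0" by (simp add: a_def)
  from geodesic_iff[OF x, THEN iffD1, OF this, rule_format, of "V s"] have 0: "?E = 0"
    using G_sym[OF x, of a "V s"] by linarith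
  have "((\<lambda>s. G (X s) (V s) (V s)) has_derivative
      ?D) (at s)"
    using X V unfolding has_vector_derivative_def a_def by (intro has_derivative_G x)
  also have "?D =
      (\<lambda>h. h * (?E))"
    by (simp add: linear_cmul[OF linear_dG[OF x]] bilinear_lmul[OF bilinear_G[OF x]] bilinear_rmul[OF bilinear_G[OF x]] algebra_simps)
  finally show ?thesis by (simp only: 0 has_field_derivative_def mult_commute_abs)
qed

text \<open>Along a compact piece the acceleration, quadratic in \<open>V\<close>, is bounded by a
  constant times \<open>norm (V s)\<close>, so the Gronwall argument applies. This is needed because
  null vectors are nonzero by definition: conservation of the square alone would not preserve
  nullity.\<close>

lemma geodesic_velocity_zero:
  assumes X: "\<And>s. s \<in> {a..b} \<Longrightarrow> X s \<in> S" "continuous_on {a..b} X"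
    and V: "\<And>s. s \<in> {a..b} \<Longrightarrow> (V has_vector_derivative - Gam (X s) (V s) (V s)) (at s)"
    and t0: "t0 \<in> {a..b}" "V t0 = 0" and s: "s \<in> {a..b}"
  shows "V s = 0"
proof -
  have contV: "continuous_on {a..b} V"
    using V has_vector_derivative_continuous continuous_at_imp_continuous_on by blast
  have contG: "continuous_on {a..b} (\<lambda>s. Gam (X s) i j)" for i j
    by (rule continuous_on_compose2[OF smooth_on_imp_continuous_on[OF smooth_Gam] X(2)]) (use X(1) in auto)
  define k where "k s = (\<Sum>i\<in>Basis. \<Sum>j\<in>Basis. \<bar>V s \<bullet> i\<bar> * norm (Gam (X s) i j))" for s
  have "continuous_on {a..b} k" unfolding k_def by (intro continuous_intros contV contG)
  from compact_imp_bounded[OF compact_continuous_image[OF this compact_Icc]]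
  obtain K where "\<forall>x\<in>k ` {a..b}. norm x \<le> K" unfolding bounded_iff by blast
  then have K: "\<bar>k s\<bar> \<le> K" if "s \<in> {a..b}" for s using that by (metis imageI real_norm_def)
  have "norm (- Gam (X s) (V s) (V s)) \<le> K * norm (V s)" if s: "s \<in> {a..b}" for s
  proof -
    have "norm (- Gam (X s) (V s) (V s)) = norm (bilinear_extension (Gam (X s)) (V s) (V s))"
      using Gam_expand[OF X(1)[OF s], of "V s" "V s"] by simp
    also have "\<dots> \<le> (\<Sum>i\<in>Basis. \<Sum>j\<in>Basis. norm (((V s \<bullet> i) * (V s \<bullet> j)) *\<^sub>R Gam (X s) i j))"
      by (intro order_trans[OF norm_sum] sum_mono norm_sum)
    also have "\<dots> \<le> (\<Sum>i\<in>Basis. \<Sum>j\<in>Basis. (\<bar>V s \<bullet> i\<bar> * norm (Gam (X s) i j)) * norm (V s))"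
    proof (intro sum_mono)
      fix i j :: 'e assume j: "j \<in> Basis"
      let ?m = "\<bar>V s \<bullet> i\<bar> * norm (Gam (X s) i j)" and ?l = "norm (((V s \<bullet> i) * (V s \<bullet> j)) *\<^sub>R Gam (X s) i j)"
      have "?l = ?m * \<bar>V s \<bullet> j\<bar>"
        by (simp add: abs_mult)
      also have "\<dots> \<le> ?m * norm (V s)"
        using Basis_le_norm[OF j] by (intro mult_left_mono) auto
      finally show "?l \<le> ?m * norm (V s)" .
    qed
    also have "\<dots> = k s * norm (V s)" unfolding k_def by (simp add: sum_distrib_right)
    also have "\<dots> \<le> K * norm (V s)" using K[OF s] by (intro mult_right_mono) auto
    finally show ?thesis .
  qed
  from gronwall_zero[OF V this t0 s] show ?thesis .
qed

lemma geodesic_exists: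
  assumes x: "x \<in> S"
  obtains \<delta> X V where "\<delta> > 0" "X 0 = x" "V 0 = v" "smooth_on {-\<delta><..<\<delta>} X"
    "\<And>s. s \<in> {-\<delta><..<\<delta>} \<Longrightarrow> X s \<in> S"
    "\<And>s. s \<in> {-\<delta><..<\<delta>} \<Longrightarrow> (X has_vector_derivative V s) (at s)"
    "\<And>s. s \<in> {-\<delta><..<\<delta>} \<Longrightarrow> (V has_vector_derivative - Gam (X s) (V s) (V s)) (at s)"
proof -
  \<comment> \<open>The geodesic spray, a vector field on \<open>S \<times> UNIV\<close>, the
    tangent bundle of \<open>S\<close>.\<close>
  define F where "F z = (snd z, - Gam (fst z) (snd z) (snd z))" for z :: "'e \<times> 'e"
  have oSU: "open (S \<times> (UNIV :: 'e set))" using open_S by (intro open_Times) auto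
  have "Ck_on k F (S \<times> UNIV)" for k
  proof -
    have G: "Ck_on k (\<lambda>z. Gam (fst z) i j) (S \<times> (UNIV :: 'e set))" for i j
      by (rule Ck_on_compose[OF oSU open_S])
        (use smooth_Gam in \<open>auto simp: smooth_on_def intro: Ck_on_bounded_linear oSU bounded_linear_fst\<close>)
    have "Ck_on k (\<lambda>z. (snd z, \<Sum>i\<in>Basis. \<Sum>j\<in>Basis. ((snd z \<bullet> i) * (snd z \<bullet> j)) *\<^sub>R (- 1 :: real) *\<^sub>R Gam (fst z) i j)) (S \<times> UNIV)"
      by (intro Ck_on_Pair Ck_on_sum Ck_on_scaleR Ck_on_mult Ck_on_inner Ck_on_const G oSU finite_Basis
          Ck_on_bounded_linear bounded_linear_snd)
    moreover have "F z = (snd z, \<Sum>i\<in>Basis. \<Sum>j\<in>Basis. ((snd z \<bullet> i) * (snd z \<bullet> j)) *\<^sub>R (- 1 :: real) *\<^sub>R Gam (fst z) i j)"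
      if "z \<in> S \<times> UNIV" for z
    proof -
      have "fst z \<in> S" using that by auto
      from Gam_expand[OF this, of "snd z" "snd z"] show ?thesis by (simp add: F_def sum_negf)
    qed
    ultimately show ?thesis by (rule Ck_on_cong[OF oSU, THEN iffD2, rotated])
  qed
  then have smooth: "smooth_on (S \<times> UNIV) F" by (simp add: smooth_on_def)
  have xv: "(x, v) \<in> S \<times> UNIV" using x by simp
  obtain \<delta> y where y: "\<delta> > 0" "y 0 = (x, v)" "smooth_on {-\<delta><..<\<delta>} y"
    "\<And>t. t \<in> {-\<delta><..<\<delta>} \<Longrightarrow> y t \<in> S \<times> UNIV"
    "\<And>t. t \<in> {-\<delta><..<\<delta>} \<Longrightarrow> (y has_vector_derivative F (y t)) (at t)"
    using smooth_ode_exists[OF oSU xv smooth] by blast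
  show thesis
  proof (rule that[of \<delta> "\<lambda>t. fst (y t)" "\<lambda>t. snd (y t)"])
    show "smooth_on {-\<delta><..<\<delta>} (\<lambda>t. fst (y t))"
      using y(3) unfolding smooth_on_def
      by (intro allI Ck_on_linear_compose[OF bounded_linear_fst]) simp_all
    fix s assume s: "s \<in> {-\<delta><..<\<delta>}"
    show "fst (y s) \<in> S" using y(4)[OF s] by auto
    show "((\<lambda>t. fst (y t)) has_vector_derivative snd (y s)) (at s)"
      using bounded_linear.has_vector_derivative[OF bounded_linear_fst y(5)[OF s]] by (simp add: F_def)
    show "((\<lambda>t. snd (y t)) has_vector_derivative - Gam (fst (y s)) (snd (y s)) (snd (y s))) (at s)"
      using bounded_linear.has_vector_derivative[OF bounded_linear_snd y(5)[OF s]] by (simp add: F_def)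
  qed (use y in auto)
qed

end

section \<open>Maximal extension and persistence of the null condition\<close>

context lorentz_manifold
begin

lemma geodesic_onD:
  assumes "geodesic_on I \<gamma>"
  shows "open I" "is_interval I" "I \<noteq> {}" "connected I"
  using assms by (simp_all add: geodesic_on_def is_interval_connected_1)

lemma inextendible_geodesic_onD: "inextendible_geodesic_on I \<gamma> \<Longrightarrow> geodesic_on I \<gamma>"
  by (simp add: inextendible_geodesic_on_def)

lemma geodesic_through:
  assumes c: "c \<in> \<A>" and p: "p \<in> fst c"
  obtains I \<gamma> where "geodesic_on I \<gamma>" "0 \<in> I" "\<gamma> 0 = p" "velocity c I \<gamma> 0 = v"
proof -
  interpret coord_metric "codom c" "coord_g c" by (rule coord_metric_chart[OF c])
  obtain \<delta> X V where d: "\<delta> > 0" "X 0 = snd c p" "V 0 = v" "smooth_on {-\<delta><..<\<delta>} X"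
    "\<And>s. s \<in> {-\<delta><..<\<delta>} \<Longrightarrow> X s \<in> codom c"
    "\<And>s. s \<in> {-\<delta><..<\<delta>} \<Longrightarrow> (X has_vector_derivative V s) (at s)"
    "\<And>s. s \<in> {-\<delta><..<\<delta>} \<Longrightarrow> (V has_vector_derivative - Gam (X s) (V s) (V s)) (at s)"
    using geodesic_exists[OF coord_in_codom[OF p], of v] by blast
  define \<gamma> where "\<gamma> s = inv_coord c (X s)" for s
  have geo: "geodesic_in c {-\<delta><..<\<delta>} \<gamma> X V"
    unfolding geodesic_in_def \<gamma>_def using c d inv_coord_in_dom[OF c] coord_inv_coord[OF c] by simp
  show thesis
  proof (rule that)
    show "geodesic_on {-\<delta><..<\<delta>} \<gamma>"
    proof (rule geodesic_onI)
      show "\<exists>c N X V. geodesic_in c N \<gamma> X V \<and> t \<in> N" if "t \<in> {-\<delta><..<\<delta>}" for t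
        using geo that by blast
    qed (use d(1) is_interval_oo in simp_all)
    show "0 \<in> {-\<delta><..<\<delta>}" using d(1) by simp
    then show "velocity c {-\<delta><..<\<delta>} \<gamma> 0 = v" using geodesic_in_velocity[OF geo, of 0] d(3) by simp
    show "\<gamma> 0 = p" unfolding \<gamma>_def d(2) by (rule inv_coord_coord[OF c p])
  qed
qed

lemma geodesic_on_Union:
  assumes C: "C \<noteq> {}" "\<And>J. J \<in> C \<Longrightarrow> geodesic_on J (\<eta> J)" "\<And>J. J \<in> C \<Longrightarrow> t0 \<in> J"
    and agree: "\<And>J t. J \<in> C \<Longrightarrow> t \<in> J \<Longrightarrow> \<gamma> t = \<eta> J t"
  shows "geodesic_on (\<Union>C) \<gamma>"
proof (rule geodesic_onI)
  show "open (\<Union>C)" using C(2) geodesic_onD(1) by blast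
  have "connected (\<Union>C)"
  proof (rule connected_Union)
    show "\<Inter>C \<noteq> {}" using C(3) by blast
  qed (use C(2) geodesic_onD(4) in blast)
  then show "is_interval (\<Union>C)" by (simp add: is_interval_connected_1)
  show "\<Union>C \<noteq> {}" using C(1,3) by blast
  fix t assume "t \<in> \<Union>C"
  then obtain J where J: "J \<in> C" "t \<in> J" by blast
  obtain c where c: "c \<in> \<A>" "\<eta> J t \<in> fst c" by (rule chart_at)
  obtain N X V where N: "geodesic_in c N (\<eta> J) X V" "t \<in> N" "N \<subseteq> J"
    by (rule geodesic_on_imp_in[OF C(2)[OF J(1)] J(2) c])
  have "geodesic_in c N \<gamma> X V"
    by (rule geodesic_in_cong[OF N(1)]) (use agree[OF J(1)] N(3) in auto)
  then show "\<exists>c N X V. geodesic_in c N \<gamma> X V \<and> t \<in> N" using N(2) by blast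
qed

text \<open>Extensions are encoded by their graphs, so that inclusion of sets expresses both a
  larger domain and agreement on the smaller one. The union of a chain is then the graph of a
  function, and its domain is an interval because all members contain the parameters of
  \<open>I\<close>.\<close>

lemma geodesic_extends:
  assumes geo: "geodesic_on I \<gamma>"
  obtains J \<eta> where "inextendible_geodesic_on J \<eta>" "I \<subseteq> J" "\<And>t. t \<in> I \<Longrightarrow> \<eta> t = \<gamma> t"
proof -
  define gr where "gr J \<eta> = {(t, \<eta> t) | t. t \<in> J}" for J :: "real set" and \<eta> :: "real \<Rightarrow> 'a"
  define E where "E = {gr J \<eta> | J \<eta>. geodesic_on J \<eta> \<and> I \<subseteq> J \<and> (\<forall>t\<in>I. \<eta> t = \<gamma> t)}"
  obtain t0 where t0: "t0 \<in> I" using geodesic_onD(3)[OF geo] by blast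
  have "\<exists>M\<in>E. \<forall>X\<in>E. M \<subseteq> X \<longrightarrow> X = M"
  proof (rule subset_Zorn_nonempty)
    show "E \<noteq> {}" using geo unfolding E_def by blast
    fix C assume C: "C \<noteq> {}" "subset.chain E C"
    have el: "\<exists>\<eta>. Q = gr (fst ` Q) \<eta> \<and> geodesic_on (fst ` Q) \<eta> \<and> I \<subseteq> fst ` Q \<and> (\<forall>t\<in>I. \<eta> t = \<gamma> t)"
      if "Q \<in> C" for Q
    proof -
      have "Q \<in> E" using that C(2) by (auto simp: subset_chain_def)
      then obtain J \<eta> where Q: "Q = gr J \<eta>" "geodesic_on J \<eta>" "I \<subseteq> J" "\<forall>t\<in>I. \<eta> t = \<gamma> t"
        unfolding E_def by blast
      moreover have "fst ` Q = J" unfolding Q(1) gr_def by force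
      ultimately show ?thesis by metis
    qed
    have sv: "p = q" if pq: "(t, p) \<in> \<Union>C" "(t, q) \<in> \<Union>C" for t p q
    proof -
      obtain P Q where PQ: "P \<in> C" "(t, p) \<in> P" "Q \<in> C" "(t, q) \<in> Q" using pq by blast
      then have "P \<subseteq> Q \<or> Q \<subseteq> P" using C(2) by (auto simp: subset_chain_def)
      then obtain R where R: "R \<in> C" "(t, p) \<in> R" "(t, q) \<in> R" using PQ by blast
      then obtain \<eta> where "R = gr (fst ` R) \<eta>" using el by blast
      then have "p = \<eta> t" "q = \<eta> t" using R(2,3) unfolding gr_def by auto
      then show ?thesis by simp
    qed
    define \<zeta> where "\<zeta> t = (THE p. (t, p) \<in> \<Union>C)" for t
    have \<zeta>: "\<zeta> t = p" if "(t, p) \<in> \<Union>C" for t p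
      unfolding \<zeta>_def using sv that by blast
    define D where "D = (\<lambda>Q. fst ` Q) ` C"
    have UC: "\<Union>C = gr (\<Union>D) \<zeta>"
    proof (rule set_eqI, clarify)
      fix t p
      show "(t, p) \<in> \<Union>C \<longleftrightarrow> (t, p) \<in> gr (\<Union>D) \<zeta>"
      proof
        assume tp: "(t, p) \<in> \<Union>C"
        then have "t \<in> \<Union>D" unfolding D_def by force
        then show "(t, p) \<in> gr (\<Union>D) \<zeta>" using \<zeta>[OF tp] unfolding gr_def by blast
      next
        assume "(t, p) \<in> gr (\<Union>D) \<zeta>"
        then have "t \<in> \<Union>D" "p = \<zeta> t" unfolding gr_def by auto
        moreover from this obtain q where "(t, q) \<in> \<Union>C" unfolding D_def by force
        ultimately show "(t, p) \<in> \<Union>C" using \<zeta> by metis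
      qed
    qed
    have ex: "\<exists>\<eta>. geodesic_on J \<eta> \<and> I \<subseteq> J \<and> (\<forall>t\<in>J. \<zeta> t = \<eta> t) \<and> (\<forall>t\<in>I. \<eta> t = \<gamma> t)" if J: "J \<in> D" for J
    proof -
      obtain Q where Q: "Q \<in> C" "J = fst ` Q" using J unfolding D_def by blast
      obtain \<eta> where \<eta>: "Q = gr J \<eta>" "geodesic_on J \<eta>" "I \<subseteq> J" "\<forall>t\<in>I. \<eta> t = \<gamma> t"
        using el[OF Q(1)] Q(2) by blast
      have "\<zeta> t = \<eta> t" if "t \<in> J" for t
      proof (rule \<zeta>)
        have "(t, \<eta> t) \<in> Q" unfolding \<eta>(1) gr_def using that by blast
        then show "(t, \<eta> t) \<in> \<Union>C" using Q(1) by blast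
      qed
      then show ?thesis using \<eta> by blast
    qed
    then obtain \<eta> where \<eta>: "\<And>J. J \<in> D \<Longrightarrow> geodesic_on J (\<eta> J)" "\<And>J. J \<in> D \<Longrightarrow> I \<subseteq> J"
      "\<And>J t. J \<in> D \<Longrightarrow> t \<in> J \<Longrightarrow> \<zeta> t = \<eta> J t" "\<And>J t. J \<in> D \<Longrightarrow> t \<in> I \<Longrightarrow> \<eta> J t = \<gamma> t"
      by metis
    have D: "D \<noteq> {}" using C(1) unfolding D_def by blast
    have "geodesic_on (\<Union>D) \<zeta>"
      by (rule geodesic_on_Union[OF D \<eta>(1) _ \<eta>(3)]) (use \<eta>(2) t0 in blast)+
    moreover have "I \<subseteq> \<Union>D" using D \<eta>(2) by blast
    moreover have "\<zeta> t = \<gamma> t" if "t \<in> I" for t using D \<eta>(2-4) that by (metis all_not_in_conv subsetD)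
    ultimately show "\<Union>C \<in> E" unfolding UC E_def by blast
  qed
  then obtain M where max: "M \<in> E" "\<forall>X\<in>E. M \<subseteq> X \<longrightarrow> X = M" by blast
  then obtain J \<eta> where M: "M = gr J \<eta>" "geodesic_on J \<eta>" "I \<subseteq> J" "\<forall>t\<in>I. \<eta> t = \<gamma> t"
    unfolding E_def by blast
  have "inextendible_geodesic_on J \<eta>" unfolding inextendible_geodesic_on_def
  proof (intro conjI allI impI)
    fix J' \<eta>' assume *: "geodesic_on J' \<eta>' \<and> J \<subseteq> J' \<and> (\<forall>t\<in>J. \<eta>' t = \<eta> t)"
    have "\<forall>t\<in>I. \<eta>' t = \<gamma> t" using * M(3,4) by (metis subsetD)
    then have "gr J' \<eta>' \<in> E" using * M(3) unfolding E_def by blast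
    moreover have "gr J \<eta> \<subseteq> gr J' \<eta>'" using * unfolding gr_def by force
    ultimately have "gr J' \<eta>' = gr J \<eta>" using max(2) M(1) by blast
    moreover have "fst ` gr K \<theta> = K" for K \<theta> unfolding gr_def by force
    ultimately show "J' = J" by metis
  qed (fact M(2))
  then show thesis using that M(3,4) by blast
qed

lemma null_transform:
  assumes c: "c \<in> \<A>" and d: "d \<in> \<A>" and p: "p \<in> fst c \<inter> fst d" and n: "null c p v"
  shows "null d p (transition_deriv c d p v)"
proof -
  have "transition_deriv c d p v \<noteq> 0"
  proof
    assume "transition_deriv c d p v = 0"
    then have "g c p v w = 0" for w
      using metric_transform[OF c d p, of v w] bilinear_lzero[OF lorentz_form_bilinear[OF lorentz[OF d]]] p by simp
    then have "v = 0" using lorentz_form_nondegenerate[OF lorentz[OF c]] p by blast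
    then show False using n by (simp add: null_def)
  qed
  then show ?thesis using n metric_transform[OF c d p, of v v] by (simp add: null_def)
qed

text \<open>Being null is locally constant in the parameter: inside a chart the square of the
  velocity is conserved, and the velocity vanishes at all parameters of a compact interval or at
  none. Connectedness of \<open>I\<close> spreads the condition from \<open>t0\<close> to every
  parameter.\<close>

lemma null_geodesicI:
  assumes inext: "inextendible_geodesic_on I \<gamma>" and t0: "t0 \<in> I" and c: "c \<in> \<A>" "\<gamma> t0 \<in> fst c"
    and n: "null c (\<gamma> t0) (velocity c I \<gamma> t0)"
  shows "null_geodesic_on I \<gamma>"
proof -
  have geo: "geodesic_on I \<gamma>" by (rule inextendible_geodesic_onD[OF inext])
  note I = geodesic_onD[OF geo]
  define P where "P t \<longleftrightarrow> (\<exists>d\<in>\<A>. \<gamma> t \<in> fst d \<and> null d (\<gamma> t) (velocity d I \<gamma> t))" for t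
  have P: "P t \<longleftrightarrow> null d (\<gamma> t) (velocity d I \<gamma> t)" if "t \<in> I" "d \<in> \<A>" "\<gamma> t \<in> fst d" for t d
    unfolding P_def using null_transform velocity_transform[OF geo that(1)] that by (metis IntI)
  have "P t = P t0" if t: "t \<in> I" for t
  proof (rule connected_local_const[of I])
    show "connected I" by (rule I(4))
    show "\<forall>t\<in>I. \<forall>\<^sub>F s in at t within I. P t = P s"
    proof
      fix t assume t: "t \<in> I"
      obtain d where d: "d \<in> \<A>" "\<gamma> t \<in> fst d" by (rule chart_at)
      interpret coord_metric "codom d" "coord_g d" by (rule coord_metric_chart[OF d(1)])
      obtain N X V where N: "geodesic_in d N \<gamma> X V" "t \<in> N" "N \<subseteq> I"
        by (rule geodesic_on_imp_in[OF geo t d])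
      note D = geodesic_inD[OF N(1)]
      obtain r where r: "r > 0" "cball t r \<subseteq> N" using D(2) N(2) open_contains_cball by blast
      then have rN: "{t-r..t+r} \<subseteq> N" by (simp add: cball_eq_atLeastAtMost)
      have Ps: "P s \<longleftrightarrow> V s \<noteq> 0 \<and> coord_g d (X s) (V s) (V s) = 0" if s: "s \<in> N" for s
      proof -
        have "s \<in> I" using s N(3) by blast
        then show ?thesis
          using P[OF _ d(1) D(4)[OF s]] geodesic_in_velocity[OF N(1) s _ I(1)] coord_g_coord[OF d(1) D(4)[OF s]]
            D(5)[OF s] by (simp add: null_def)
      qed
      have "P t = P s" if s: "s \<in> {t-r..t+r}" for s
      proof -
        have tt: "t \<in> {t-r..t+r}" using r(1) by simp
        have zero: "V b = 0" if "V a = 0" "a \<in> {t-r..t+r}" "b \<in> {t-r..t+r}" for a b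
          by (rule geodesic_velocity_zero[of "t-r" "t+r" X V a])
            (use that D rN in \<open>auto intro: continuous_on_subset smooth_on_imp_continuous_on\<close>)
        have "\<exists>k. \<forall>u\<in>{t-r..t+r}. coord_g d (X u) (V u) (V u) = k"
        proof (rule has_field_derivative_zero_constant)
          fix u assume "u \<in> {t-r..t+r}"
          then have u: "u \<in> N" using rN by blast
          show "((\<lambda>s. coord_g d (X s) (V s) (V s)) has_real_derivative 0) (at u within {t-r..t+r})"
            by (rule has_field_derivative_at_within[OF geodesic_norm_derivative[OF D(6)[OF u] D(7)[OF u] D(8)[OF u]]])
        qed simp
        then have "coord_g d (X s) (V s) (V s) = coord_g d (X t) (V t) (V t)" using s tt by metis
        moreover have "V s = 0 \<longleftrightarrow> V t = 0" using zero[OF _ s tt] zero[OF _ tt s] by metis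
        ultimately show ?thesis using Ps[OF subsetD[OF rN s]] Ps[OF subsetD[OF rN tt]] by metis
      qed
      then show "\<forall>\<^sub>F s in at t within I. P t = P s"
        unfolding eventually_at using r(1) by (intro exI[of _ r]) (simp add: dist_real_def abs_le_iff abs_less_iff)
    qed
  qed (use t t0 in auto)
  moreover have "P t0" using P[OF t0 c] n by blast
  ultimately show ?thesis unfolding null_geodesic_on_def using inext P by blast
qed

lemma null_geodesic_through:
  assumes c: "c \<in> \<A>" and p: "p \<in> fst c" and v: "null c p v"
  obtains I \<gamma> where "null_geodesic_on I \<gamma>" "0 \<in> I" "\<gamma> 0 = p" "velocity c I \<gamma> 0 = v"
proof -
  obtain I \<gamma> where g: "geodesic_on I \<gamma>" "0 \<in> I" "\<gamma> 0 = p" "velocity c I \<gamma> 0 = v"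
    by (rule geodesic_through[OF c p])
  obtain J \<eta> where J: "inextendible_geodesic_on J \<eta>" "I \<subseteq> J" "\<And>t. t \<in> I \<Longrightarrow> \<eta> t = \<gamma> t"
    using geodesic_extends[OF g(1)] by metis
  note oI = geodesic_onD(1)[OF g(1)] and oJ = geodesic_onD(1)[OF inextendible_geodesic_onD[OF J(1)]]
  obtain N X V where N: "geodesic_in c N \<gamma> X V" "0 \<in> N" "N \<subseteq> I"
    by (rule geodesic_on_imp_in[OF g(1,2) c]) (use g(3) p in simp)
  have "geodesic_in c N \<eta> X V"
    by (rule geodesic_in_cong[OF N(1)]) (use J(3) N(3) in auto)
  then have vel: "velocity c J \<eta> 0 = v"
    using geodesic_in_velocity[OF _ N(2), of c \<eta> X V J] geodesic_in_velocity[OF N(1,2) g(2) oI] g(2,4) J(2) oJ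
    by auto
  have "null_geodesic_on J \<eta>"
    by (rule null_geodesicI[OF J(1) _ c]) (use g J(2,3) p v vel in auto)
  then show thesis using that[of J \<eta>] g(2,3) J(2,3) vel by auto
qed

end


section \<open>Causally convex sets and null geodesics\<close>

text \<open>If \<open>\<gamma>\<close> left \<open>U\<close>, consider its last exit point \<open>\<gamma> e\<close> before and its first entry point \<open>\<gamma> f\<close>
  after that time. Short pieces of \<open>\<gamma>\<close> before \<open>e\<close> and after \<open>f\<close> are separated by disjoint open
  sets: neighbourhoods of \<open>\<gamma> e\<close> and \<open>\<gamma> f\<close> if these differ, and otherwise the past and the future of
  this point with respect to the time function \<open>\<tau>\<close>.\<close>

lemma curve_stays_inside:
  fixes \<gamma> :: "real \<Rightarrow> 'a::t2_space" and \<tau> :: "'a \<Rightarrow> real"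
  assumes U: "open U" and D: "open D" "closure U \<subseteq> D" and \<tau>: "continuous_on D \<tau>"
    and cont: "continuous_on {s..t} \<gamma>"
    and conn: "\<And>a b. s \<le> a \<Longrightarrow> a < b \<Longrightarrow> b \<le> t \<Longrightarrow> connected (\<gamma> ` {a..b} \<inter> U)"
    and mono: "\<And>r. r \<in> {s..t} \<Longrightarrow> \<gamma> r \<in> D \<Longrightarrow> \<exists>\<eta>>0. \<forall>u\<in>{s..t}.
      (r - \<eta> < u \<and> u < r \<longrightarrow> \<tau> (\<gamma> u) < \<tau> (\<gamma> r)) \<and> (r < u \<and> u < r + \<eta> \<longrightarrow> \<tau> (\<gamma> r) < \<tau> (\<gamma> u))"
    and ends: "\<gamma> s \<in> U" "\<gamma> t \<in> U" and r: "r \<in> {s..t}"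
  shows "\<gamma> r \<in> U"
proof (rule ccontr)
  assume rU: "\<gamma> r \<notin> U"
  have near: "\<exists>\<eta>>0. \<forall>v\<in>{s..t}. \<bar>v - u\<bar> < \<eta> \<longrightarrow> \<gamma> v \<in> Q" if Q: "open Q" and u: "u \<in> {s..t}" "\<gamma> u \<in> Q" for Q u
  proof -
    have "(\<gamma> \<longlongrightarrow> \<gamma> u) (at u within {s..t})" using cont u(1) by (simp add: continuous_on_def)
    from topological_tendstoD[OF this Q u(2)] obtain \<eta> where \<eta>: "\<eta> > 0" "\<And>v. v \<in> {s..t} \<Longrightarrow> v \<noteq> u \<Longrightarrow> dist v u < \<eta> \<Longrightarrow> \<gamma> v \<in> Q"
      unfolding eventually_at by blast
    have "\<gamma> v \<in> Q" if "v \<in> {s..t}" "\<bar>v - u\<bar> < \<eta>" for v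
      using \<eta>(2)[OF that(1)] that(2) u(2) by (cases "v = u") (simp_all add: dist_real_def)
    then show ?thesis using \<eta>(1) by blast
  qed
  have "{u \<in> {s..t}. \<gamma> u \<in> closure U} = {s..t} \<inter> \<gamma> -` closure U" by auto
  then have clo: "closed {u \<in> {s..t}. \<gamma> u \<in> closure U}"
    using continuous_closed_preimage[OF cont _ closed_closure[of U]] by simp
  define A where "A = {u \<in> {s..r}. \<gamma> u \<in> U}"
  define B where "B = {u \<in> {r..t}. \<gamma> u \<in> U}"
  define e where "e = Sup A"
  define f where "f = Inf B"
  have sA: "s \<in> A" and tB: "t \<in> B" using ends r by (auto simp: A_def B_def)
  have bA: "bdd_above A" and bB: "bdd_below B" unfolding A_def B_def by (auto intro!: bdd_aboveI bdd_belowI)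
  have eA: "a \<le> e" if "a \<in> A" for a unfolding e_def using bA that by (rule cSup_upper[rotated])
  have fB: "f \<le> b" if "b \<in> B" for b unfolding f_def using bB that by (rule cInf_lower[rotated])
  have er: "e \<le> r" unfolding e_def using sA by (intro cSup_least) (auto simp: A_def)
  have fr: "r \<le> f" unfolding f_def using tB by (intro cInf_greatest) (auto simp: B_def)
  have est: "e \<in> {s..t}" and fst: "f \<in> {s..t}" using eA[OF sA] fB[OF tB] er fr r by auto
  have AC: "A \<subseteq> {u \<in> {s..t}. \<gamma> u \<in> closure U}" and BC: "B \<subseteq> {u \<in> {s..t}. \<gamma> u \<in> closure U}"
    using closure_subset[of U] r by (auto simp: A_def B_def)
  have "e \<in> {u \<in> {s..t}. \<gamma> u \<in> closure U}"
    unfolding e_def using closed_subset_contains_Sup[OF clo AC] sA bA by blast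
  then have eD: "\<gamma> e \<in> D" using D(2) by blast
  have "f \<in> {u \<in> {s..t}. \<gamma> u \<in> closure U}"
    unfolding f_def using closed_subset_contains_Inf[OF clo BC] tB bB by blast
  then have fD: "\<gamma> f \<in> D" using D(2) by blast
  have eU: "\<gamma> e \<notin> U"
  proof
    assume eU: "\<gamma> e \<in> U"
    then have er': "e < r" using rU er by (cases "e = r") auto
    obtain \<eta> where \<eta>: "\<eta> > 0" "\<And>v. v \<in> {s..t} \<Longrightarrow> \<bar>v - e\<bar> < \<eta> \<Longrightarrow> \<gamma> v \<in> U"
      using near[OF U est eU] by blast
    define v where "v = min r (e + \<eta> / 2)"
    have v: "e < v" "v \<le> r" "\<bar>v - e\<bar> < \<eta>" using \<eta>(1) er' by (auto simp: v_def)
    then have "\<gamma> v \<in> U" using \<eta>(2)[of v] est r by simp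
    then have "v \<in> A" using v est by (auto simp: A_def)
    then show False using eA v by fastforce
  qed
  have fU: "\<gamma> f \<notin> U"
  proof
    assume fU: "\<gamma> f \<in> U"
    then have fr': "r < f" using rU fr by (cases "f = r") auto
    obtain \<eta> where \<eta>: "\<eta> > 0" "\<And>v. v \<in> {s..t} \<Longrightarrow> \<bar>v - f\<bar> < \<eta> \<Longrightarrow> \<gamma> v \<in> U"
      using near[OF U fst fU] by blast
    define v where "v = max r (f - \<eta> / 2)"
    have v: "v < f" "r \<le> v" "\<bar>v - f\<bar> < \<eta>" using \<eta>(1) fr' by (auto simp: v_def)
    then have "\<gamma> v \<in> U" using \<eta>(2)[of v] fst r by simp
    then have "v \<in> B" using v fst by (auto simp: B_def)
    then show False using fB v by fastforce
  qed
  have gap: "\<gamma> u \<notin> U" if "e \<le> u" "u \<le> f" for u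
  proof
    assume u: "\<gamma> u \<in> U"
    show False
    proof (cases "u \<le> r")
      case True
      then have "u \<in> A" using u that est by (auto simp: A_def)
      then show False using eA[of u] that eU u by auto
    next
      case False
      then have "u \<in> B" using u that fst by (auto simp: B_def)
      then show False using fB[of u] that fU u by auto
    qed
  qed
  have "\<exists>O1 O2 \<eta>. open O1 \<and> open O2 \<and> O1 \<inter> O2 = {} \<and> \<eta> > 0 \<and>
    (\<forall>u\<in>{s..t}. \<gamma> u \<in> U \<longrightarrow> (e - \<eta> < u \<and> u < e \<longrightarrow> \<gamma> u \<in> O1) \<and> (f < u \<and> u < f + \<eta> \<longrightarrow> \<gamma> u \<in> O2))"
  proof (cases "\<gamma> e = \<gamma> f")
    case False
    from hausdorff[OF this] obtain O1 O2
      where O: "open O1" "open O2" "\<gamma> e \<in> O1" "\<gamma> f \<in> O2" "O1 \<inter> O2 = {}"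
      by (elim exE conjE)
    obtain \<eta>1 where \<eta>1: "\<eta>1 > 0" "\<And>v. v \<in> {s..t} \<Longrightarrow> \<bar>v - e\<bar> < \<eta>1 \<Longrightarrow> \<gamma> v \<in> O1"
      using near[OF O(1) est O(3)] by blast
    obtain \<eta>2 where \<eta>2: "\<eta>2 > 0" "\<And>v. v \<in> {s..t} \<Longrightarrow> \<bar>v - f\<bar> < \<eta>2 \<Longrightarrow> \<gamma> v \<in> O2"
      using near[OF O(2) fst O(4)] by blast
    have "\<forall>u\<in>{s..t}. \<gamma> u \<in> U \<longrightarrow> (e - min \<eta>1 \<eta>2 < u \<and> u < e \<longrightarrow> \<gamma> u \<in> O1) \<and>
        (f < u \<and> u < f + min \<eta>1 \<eta>2 \<longrightarrow> \<gamma> u \<in> O2)"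
    proof (intro ballI impI conjI)
      fix u assume u: "u \<in> {s..t}"
      show "\<gamma> u \<in> O1" if "e - min \<eta>1 \<eta>2 < u \<and> u < e" using \<eta>1(2)[OF u] that by auto
      show "\<gamma> u \<in> O2" if "f < u \<and> u < f + min \<eta>1 \<eta>2" using \<eta>2(2)[OF u] that by auto
    qed
    moreover have "min \<eta>1 \<eta>2 > 0" using \<eta>1(1) \<eta>2(1) by simp
    ultimately show ?thesis using O(1,2,5) by blast
  next
    case True
    define O1 where "O1 = \<tau> -` {..<\<tau> (\<gamma> e)} \<inter> D"
    define O2 where "O2 = \<tau> -` {\<tau> (\<gamma> e)<..} \<inter> D"
    have O: "open O1" "open O2" unfolding O1_def O2_def
      by (auto intro: continuous_on_open_vimage[OF D(1), THEN iffD1, OF \<tau>, rule_format])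
    obtain \<eta>1 where \<eta>1: "\<eta>1 > 0" "\<And>u. u \<in> {s..t} \<Longrightarrow> e - \<eta>1 < u \<Longrightarrow> u < e \<Longrightarrow> \<tau> (\<gamma> u) < \<tau> (\<gamma> e)"
      using mono[OF est eD] by blast
    obtain \<eta>2 where \<eta>2: "\<eta>2 > 0" "\<And>u. u \<in> {s..t} \<Longrightarrow> f < u \<Longrightarrow> u < f + \<eta>2 \<Longrightarrow> \<tau> (\<gamma> f) < \<tau> (\<gamma> u)"
      using mono[OF fst fD] by blast
    have "\<forall>u\<in>{s..t}. \<gamma> u \<in> U \<longrightarrow> (e - min \<eta>1 \<eta>2 < u \<and> u < e \<longrightarrow> \<gamma> u \<in> O1) \<and>
        (f < u \<and> u < f + min \<eta>1 \<eta>2 \<longrightarrow> \<gamma> u \<in> O2)"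
    proof (intro ballI impI conjI)
      fix u assume u: "u \<in> {s..t}" "\<gamma> u \<in> U"
      have "\<gamma> u \<in> D" using u(2) D(2) closure_subset[of U] by (meson subsetD)
      note uD = this
      show "\<gamma> u \<in> O1" if *: "e - min \<eta>1 \<eta>2 < u \<and> u < e"
      proof -
        have "e - \<eta>1 < u" "u < e" using * min.cobounded1[of \<eta>1 \<eta>2] by linarith+
        from \<eta>1(2)[OF u(1) this] uD show ?thesis unfolding O1_def by blast
      qed
      show "\<gamma> u \<in> O2" if *: "f < u \<and> u < f + min \<eta>1 \<eta>2"
      proof -
        have "f < u" "u < f + \<eta>2" using * min.cobounded2[of \<eta>1 \<eta>2] by linarith+
        from \<eta>2(2)[OF u(1) this] uD show ?thesis unfolding O2_def True by blast
      qed
    qed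
    moreover have "min \<eta>1 \<eta>2 > 0" using \<eta>1(1) \<eta>2(1) by simp
    moreover have "O1 \<inter> O2 = {}" unfolding O1_def O2_def by auto
    ultimately show ?thesis using O by blast
  qed
  then obtain O1 O2 \<eta> where O: "open O1" "open O2" "O1 \<inter> O2 = {}" "\<eta> > 0"
    "\<And>u. u \<in> {s..t} \<Longrightarrow> \<gamma> u \<in> U \<Longrightarrow> e - \<eta> < u \<Longrightarrow> u < e \<Longrightarrow> \<gamma> u \<in> O1"
    "\<And>u. u \<in> {s..t} \<Longrightarrow> \<gamma> u \<in> U \<Longrightarrow> f < u \<Longrightarrow> u < f + \<eta> \<Longrightarrow> \<gamma> u \<in> O2" by blast
  obtain a where a: "a \<in> A" "e - \<eta> < a"
    using less_cSup_iff[of A "e - \<eta>"] sA bA O(4) unfolding e_def by auto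
  obtain b where b: "b \<in> B" "b < f + \<eta>"
    using cInf_less_iff[of B "f + \<eta>"] tB bB O(4) unfolding f_def by auto
  have ae: "a < e" using eA[OF a(1)] a(1) eU by (cases "a = e") (auto simp: A_def)
  have fb: "f < b" using fB[OF b(1)] b(1) fU by (cases "b = f") (auto simp: B_def)
  have aU: "\<gamma> a \<in> U" "s \<le> a" and bU: "\<gamma> b \<in> U" "b \<le> t" using a b by (auto simp: A_def B_def)
  have ab: "a < b" using ae fb er fr by linarith
  have "\<gamma> ` {a..b} \<inter> U \<subseteq> O1 \<union> O2"
  proof
    fix p assume "p \<in> \<gamma> ` {a..b} \<inter> U"
    then obtain u where u: "u \<in> {a..b}" "p = \<gamma> u" "\<gamma> u \<in> U" by blast
    then have "u < e \<or> f < u" using gap[of u] by fastforce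
    moreover have "u \<in> {s..t}" using u aU bU by auto
    ultimately show "p \<in> O1 \<union> O2" using O(5)[of u] O(6)[of u] u a(2) b(2) by auto
  qed
  moreover have "\<gamma> a \<in> O1" "\<gamma> b \<in> O2" using O(5)[of a] O(6)[of b] aU bU a b ae fb ab by auto
  moreover have "connected (\<gamma> ` {a..b} \<inter> U)" using conn[OF aU(2) ab bU(2)] .
  ultimately show False
    using connectedD[of "\<gamma> ` {a..b} \<inter> U" O1 O2] O(1-3) aU bU ab by fastforce
qed

context lorentz_manifold
begin

lemma geodesic_coord_derivatives:
  assumes geo: "geodesic_on I \<gamma>" and r: "r \<in> I" and c: "c \<in> \<A>" "\<gamma> r \<in> fst c"
  shows "((\<lambda>r. snd c (\<gamma> r)) has_vector_derivative velocity c I \<gamma> r) (at r)"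
    and "(velocity c I \<gamma> has_vector_derivative
      - Gamma c (snd c (\<gamma> r)) (velocity c I \<gamma> r) (velocity c I \<gamma> r)) (at r)"
proof -
  note I = geodesic_onD(1)[OF geo]
  obtain N X V where N: "geodesic_in c N \<gamma> X V" "r \<in> N" "N \<subseteq> I"
    by (rule geodesic_on_imp_in[OF geo r c])
  note D = geodesic_inD[OF N(1)]
  have vel: "velocity c I \<gamma> s = V s" if "s \<in> N" for s
    using geodesic_in_velocity[OF N(1) that _ I] N(3) that by blast
  show "((\<lambda>r. snd c (\<gamma> r)) has_vector_derivative velocity c I \<gamma> r) (at r)"
    unfolding vel[OF N(2)]
    by (rule has_vector_derivative_transform_within_open[OF D(7)[OF N(2)] D(2) N(2)]) (simp add: D(5))
  show "(velocity c I \<gamma> has_vector_derivative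
      - Gamma c (snd c (\<gamma> r)) (velocity c I \<gamma> r) (velocity c I \<gamma> r)) (at r)"
    unfolding vel[OF N(2)] D(5)[OF N(2)]
    by (rule has_vector_derivative_transform_within_open[OF D(8)[OF N(2)] D(2) N(2)]) (simp add: vel)
qed

lemma geodesic_continuous_on:
  assumes geo: "geodesic_on I \<gamma>"
  shows "continuous_on I \<gamma>"
proof (rule continuous_at_imp_continuous_on, rule ballI)
  fix t assume t: "t \<in> I"
  obtain c where c: "c \<in> \<A>" "\<gamma> t \<in> fst c" by (rule chart_at)
  obtain N X V where N: "geodesic_in c N \<gamma> X V" "t \<in> N" "N \<subseteq> I"
    by (rule geodesic_on_imp_in[OF geo t c])
  note D = geodesic_inD[OF N(1)]
  have "continuous_on N (\<lambda>s. inv_coord c (X s))"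
    by (rule continuous_on_compose2[OF continuous_on_inv_coord[OF c(1)] smooth_on_imp_continuous_on[OF D(3)]])
      (use D(6) in auto)
  then have "continuous_on N \<gamma>" by (rule continuous_on_eq) (simp add: D(9)[symmetric])
  then show "isCont \<gamma> t" using D(2) N(2) by (simp add: continuous_on_eq_continuous_at)
qed

end

section \<open>Time orientation along null geodesics\<close>

context spacetime
begin

lemma time_product_nonzero:
  assumes "c \<in> \<A>" "p \<in> fst c" "nonspacelike c p v"
  shows "g c p (T c p) v \<noteq> 0"
  using lorentz_form_timelike_nonspacelike[OF lorentz[OF assms(1,2)], of "T c p" v]
    T_timelike[OF assms(1,2)] assms(3) by (simp add: timelike_def nonspacelike_def)

lemma null_geodesic_onD:
  assumes "null_geodesic_on I \<gamma>"
  shows "geodesic_on I \<gamma>"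
    and "t \<in> I \<Longrightarrow> c \<in> \<A> \<Longrightarrow> \<gamma> t \<in> fst c \<Longrightarrow> null c (\<gamma> t) (velocity c I \<gamma> t)"
    and "t \<in> I \<Longrightarrow> c \<in> \<A> \<Longrightarrow> \<gamma> t \<in> fst c \<Longrightarrow> nonspacelike c (\<gamma> t) (velocity c I \<gamma> t)"
  using assms by (auto simp: null_geodesic_on_def inextendible_geodesic_on_def null_def nonspacelike_def)

text \<open>The product of the time orientation with the velocity is independent of the chart,
  continuous along the geodesic and never zero, so its sign is constant on the connected parameter
  interval.\<close>

lemma null_geodesic_orientation:
  assumes nul: "null_geodesic_on I \<gamma>"
  shows "(\<forall>t\<in>I. \<forall>c\<in>\<A>. \<gamma> t \<in> fst c \<longrightarrow> future_directed c (\<gamma> t) (velocity c I \<gamma> t)) \<or>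
    (\<forall>t\<in>I. \<forall>c\<in>\<A>. \<gamma> t \<in> fst c \<longrightarrow> past_directed c (\<gamma> t) (velocity c I \<gamma> t))"
proof -
  note geo = null_geodesic_onD(1)[OF nul]
  note I = geodesic_onD[OF geo]
  define h where "h c t = g c (\<gamma> t) (T c (\<gamma> t)) (velocity c I \<gamma> t)" for c t
  have h: "h c t = h d t" if "t \<in> I" "c \<in> \<A>" "\<gamma> t \<in> fst c" "d \<in> \<A>" "\<gamma> t \<in> fst d" for c d t
  proof -
    have p: "\<gamma> t \<in> fst c \<inter> fst d" using that by blast
    show ?thesis unfolding h_def
      using metric_transform[OF that(2,4) p] T_transform[OF that(2,4) p]
        velocity_transform[OF geo that(1-5)] by simp
  qed
  have h0: "h c t \<noteq> 0" if "t \<in> I" "c \<in> \<A>" "\<gamma> t \<in> fst c" for c t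
    unfolding h_def by (rule time_product_nonzero[OF that(2,3) null_geodesic_onD(3)[OF nul that]])
  define P where "P t \<longleftrightarrow> (\<exists>c\<in>\<A>. \<gamma> t \<in> fst c \<and> h c t < 0)" for t
  have P: "P t \<longleftrightarrow> h c t < 0" if "t \<in> I" "c \<in> \<A>" "\<gamma> t \<in> fst c" for c t
    unfolding P_def using h that by metis
  have const: "P s = P t" if s: "s \<in> I" and t: "t \<in> I" for s t
  proof (rule connected_local_const[OF I(4) s t])
    show "\<forall>t\<in>I. \<forall>\<^sub>F s in at t within I. P t = P s"
    proof
      fix t assume t: "t \<in> I"
      obtain c where c: "c \<in> \<A>" "\<gamma> t \<in> fst c" by (rule chart_at)
      interpret coord_metric "codom c" "coord_g c" by (rule coord_metric_chart[OF c(1)])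
      obtain N X V where N: "geodesic_in c N \<gamma> X V" "t \<in> N" "N \<subseteq> I"
        by (rule geodesic_on_imp_in[OF geo t c])
      note D = geodesic_inD[OF N(1)]
      have vel: "velocity c I \<gamma> s = V s" if "s \<in> N" for s
        using geodesic_in_velocity[OF N(1) that _ I(1)] N(3) that by blast
      have "continuous_on N V"
        using D(8) has_vector_derivative_continuous continuous_at_imp_continuous_on by blast
      moreover have "continuous_on N (\<lambda>s. T c (\<gamma> s))"
        by (rule continuous_on_compose2[OF T_continuous[OF c(1)]
              continuous_on_subset[OF geodesic_continuous_on[OF geo] N(3)]]) (use D(4) in blast)
      \<comment> \<open>\<open>Ck_on 0\<close> is continuity, so \<open>Ck_G\<close> applies to the
        field \<open>T\<close>, which is merely continuous.\<close>
      ultimately have "Ck_on 0 (\<lambda>s. coord_g c (X s) (T c (\<gamma> s)) (V s)) N"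
        by (intro Ck_G) (use D(2,6) smooth_on_imp_continuous_on[OF D(3)] in auto)
      then have "continuous_on N (\<lambda>s. coord_g c (X s) (T c (\<gamma> s)) (V s))" by simp
      then have "continuous_on N (h c)"
        by (rule continuous_on_eq)
          (use vel D(4,5) coord_g_coord[OF c(1)] in \<open>simp add: h_def D(5)[symmetric]\<close>)
      then have "isCont (h c) t" using D(2) N(2) by (simp add: continuous_on_eq_continuous_at)
      then have lim: "(h c \<longlongrightarrow> h c t) (at t within I)"
        by (metis isCont_def tendsto_within_subset top_greatest)
      have N': "\<forall>\<^sub>F s in at t within I. s \<in> N"
        using eventually_at_topological D(2) N(2) by blast
      show "\<forall>\<^sub>F s in at t within I. P t = P s"
      proof (cases "h c t < 0")
        case True
        from N' order_tendstoD(2)[OF lim True] show ?thesis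
          by eventually_elim (use True P[OF _ c(1)] c(2) D(4) N(3) t in blast)
      next
        case False
        then have "h c t > 0" using h0[OF t c] by simp
        from N' order_tendstoD(1)[OF lim this] show ?thesis
        proof eventually_elim
          case (elim s)
          then show ?case using False P[OF t c] P[of s c] c D(4)[of s] N(3) by fastforce
        qed
      qed
    qed
  qed
  obtain t0 where t0: "t0 \<in> I" using I(3) by blast
  show ?thesis
  proof (cases "P t0")
    case True
    then have "future_directed c (\<gamma> t) (velocity c I \<gamma> t)" if "t \<in> I" "c \<in> \<A>" "\<gamma> t \<in> fst c" for t c
      using const[OF t0 that(1)] P[OF that] null_geodesic_onD(3)[OF nul that]
      by (simp add: future_directed_def h_def)
    then show ?thesis by blast
  next
    case False
    then have "past_directed c (\<gamma> t) (velocity c I \<gamma> t)" if "t \<in> I" "c \<in> \<A>" "\<gamma> t \<in> fst c" for t c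
      using const[OF t0 that(1)] P[OF that] h0[OF that] null_geodesic_onD(3)[OF nul that]
      by (simp add: past_directed_def h_def)
    then show ?thesis by blast
  qed
qed

lemma geodesic_smooth_curve_on:
  assumes geo: "geodesic_on I \<gamma>" and J: "J \<subseteq> I"
  shows "smooth_curve_on J \<gamma>"
  unfolding smooth_curve_on_def
proof (intro ballI impI)
  fix t c assume t: "t \<in> J" and c: "c \<in> \<A>" "\<gamma> t \<in> fst c"
  obtain N X V where N: "geodesic_in c N \<gamma> X V" "t \<in> N" "N \<subseteq> I"
    by (rule geodesic_on_imp_in[OF geo _ c]) (use t J in blast)
  note D = geodesic_inD[OF N(1)]
  show "\<exists>N f. open N \<and> t \<in> N \<and> smooth_on N f \<and> (\<forall>s\<in>J \<inter> N. \<gamma> s \<in> fst c \<and> snd c (\<gamma> s) = f s)"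
    using D(2-5) N(2) by blast
qed

lemma geodesic_velocity_Icc:
  assumes geo: "geodesic_on I \<gamma>" and ab: "a < b" "{a..b} \<subseteq> I" and t: "t \<in> {a..b}"
    and c: "c \<in> \<A>" "\<gamma> t \<in> fst c"
  shows "velocity c {a..b} \<gamma> t = velocity c I \<gamma> t"
proof -
  have tI: "t \<in> I" using ab t by blast
  have "((snd c \<circ> \<gamma>) has_vector_derivative velocity c I \<gamma> t) (at t)"
    using geodesic_coord_derivatives(1)[OF geo tI c] by (simp add: o_def)
  then have "((snd c \<circ> \<gamma>) has_vector_derivative velocity c I \<gamma> t) (at t within {a..b})"
    by (rule has_vector_derivative_at_within)
  then show ?thesis unfolding velocity_def[of c "{a..b}"]
    by (rule vector_derivative_within_cbox[of a b, unfolded cbox_interval, OF ab(1) t])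
qed

lemma null_geodesic_nonspacelike_curve:
  assumes nul: "null_geodesic_on I \<gamma>" and ab: "a < b" "{a..b} \<subseteq> I"
  shows "nonspacelike_curve {a..b} \<gamma>"
proof -
  note geo = null_geodesic_onD(1)[OF nul]
  have *: "piecewise_smooth_with P {a..b} \<gamma>"
    if P: "\<forall>t\<in>I. \<forall>c\<in>\<A>. \<gamma> t \<in> fst c \<longrightarrow> P c (\<gamma> t) (velocity c I \<gamma> t)" for P
    unfolding piecewise_smooth_with_def
  proof (intro conjI exI[of _ "{}"] allI impI ballI)
    show "continuous_on {a..b} \<gamma>" using geodesic_continuous_on[OF geo] ab(2) continuous_on_subset by blast
    fix a' b' assume *: "a' < b' \<and> {a'..b'} \<subseteq> {a..b} \<and> {a'<..<b'} \<inter> {} = {}"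
    then have sub: "{a'..b'} \<subseteq> I" using ab(2) by blast
    show "smooth_curve_on {a'..b'} \<gamma>" by (rule geodesic_smooth_curve_on[OF geo sub])
    fix t c assume t: "t \<in> {a'..b'}" and c: "c \<in> \<A>" "\<gamma> t \<in> fst c"
    then have "P c (\<gamma> t) (velocity c I \<gamma> t)" using P sub by blast
    then show "P c (\<gamma> t) (velocity c {a'..b'} \<gamma> t)"
      using geodesic_velocity_Icc[OF geo _ sub t c] * by simp
  qed simp
  show ?thesis unfolding nonspacelike_curve_def
    using null_geodesic_orientation[OF nul] * ab(1) by (auto simp: is_interval_cc)
qed

end


section \<open>Nearly straight curves\<close>

text \<open>The mean value inequality with \<open>K * h\<close> as comparison function; the two
  alternatives correspond to the two possible orders of \<open>s\<close> and
  \<open>t\<close>.\<close>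

lemma norm_diff_le_by_derivative:
  fixes f :: "real \<Rightarrow> 'b::euclidean_space" and h :: "real \<Rightarrow> real"
  assumes f: "\<And>r. r \<in> {a..b} \<Longrightarrow> (f has_vector_derivative f' r) (at r)"
    and h: "\<And>r. r \<in> {a..b} \<Longrightarrow> (h has_vector_derivative h' r) (at r)"
    and bound: "\<And>r. r \<in> {a..b} \<Longrightarrow> norm (f' r) \<le> K * h' r"
    and st: "s \<in> {a..b}" "t \<in> {a..b}"
  shows "norm (f t - f s) \<le> K * h t - K * h s \<or> norm (f t - f s) \<le> K * h s - K * h t"
proof -
  have le: "norm (f v - f u) \<le> K * h v - K * h u" if uv: "a \<le> u" "u < v" "v \<le> b" for u v
  proof (rule differentiable_bound_general[OF uv(2), of f "\<lambda>r. K * h r" f' "\<lambda>r. K * h' r"])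
    show "continuous_on {u..v} f"
      using has_vector_derivative_continuous[OF f] uv by (intro continuous_at_imp_continuous_on ballI) simp
    have Kh: "((\<lambda>r. K * h r) has_vector_derivative K * h' r) (at r)" if "r \<in> {a..b}" for r
      using h[OF that] by (rule has_vector_derivative_mult_right)
    show "continuous_on {u..v} (\<lambda>r. K * h r)"
      using has_vector_derivative_continuous[OF Kh] uv by (intro continuous_at_imp_continuous_on ballI) simp
    fix r assume "u < r" "r < v"
    then have r: "r \<in> {a..b}" using uv by simp
    show "(f has_vector_derivative f' r) (at r)" "((\<lambda>r. K * h r) has_vector_derivative K * h' r) (at r)"
      "norm (f' r) \<le> K * h' r" using f[OF r] Kh[OF r] bound[OF r] .
  qed
  consider "s < t" | "s = t" | "t < s" by linarith
  then show ?thesis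
  proof cases
    case 1 then show ?thesis using le[of s t] st by simp
  next
    case 2 then show ?thesis by simp
  next
    case 3 then show ?thesis using le[of t s] st by (simp add: norm_minus_commute)
  qed
qed

text \<open>Curves with small acceleration are nearly straight. Here \<open>\<omega>\<close> serves as parameter, so that
  \<open>V / \<omega> V\<close> is the direction of the curve, and its derivative is controlled by the one of \<open>\<omega> X\<close>.\<close>

lemma nearly_straight:
  fixes X V :: "real \<Rightarrow> 'e::euclidean_space" and \<omega> :: "'e \<Rightarrow> real"
  assumes X: "\<And>r. r \<in> {a..b} \<Longrightarrow> (X has_vector_derivative V r) (at r)"
    and V: "\<And>r. r \<in> {a..b} \<Longrightarrow> (V has_vector_derivative A r) (at r)"
    and \<omega>: "linear \<omega>" "\<And>u. \<bar>\<omega> u\<bar> \<le> B * norm u"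
    and \<kappa>: "\<kappa> > 0" "\<And>r. r \<in> {a..b} \<Longrightarrow> \<kappa> * norm (V r) \<le> \<sigma> * \<omega> (V r)" "\<And>r. r \<in> {a..b} \<Longrightarrow> V r \<noteq> 0"
    and \<sigma>: "\<bar>\<sigma>\<bar> = 1"
    and C: "C \<ge> 0" "\<And>r. r \<in> {a..b} \<Longrightarrow> norm (A r) \<le> C * (norm (V r))\<^sup>2"
    and D: "\<And>r r'. r \<in> {a..b} \<Longrightarrow> r' \<in> {a..b} \<Longrightarrow> \<bar>\<omega> (X r) - \<omega> (X r')\<bar> \<le> D"
    and st: "s \<in> {a..b}" "t \<in> {a..b}"
  shows "norm (X t - X s - \<omega> (X t - X s) *\<^sub>R (inverse (\<omega> (V s)) *\<^sub>R V s))
    \<le> (C / \<kappa>\<^sup>2 + B * C / \<kappa>^3) * D * \<bar>\<omega> (X t - X s)\<bar>"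
proof -
  \<comment> \<open>\<open>M\<close> bounds the derivative of the direction \<open>q\<close>
    relative to the speed of \<open>\<omega> (X r)\<close>. With \<open>norm (V r)\<close> at most
    the absolute value of \<open>\<omega> (V r)\<close> divided by \<open>\<kappa>\<close>, the
    acceleration contributes \<open>C / \<kappa>\<^sup>2\<close> and the derivative of the
    normalising factor contributes \<open>B * C / \<kappa>^3\<close>.\<close>
  define M where "M = C / \<kappa>\<^sup>2 + B * C / \<kappa>^3"
  define q where "q r = inverse (\<omega> (V r)) *\<^sub>R V r" for r
  let ?q' = "\<lambda>r. inverse (\<omega> (V r)) *\<^sub>R A r + (- (inverse (\<omega> (V r)) * \<omega> (A r) * inverse (\<omega> (V r)))) *\<^sub>R V r"
  \<comment> \<open>The sign \<open>\<sigma>\<close> tells whether \<open>\<omega>\<close> grows or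
    decreases along the curve; \<open>h\<close> grows in either case.\<close>
  define h where "h r = \<sigma> * \<omega> (X r)" for r
  have bl: "bounded_linear \<omega>" using \<omega>(1) by (simp add: linear_conv_bounded_linear)
  have B: "B \<ge> 0"
  proof -
    have "0 \<le> \<bar>\<omega> (V s)\<bar>" by simp
    also have "\<dots> \<le> B * norm (V s)" by (rule \<omega>(2))
    finally show ?thesis using \<kappa>(3)[OF st(1)] by (simp add: zero_le_mult_iff)
  qed
  have M: "M \<ge> 0" unfolding M_def using C(1) B \<kappa>(1) by simp
  have l: "\<omega> (V r) \<noteq> 0" "norm (V r) \<le> \<bar>\<omega> (V r)\<bar> / \<kappa>" "\<sigma> * \<omega> (V r) = \<bar>\<omega> (V r)\<bar>" if r: "r \<in> {a..b}" for r
  proof -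
    have pos: "0 < \<sigma> * \<omega> (V r)" using \<kappa>(1) \<kappa>(2)[OF r] \<kappa>(3)[OF r] by (metis less_le_trans mult_pos_pos zero_less_norm_iff)
    then show "\<omega> (V r) \<noteq> 0" by auto
    have "\<bar>\<sigma> * \<omega> (V r)\<bar> = \<bar>\<omega> (V r)\<bar>" using \<sigma> by (simp add: abs_mult)
    then show 3: "\<sigma> * \<omega> (V r) = \<bar>\<omega> (V r)\<bar>" using pos by simp
    show "norm (V r) \<le> \<bar>\<omega> (V r)\<bar> / \<kappa>"
      using \<kappa>(2)[OF r] \<kappa>(1) unfolding 3 by (simp add: field_simps)
  qed
  have \<omega>X: "((\<lambda>r. \<omega> (X r)) has_vector_derivative \<omega> (V r)) (at r)" if "r \<in> {a..b}" for r
    by (rule bounded_linear.has_vector_derivative[OF bl X[OF that]])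
  have h: "(h has_vector_derivative \<bar>\<omega> (V r)\<bar>) (at r)" if "r \<in> {a..b}" for r
    unfolding h_def l(3)[OF that, symmetric] by (rule has_vector_derivative_mult_right[OF \<omega>X[OF that]])
  have q: "(q has_vector_derivative ?q' r) (at r)"
    if r: "r \<in> {a..b}" for r
    unfolding q_def
  proof (rule has_vector_derivative_scaleR[OF _ V[OF r]])
    have "((\<lambda>r. \<omega> (V r)) has_real_derivative \<omega> (A r)) (at r)"
      using bounded_linear.has_vector_derivative[OF bl V[OF r]] by (simp add: has_real_derivative_iff_has_vector_derivative)
    from DERIV_inverse'[OF this l(1)[OF r]]
    show "((\<lambda>r. inverse (\<omega> (V r))) has_real_derivative
        - (inverse (\<omega> (V r)) * \<omega> (A r) * inverse (\<omega> (V r)))) (at r)" .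
  qed
  have q': "norm (?q' r)
      \<le> M * \<bar>\<omega> (V r)\<bar>" if r: "r \<in> {a..b}" for r
  proof -
    define L where "L = \<bar>\<omega> (V r)\<bar>"
    have L: "L > 0" using l(1)[OF r] by (simp add: L_def)
    have Vn: "norm (V r) \<le> L / \<kappa>" using l(2)[OF r] by (simp add: L_def)
    have "norm (A r) \<le> C * (norm (V r))\<^sup>2" by (rule C(2)[OF r])
    also have "\<dots> \<le> C * (L / \<kappa>)\<^sup>2" using Vn C(1) by (intro mult_left_mono power_mono) auto
    finally have An: "norm (A r) \<le> C * (L / \<kappa>)\<^sup>2" .
    have \<omega>A: "\<bar>\<omega> (A r)\<bar> \<le> B * (C * (L / \<kappa>)\<^sup>2)"
      using \<omega>(2)[of "A r"] mult_left_mono[OF An B] by linarith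
    have "norm (?q' r)
        \<le> inverse L * norm (A r) + (inverse L * \<bar>\<omega> (A r)\<bar> * inverse L) * norm (V r)"
      by (rule order_trans[OF norm_triangle_ineq]) (simp add: abs_mult L_def)
    also have "\<dots> \<le> inverse L * (C * (L / \<kappa>)\<^sup>2) + (inverse L * (B * (C * (L / \<kappa>)\<^sup>2)) * inverse L) * (L / \<kappa>)"
      using An \<omega>A Vn L B C(1) \<kappa>(1) by (intro add_mono mult_mono) auto
    also have "\<dots> = M * L"
      unfolding M_def using L \<kappa>(1) by (simp add: field_simps power2_eq_square power3_eq_cube)
    finally show ?thesis by (simp add: L_def)
  qed
  have hX: "\<bar>h r - h r'\<bar> = \<bar>\<omega> (X r) - \<omega> (X r')\<bar>" for r r'
    unfolding h_def using \<sigma> by (simp add: right_diff_distrib[symmetric] abs_mult)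
  have qd: "norm (q r - q s) \<le> M * D" if r: "r \<in> {a..b}" for r
  proof -
    have "norm (q r - q s) \<le> M * h r - M * h s \<or> norm (q r - q s) \<le> M * h s - M * h r"
      by (rule norm_diff_le_by_derivative[OF q h q' st(1) r])
    moreover have "M * h r - M * h s \<le> M * \<bar>h r - h s\<bar>" "M * h s - M * h r \<le> M * \<bar>h r - h s\<bar>"
      unfolding right_diff_distrib[symmetric] using M by (intro mult_left_mono; simp)+
    moreover have "M * \<bar>h r - h s\<bar> \<le> M * D" unfolding hX using M D[OF r st(1)] by (rule mult_left_mono[rotated])
    ultimately show ?thesis by linarith
  qed
  \<comment> \<open>The curve minus the line of direction \<open>q s\<close>. Its derivative is
    \<open>\<omega> (V r) *\<^sub>R (q r - q s)\<close>, so a second integration against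
    \<open>h\<close> turns the bound on \<open>q\<close> into a bound on the deviation from the
    tangent line.\<close>
  define \<Phi> where "\<Phi> r = X r - \<omega> (X r) *\<^sub>R q s" for r
  have \<Phi>: "(\<Phi> has_vector_derivative V r - \<omega> (V r) *\<^sub>R q s) (at r)" if "r \<in> {a..b}" for r
    unfolding \<Phi>_def
    by (rule has_vector_derivative_diff[OF X[OF that]])
      (rule bounded_linear.has_vector_derivative[OF bounded_linear_scaleR_left \<omega>X[OF that]])
  have \<Phi>': "norm (V r - \<omega> (V r) *\<^sub>R q s) \<le> (M * D) * \<bar>\<omega> (V r)\<bar>" if r: "r \<in> {a..b}" for r
  proof -
    have "V r - \<omega> (V r) *\<^sub>R q s = \<omega> (V r) *\<^sub>R (q r - q s)"
      using l(1)[OF r] by (simp add: q_def scaleR_diff_right)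
    then show ?thesis using mult_left_mono[OF qd[OF r], of "\<bar>\<omega> (V r)\<bar>"] by (simp add: mult.commute)
  qed
  have "D \<ge> 0" using D[OF st] by (meson abs_ge_zero order_trans)
  then have MD: "M * D \<ge> 0" using M by simp
  have "norm (\<Phi> t - \<Phi> s) \<le> M * D * h t - M * D * h s \<or> norm (\<Phi> t - \<Phi> s) \<le> M * D * h s - M * D * h t"
    by (rule norm_diff_le_by_derivative[OF \<Phi> h \<Phi>' st])
  moreover have "M * D * h t - M * D * h s \<le> M * D * \<bar>h t - h s\<bar>" "M * D * h s - M * D * h t \<le> M * D * \<bar>h t - h s\<bar>"
    unfolding right_diff_distrib[symmetric] using MD by (intro mult_left_mono; simp)+
  ultimately have "norm (\<Phi> t - \<Phi> s) \<le> M * D * \<bar>h t - h s\<bar>" by linarith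
  moreover have "\<Phi> t - \<Phi> s = X t - X s - \<omega> (X t - X s) *\<^sub>R q s"
    unfolding \<Phi>_def linear_diff[OF \<omega>(1)] by (simp add: scaleR_diff_left)
  ultimately show ?thesis unfolding hX linear_diff[OF \<omega>(1)] q_def M_def by simp
qed

text \<open>The times \<open>d1\<close> and \<open>d2\<close> differ by at most
  \<open>2 * B * \<rho>\<close>, since the end points are \<open>2 * \<rho>\<close> apart. The
  slopes satisfy \<open>s1 - s2 \<ge> 1\<close>, so the lines have separated by at least
  \<open>norm w\<close> times the size of \<open>d1\<close>. The two deviations of
  \<open>norm w / 4\<close> consume only half of this, up to multiples of \<open>\<rho>\<close>;
  hence \<open>d1\<close>, and with it the distance from \<open>y\<close>, is bounded by a multiple
  of \<open>\<rho>\<close>.\<close>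

lemma transversal_lines_estimate:
  fixes y z1 z2 e w :: "'e::euclidean_space" and \<omega> :: "'e \<Rightarrow> real"
  assumes \<omega>: "linear \<omega>" "\<And>u. \<bar>\<omega> u\<bar> \<le> B * norm u" and B: "B \<ge> 0"
    and s: "s1 \<in> {1/2..2}" "s2 \<in> {-2..-1/2}"
    and l1: "norm (z1 - y - \<omega> (z1 - y) *\<^sub>R (e + s1 *\<^sub>R w)) \<le> norm w / 4 * \<bar>\<omega> (z1 - y)\<bar>"
    and l2: "norm (z2 - y - \<omega> (z2 - y) *\<^sub>R (e + s2 *\<^sub>R w)) \<le> norm w / 4 * \<bar>\<omega> (z2 - y)\<bar>"
    and z: "norm (z1 - z2) \<le> 2 * \<rho>" and w: "w \<noteq> 0"
  shows "norm (z1 - y) \<le> (norm e + 3 * norm w) * (2 * (2 + norm w * B + 2 * (norm e + 2 * norm w) * B) / norm w) * \<rho>"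
proof -
  define d1 where "d1 = \<omega> (z1 - y)"
  define d2 where "d2 = \<omega> (z2 - y)"
  define Q where "Q = norm e + 2 * norm w"
  have \<rho>: "\<rho> \<ge> 0" using z norm_ge_zero[of "z1 - z2"] by linarith
  have q: "norm (e + s *\<^sub>R w) \<le> Q" if "\<bar>s\<bar> \<le> 2" for s
    unfolding Q_def using norm_triangle_ineq[of e "s *\<^sub>R w"] mult_right_mono[OF that norm_ge_zero[of w]] by simp
  have "d1 - d2 = \<omega> (z1 - z2)" unfolding d1_def d2_def using linear_diff[OF \<omega>(1)] by simp
  then have dd: "\<bar>d1 - d2\<bar> \<le> 2 * B * \<rho>"
    using \<omega>(2)[of "z1 - z2"] mult_left_mono[OF z B] by simp
  then have d2: "\<bar>d2\<bar> \<le> \<bar>d1\<bar> + 2 * B * \<rho>" by linarith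
  let ?r1 = "z1 - y - d1 *\<^sub>R (e + s1 *\<^sub>R w)" and ?r2 = "z2 - y - d2 *\<^sub>R (e + s2 *\<^sub>R w)"
  have tri: "norm (a - b + c - d) \<le> norm a + norm b + norm c + norm d" for a b c d :: 'e
    by norm
  have ident: "((s1 - s2) * d1) *\<^sub>R w = (z1 - z2) - ?r1
      + ?r2 - (d1 - d2) *\<^sub>R (e + s2 *\<^sub>R w)"
    by (simp add: algebra_simps)
  have "1 * \<bar>d1\<bar> \<le> (s1 - s2) * \<bar>d1\<bar>" using s by (intro mult_right_mono) auto
  then have "\<bar>d1\<bar> * norm w \<le> ((s1 - s2) * \<bar>d1\<bar>) * norm w" by (intro mult_right_mono) auto
  also have "\<dots> = norm (((s1 - s2) * d1) *\<^sub>R w)" using s by (simp add: abs_mult)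
  also have "\<dots> \<le> norm (z1 - z2) + norm ?r1
      + norm ?r2 + norm ((d1 - d2) *\<^sub>R (e + s2 *\<^sub>R w))"
    unfolding ident by (rule tri)
  also have "\<dots> \<le> 2 * \<rho> + norm w / 4 * \<bar>d1\<bar> + norm w / 4 * (\<bar>d1\<bar> + 2 * B * \<rho>) + 2 * B * \<rho> * Q"
  proof (intro add_mono)
    show "norm ?r2 \<le> norm w / 4 * (\<bar>d1\<bar> + 2 * B * \<rho>)"
      using l2 mult_left_mono[OF d2, of "norm w / 4"] by (simp add: d2_def)
    show "norm ((d1 - d2) *\<^sub>R (e + s2 *\<^sub>R w)) \<le> 2 * B * \<rho> * Q"
      using dd q[of s2] s B \<rho> by (simp add: mult_mono)
  qed (use z l1 in \<open>simp_all add: d1_def\<close>)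
  also have "\<dots> \<le> \<bar>d1\<bar> * norm w / 2 + (2 + norm w * B + 2 * Q * B) * \<rho>"
    using mult_nonneg_nonneg[OF mult_nonneg_nonneg[OF norm_ge_zero[of w] B] \<rho>] by (simp add: algebra_simps)
  finally have "\<bar>d1\<bar> * norm w \<le> 2 * ((2 + norm w * B + 2 * Q * B) * \<rho>)" by linarith
  then have d1: "\<bar>d1\<bar> \<le> 2 * (2 + norm w * B + 2 * Q * B) / norm w * \<rho>"
    using w by (simp add: field_simps)
  have "norm (z1 - y) \<le> norm (d1 *\<^sub>R (e + s1 *\<^sub>R w)) + norm ?r1"
    by (rule norm_triangle_sub)
  also have "\<dots> \<le> \<bar>d1\<bar> * Q + norm w / 4 * \<bar>d1\<bar>"
    using l1 q[of s1] s by (intro add_mono) (simp_all add: d1_def mult_left_mono)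
  also have "\<dots> \<le> (norm e + 3 * norm w) * \<bar>d1\<bar>"
    using mult_nonneg_nonneg[OF norm_ge_zero[of w] abs_ge_zero[of d1]] by (simp add: Q_def algebra_simps)
  also have "\<dots> \<le> (norm e + 3 * norm w) * (2 * (2 + norm w * B + 2 * Q * B) / norm w * \<rho>)"
    using d1 by (intro mult_left_mono) auto
  finally show ?thesis by (simp add: Q_def mult.assoc)
qed

text \<open>The dimension bound enters here: it supplies a spatial direction along which two null
  directions can be spread apart.\<close>

lemma exists_orthogonal_nonzero:
  fixes k :: "'e::euclidean_space \<Rightarrow> real"
  assumes "linear k" "DIM('e) \<ge> 2"
  obtains w where "w \<noteq> 0" "k w = 0"
proof -
  obtain i j :: 'e where ij: "i \<in> Basis" "j \<in> Basis" "i \<noteq> j"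
    using assms(2) card_le_Suc0_iff_eq[of "Basis :: 'e set"] by fastforce
  show thesis
  proof (cases "k i = 0")
    case True then show ?thesis using that[of i] ij nonzero_Basis by blast
  next
    case False
    define w where "w = j - (k j / k i) *\<^sub>R i"
    have "w \<bullet> j = 1" unfolding w_def using ij by (simp add: inner_simps inner_not_same_Basis)
    then have "w \<noteq> 0" by auto
    moreover have "k w = 0" unfolding w_def using False by (simp add: linear_diff[OF assms(1)] linear_cmul[OF assms(1)])
    ultimately show ?thesis using that by blast
  qed
qed

section \<open>Estimates for bilinear and quadratic forms\<close>

lemma bilinear_diff_bound:
  fixes b b' :: "'e::euclidean_space \<Rightarrow> 'e \<Rightarrow> real"
  assumes "bilinear b" "bilinear b'"
  shows "\<bar>b u v - b' u v\<bar> \<le> (\<Sum>i\<in>Basis. \<Sum>j\<in>Basis. \<bar>b i j - b' i j\<bar>) * norm u * norm v"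
proof -
  have "b u v - b' u v = (\<Sum>i\<in>Basis. \<Sum>j\<in>Basis. ((u \<bullet> i) * (v \<bullet> j)) * (b i j - b' i j))"
    unfolding bilinear_eq_sum_Basis[OF assms(1), of u v] bilinear_eq_sum_Basis[OF assms(2), of u v]
    by (simp add: sum_subtractf right_diff_distrib)
  also have "\<bar>\<dots>\<bar> \<le> (\<Sum>i\<in>Basis. \<Sum>j\<in>Basis. \<bar>((u \<bullet> i) * (v \<bullet> j)) * (b i j - b' i j)\<bar>)"
    by (intro order_trans[OF sum_abs] sum_mono sum_abs)
  also have "\<dots> \<le> (\<Sum>i\<in>Basis. \<Sum>j\<in>Basis. (norm u * norm v) * \<bar>b i j - b' i j\<bar>)"
    unfolding abs_mult by (intro sum_mono mult_right_mono mult_mono) (auto simp: Basis_le_norm)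
  also have "\<dots> = (\<Sum>i\<in>Basis. \<Sum>j\<in>Basis. \<bar>b i j - b' i j\<bar>) * norm u * norm v"
    by (simp add: sum_distrib_left[symmetric] mult_ac)
  finally show ?thesis .
qed

lemma positive_quadratic_lower_bound:
  fixes h :: "'e::euclidean_space \<Rightarrow> real"
  assumes cont: "continuous_on UNIV h" and hom: "\<And>r u. h (r *\<^sub>R u) = r\<^sup>2 * h u"
    and pos: "\<And>u. u \<noteq> 0 \<Longrightarrow> h u > 0"
  obtains m where "m > 0" "\<And>u. m * (norm u)\<^sup>2 \<le> h u"
proof -
  obtain z where z: "z \<in> sphere (0::'e) 1" "\<And>u. u \<in> sphere 0 1 \<Longrightarrow> h z \<le> h u"
    using continuous_attains_inf[of "sphere (0::'e) 1" h] continuous_on_subset[OF cont]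
    by (metis compact_sphere sphere_eq_empty not_one_less_zero subset_UNIV)
  have "h z * (norm u)\<^sup>2 \<le> h u" for u
  proof (cases "u = 0")
    case True then show ?thesis using hom[of 0 u] by simp
  next
    case False
    then have "h z \<le> h (inverse (norm u) *\<^sub>R u)" by (intro z(2)) simp
    then have "h z \<le> (inverse (norm u))\<^sup>2 * h u" by (simp only: hom)
    then show ?thesis using False by (simp add: field_simps)
  qed
  moreover have "h z > 0" using z(1) by (intro pos) auto
  ultimately show thesis using that by blast
qed


section \<open>Local geometry of a Lorentz metric\<close>

context coord_metric
begin

lemma isCont_G: "x \<in> S \<Longrightarrow> isCont (\<lambda>x. G x u v) x"
  using smooth_on_imp_continuous_on[OF smooth_G, of u v] open_S by (simp add: continuous_on_eq_continuous_at)

lemma Gam_bounded: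
  assumes K: "compact K" "K \<subseteq> S"
  obtains C where "C \<ge> 0" "\<And>x u. x \<in> K \<Longrightarrow> norm (Gam x u u) \<le> C * (norm u)\<^sup>2"
proof -
  define k where "k x = (\<Sum>i\<in>Basis. \<Sum>j\<in>Basis. norm (Gam x i j))" for x
  have "continuous_on K (\<lambda>x. Gam x i j)" for i j
    using continuous_on_subset[OF smooth_on_imp_continuous_on[OF smooth_Gam] K(2)] .
  then have "continuous_on K k" unfolding k_def by (intro continuous_intros)
  from compact_imp_bounded[OF compact_continuous_image[OF this K(1)]]
  obtain C where "\<forall>y\<in>k ` K. norm y \<le> C" unfolding bounded_iff by blast
  then have C: "k x \<le> max C 0" if "x \<in> K" for x using that by (metis abs_ge_self imageI max.coboundedI1 order_trans real_norm_def)
  have "norm (Gam x u u) \<le> max C 0 * (norm u)\<^sup>2" if x: "x \<in> K" for x u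
  proof -
    have "norm (Gam x u u) = norm (bilinear_extension (Gam x) u u)"
      using Gam_expand[of x u u] x K(2) by (simp add: subset_iff)
    also have "\<dots> \<le> (\<Sum>i\<in>Basis. \<Sum>j\<in>Basis. norm (((u \<bullet> i) * (u \<bullet> j)) *\<^sub>R Gam x i j))"
      by (intro order_trans[OF norm_sum] sum_mono norm_sum)
    also have "\<dots> \<le> (\<Sum>i\<in>Basis. \<Sum>j\<in>Basis. (norm u * norm u) * norm (Gam x i j))"
      unfolding norm_scaleR abs_mult by (intro sum_mono mult_right_mono mult_mono) (auto simp: Basis_le_norm)
    also have "\<dots> = k x * (norm u)\<^sup>2"
      unfolding k_def by (simp add: sum_distrib_left[symmetric] power2_eq_square mult.commute)
    also have "\<dots> \<le> max C 0 * (norm u)\<^sup>2" using C[OF x] by (intro mult_right_mono) auto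
    finally show ?thesis .
  qed
  then show thesis using that[of "max C 0"] by simp
qed

text \<open>Near a point the cones are close to those of the fixed Lorentz form \<open>b\<close> there. The linear
  form \<open>\<omega>\<close> is a time function, and the null vectors \<open>T0 + s w\<close> on both sides of \<open>T0\<close> are obtained
  from the intermediate value theorem.\<close>

lemma local_geometry:
  assumes x0: "x0 \<in> S" and T0: "G x0 T0 T0 < 0" and TT: "isCont TT x0" "TT x0 = T0" and dim: "DIM('e) \<ge> 2"
  obtains \<omega> w \<kappa> C R where "linear \<omega>" "\<omega> T0 = 1" "\<omega> w = 0" "w \<noteq> 0" "\<kappa> > 0" "C \<ge> 0" "R > 0" "cball x0 R \<subseteq> S"
    "\<And>x u. x \<in> cball x0 R \<Longrightarrow> G x u u \<le> 0 \<Longrightarrow> G x (TT x) u < 0 \<Longrightarrow> \<kappa> * norm u \<le> \<omega> u"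
    "\<And>x u. x \<in> cball x0 R \<Longrightarrow> norm (Gam x u u) \<le> C * (norm u)\<^sup>2"
    "\<And>x. x \<in> cball x0 R \<Longrightarrow> \<exists>s\<in>{1/2..2}. G x (T0 + s *\<^sub>R w) (T0 + s *\<^sub>R w) = 0"
    "\<And>x. x \<in> cball x0 R \<Longrightarrow> \<exists>s\<in>{-2..-1/2}. G x (T0 + s *\<^sub>R w) (T0 + s *\<^sub>R w) = 0"
proof -
  define b where "b = G x0"
  have lb: "lorentz_form b" unfolding b_def by (rule lorentz_G[OF x0])
  note bil_b = lorentz_form_bilinear[OF lb]
  note simps = bilinear_ladd[OF bil_b] bilinear_lsub[OF bil_b] bilinear_rsub[OF bil_b] bilinear_radd[OF bil_b]
    bilinear_lmul[OF bil_b] bilinear_rmul[OF bil_b]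
  have lin_b: "linear (b T0)" using bil_b by (simp add: bilinear_def)
  define N where "N = - b T0 T0"
  have N: "N > 0" using T0 by (simp add: N_def b_def)
  have bTT: "b T0 T0 = - N" by (simp add: N_def)
  \<comment> \<open>The \<open>b\<close>-dual of \<open>T0\<close>, normalised to take the value 1
    on it; its kernel is the orthogonal complement of \<open>T0\<close>.\<close>
  define \<omega> where "\<omega> u = - b T0 u / N" for u
  have lin\<omega>: "linear \<omega>"
    unfolding \<omega>_def by (rule linearI) (simp_all add: simps add_divide_distrib diff_divide_distrib)
  have \<omega>T: "\<omega> T0 = 1" using N by (simp add: \<omega>_def bTT)
  have bT: "b T0 u = - N * \<omega> u" for u using N by (simp add: \<omega>_def)
  obtain w1 where w1: "w1 \<noteq> 0" "b T0 w1 = 0" by (rule exists_orthogonal_nonzero[OF lin_b dim])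
  have bw1: "b w1 w1 > 0"
    using lorentz_form_orthogonal_pos[OF lb _ w1(2,1)] N bTT by simp
  \<comment> \<open>The scaling gives \<open>w\<close> the square \<open>N\<close>, opposite to that
    of \<open>T0\<close>, so that \<open>T0 + w\<close> and \<open>T0 - w\<close> are null for
    \<open>b\<close>.\<close>
  define w where "w = sqrt (N / b w1 w1) *\<^sub>R w1"
  have w: "w \<noteq> 0" using w1 bw1 N by (simp add: w_def)
  have bTw: "b T0 w = 0" using w1(2) by (simp add: w_def simps)
  have bwT: "b w T0 = 0" using bTw lorentz_form_sym[OF lb, of w T0] by simp
  have bww: "b w w = N"
  proof -
    have "b w w = (sqrt (N / b w1 w1))\<^sup>2 * b w1 w1" 
      unfolding w_def bilinear_lmul[OF bil_b] bilinear_rmul[OF bil_b]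
      by (simp only: power2_eq_square real_scaleR_def mult.assoc)
    then show ?thesis using N bw1 by simp
  qed
  have \<omega>w: "\<omega> w = 0" by (simp add: \<omega>_def bTw)
  \<comment> \<open>Reversing the sign of the time part of \<open>b\<close> gives a positive
    definite form, against which the Euclidean norm can be compared.\<close>
  define h where "h u = b u u + 2 * N * (\<omega> u)\<^sup>2" for u
  have h_pos: "h u > 0" if u: "u \<noteq> 0" for u
  proof -
    define v where "v = u - \<omega> u *\<^sub>R T0"
    have bTv: "b T0 v = 0" unfolding v_def by (simp add: simps bT \<omega>T)
    have bvT: "b v T0 = 0" using bTv lorentz_form_sym[OF lb, of v T0] by simp
    have u': "u = v + \<omega> u *\<^sub>R T0" by (simp add: v_def)
    have "b u u = b v v - N * (\<omega> u)\<^sup>2"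
      by (subst u', subst (2) u') (simp add: simps bTv bvT bTT power2_eq_square)
    then have hu: "h u = b v v + N * (\<omega> u)\<^sup>2" by (simp add: h_def)
    show ?thesis
    proof (cases "v = 0")
      case True
      then have "\<omega> u \<noteq> 0" using u u' by auto
      then show ?thesis using hu True N bilinear_lzero[OF bil_b] by simp
    next
      case False
      have "b v v > 0" using lorentz_form_orthogonal_pos[OF lb _ bTv False] N bTT by simp
      then show ?thesis using hu N by (simp add: add_pos_nonneg)
    qed
  qed
  have cont_h: "continuous_on UNIV h"
  proof -
    have "continuous_on UNIV \<omega>" using lin\<omega> linear_continuous_on linear_conv_bounded_linear by blast
    moreover have "continuous_on UNIV (\<lambda>u. b u u)"
      by (subst bilinear_eq_sum_Basis[OF bil_b]) (intro continuous_intros)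
    ultimately show ?thesis unfolding h_def by (intro continuous_intros)
  qed
  obtain m where m: "m > 0" "\<And>u. m * (norm u)\<^sup>2 \<le> h u"
    by (rule positive_quadratic_lower_bound[OF cont_h _ h_pos])
      (auto simp: h_def simps linear_cmul[OF lin\<omega>] power2_eq_square algebra_simps)
  \<comment> \<open>If \<open>b u u\<close> is at most half of \<open>m * (norm u)\<^sup>2\<close>,
    as for causal vectors of nearby metrics, then the lower bound on \<open>h\<close> leaves
    \<open>(\<kappa> * norm u)\<^sup>2 \<le> (\<omega> u)\<^sup>2\<close>.\<close>
  define \<kappa> where "\<kappa> = sqrt (m / (4 * N))"
  have \<kappa>: "\<kappa> > 0" "\<kappa>\<^sup>2 = m / (4 * N)" using m N by (auto simp: \<kappa>_def)
  define Q where "Q = norm T0 + 2 * norm w"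
  have Q: "Q > 0" using w by (simp add: Q_def add_nonneg_pos)
  \<comment> \<open>\<open>c\<close> measures how far the form \<open>G x\<close> is from
    \<open>b\<close>, and \<open>d\<close> how far the covector of the time orientation is from
    \<open>b T0\<close>. Below, \<open>c x < m / 2\<close> yields the cone inequality up to sign,
    \<open>d x < \<kappa> * N\<close> fixes the sign, and \<open>c x < N / (2 * Q\<^sup>2)\<close>
    keeps the squares of the vectors \<open>T0 + s w\<close> under control, \<open>Q\<close> being a
    bound for their norms.\<close>
  define c where "c x = (\<Sum>i\<in>Basis. \<Sum>j\<in>Basis. \<bar>G x i j - b i j\<bar>)" for x
  define d where "d x = (\<Sum>j\<in>Basis. \<bar>(\<Sum>i\<in>Basis. (TT x \<bullet> i) * G x i j) - b T0 j\<bar>)" for x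
  have "isCont c x0" unfolding c_def by (intro continuous_intros isCont_G x0)
  moreover have c0: "c x0 = 0" by (simp add: c_def b_def)
  ultimately have c_lim: "(c \<longlongrightarrow> 0) (nhds x0)" by (metis isCont_def tendsto_at_iff_tendsto_nhds)
  have dsum: "(\<Sum>i\<in>Basis. (u \<bullet> i) * G x i j) = G x u j" if "x \<in> S" for x u j
    using linear_eq_sum_Basis[of "\<lambda>u. G x u j" u] bilinear_G[OF that] by (simp add: bilinear_def)
  have "isCont d x0" unfolding d_def by (intro continuous_intros isCont_G x0 TT)
  moreover have "d x0 = 0" by (simp add: d_def dsum[OF x0] TT(2) b_def)
  ultimately have d_lim: "(d \<longlongrightarrow> 0) (nhds x0)" by (metis isCont_def tendsto_at_iff_tendsto_nhds)
  have "\<forall>\<^sub>F x in nhds x0. c x < m / 2" "\<forall>\<^sub>F x in nhds x0. c x < N / (2 * Q\<^sup>2)"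
    "\<forall>\<^sub>F x in nhds x0. d x < \<kappa> * N" "\<forall>\<^sub>F x in nhds x0. x \<in> S"
    using order_tendstoD(2)[OF c_lim, of "m / 2"] order_tendstoD(2)[OF c_lim, of "N / (2 * Q\<^sup>2)"]
      order_tendstoD(2)[OF d_lim, of "\<kappa> * N"] m \<kappa> N Q open_S x0 by (auto intro: eventually_nhds_in_open)
  then have "\<forall>\<^sub>F x in nhds x0. c x < m / 2 \<and> c x < N / (2 * Q\<^sup>2) \<and> d x < \<kappa> * N \<and> x \<in> S"
    by eventually_elim blast
  then obtain R' where R': "R' > 0" "\<And>x. dist x x0 < R' \<Longrightarrow> c x < m / 2 \<and> c x < N / (2 * Q\<^sup>2) \<and> d x < \<kappa> * N \<and> x \<in> S"
    unfolding eventually_nhds_metric by blast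
  define R where "R = R' / 2"
  have near: "c x < m / 2" "c x < N / (2 * Q\<^sup>2)" "d x < \<kappa> * N" "x \<in> S" if "x \<in> cball x0 R" for x
    using R'(2)[of x] R'(1) that by (auto simp: R_def dist_commute)
  have R: "R > 0" using R'(1) by (simp add: R_def)
  have RS: "cball x0 R \<subseteq> S" using near(4) by blast
  obtain C where C: "C \<ge> 0" "\<And>x u. x \<in> cball x0 R \<Longrightarrow> norm (Gam x u u) \<le> C * (norm u)\<^sup>2"
    using Gam_bounded[OF compact_cball RS] by blast
  have cbound: "\<bar>G x u v - b u v\<bar> \<le> c x * norm u * norm v" if "x \<in> S" for x u v
    unfolding c_def by (rule bilinear_diff_bound[OF bilinear_G[OF that] bil_b])
  have cone: "\<kappa> * norm u \<le> \<omega> u" if x: "x \<in> cball x0 R" and u: "G x u u \<le> 0" "G x (TT x) u < 0" for x u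
  proof -
    note n = near[OF x]
    have "b u u \<le> G x u u + c x * norm u * norm u" using cbound[OF n(4), of u u] by linarith
    also have "\<dots> \<le> m / 2 * (norm u)\<^sup>2"
      using u(1) mult_right_mono[OF less_imp_le[OF n(1)], of "(norm u)\<^sup>2"] by (simp add: power2_eq_square mult.assoc)
    finally have "m * (norm u)\<^sup>2 \<le> m / 2 * (norm u)\<^sup>2 + 2 * N * (\<omega> u)\<^sup>2"
      using m(2)[of u] by (simp add: h_def)
    then have "m / (4 * N) * (norm u)\<^sup>2 \<le> (\<omega> u)\<^sup>2" using N by (simp add: field_simps)
    then have "(\<kappa> * norm u)\<^sup>2 \<le> (\<omega> u)\<^sup>2" by (simp add: power_mult_distrib \<kappa>(2))
    then have abs: "\<kappa> * norm u \<le> \<bar>\<omega> u\<bar>" using abs_le_square_iff[of "\<kappa> * norm u" "\<omega> u"] \<kappa>(1) by simp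
    have "G x (TT x) u - b T0 u = (\<Sum>j\<in>Basis. (u \<bullet> j) * ((\<Sum>i\<in>Basis. (TT x \<bullet> i) * G x i j) - b T0 j))"
      unfolding dsum[OF n(4)] right_diff_distrib sum_subtractf
      using linear_eq_sum_Basis[OF lin_b, of u] linear_eq_sum_Basis[of "G x (TT x)" u] bilinear_G[OF n(4)]
      by (simp add: bilinear_def)
    also have "\<bar>\<dots>\<bar> \<le> (\<Sum>j\<in>Basis. norm u * \<bar>(\<Sum>i\<in>Basis. (TT x \<bullet> i) * G x i j) - b T0 j\<bar>)"
      by (rule order_trans[OF sum_abs sum_mono]) (auto simp: abs_mult Basis_le_norm intro!: mult_right_mono)
    also have "\<dots> = d x * norm u" by (simp add: d_def sum_distrib_left[symmetric] mult.commute)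
    finally have "b T0 u \<le> G x (TT x) u + d x * norm u" by linarith
    also have "\<dots> < \<kappa> * N * norm u"
      using u(2) mult_right_mono[OF less_imp_le[OF n(3)] norm_ge_zero[of u]] by linarith
    finally have "N * - \<omega> u < N * (\<kappa> * norm u)" by (simp add: bT mult_ac)
    then have "- \<omega> u < \<kappa> * norm u" by (rule mult_less_cancel_left_pos[OF N, THEN iffD1])
    then show ?thesis using abs by linarith
  qed
  let ?q = "\<lambda>x s. G x (T0 + s *\<^sub>R w) (T0 + s *\<^sub>R w)"
  \<comment> \<open>For \<open>b\<close> the value is exactly \<open>(s\<^sup>2 - 1) * N\<close>,
    because \<open>T0\<close> and \<open>w\<close> are orthogonal with opposite squares. An error
    below \<open>N / 2\<close> preserves its sign where \<open>s\<close> has absolute value 1/2 or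
    2.\<close>
  have nullv: "\<bar>?q x s - (s\<^sup>2 - 1) * N\<bar> < N / 2" if x: "x \<in> cball x0 R" and s: "\<bar>s\<bar> \<le> 2" for x s
  proof -
    note n = near[OF x]
    let ?v = "T0 + s *\<^sub>R w"
    have "b ?v ?v = (s\<^sup>2 - 1) * N" by (simp add: simps bTT bTw bwT bww power2_eq_square algebra_simps)
    moreover have "\<bar>G x ?v ?v - b ?v ?v\<bar> \<le> c x * (norm ?v)\<^sup>2"
      using cbound[OF n(4), of ?v ?v] by (simp add: power2_eq_square mult.assoc)
    moreover have "norm ?v \<le> Q"
      unfolding Q_def using norm_triangle_ineq[of T0 "s *\<^sub>R w"] mult_right_mono[OF s norm_ge_zero[of w]] by simp
    then have "c x * (norm ?v)\<^sup>2 \<le> c x * Q\<^sup>2"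
      by (intro mult_left_mono power_mono) (auto simp: c_def sum_nonneg)
    moreover have "c x * Q\<^sup>2 < N / 2" using n(2) Q by (simp add: field_simps)
    ultimately show ?thesis by linarith
  qed
  have cont_q: "continuous_on A (?q x)" if x: "x \<in> cball x0 R" for x and A :: "real set"
    unfolding bilinear_ladd[OF bilinear_G[OF near(4)[OF x]]] bilinear_radd[OF bilinear_G[OF near(4)[OF x]]]
      bilinear_lmul[OF bilinear_G[OF near(4)[OF x]]] bilinear_rmul[OF bilinear_G[OF near(4)[OF x]]]
    by (intro continuous_intros)
  have pos: "\<exists>s\<in>{1/2..2}. ?q x s = 0"
    and neg: "\<exists>s\<in>{-2..-1/2}. ?q x s = 0" if x: "x \<in> cball x0 R" for x
  proof -
    have neg_half: "?q x s \<le> 0" if "\<bar>s\<bar> = 1/2" for s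
    proof -
      have "s\<^sup>2 = \<bar>s\<bar>\<^sup>2" by simp
      also have "\<dots> = 1/4" unfolding that by (simp add: power2_eq_square)
      finally have e: "s\<^sup>2 = 1/4" .
      have s: "(s\<^sup>2 - 1) * N = - (3/4) * N" unfolding e by simp
      show ?thesis using nullv[OF x, of s, unfolded s] that N by linarith
    qed
    have pos_two: "0 \<le> ?q x s" if "\<bar>s\<bar> = 2" for s
    proof -
      have "s\<^sup>2 = \<bar>s\<bar>\<^sup>2" by simp
      also have "\<dots> = 4" unfolding that by (simp add: power2_eq_square)
      finally have e: "s\<^sup>2 = 4" .
      have s: "(s\<^sup>2 - 1) * N = 3 * N" unfolding e by simp
      show ?thesis using nullv[OF x, of s, unfolded s] that N by linarith
    qed
    have "\<exists>s\<ge>1/2. s \<le> 2 \<and> ?q x s = 0"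
      by (rule IVT'[of "?q x", OF neg_half pos_two _ cont_q[OF x]]) simp_all
    then show "\<exists>s\<in>{1/2..2}. ?q x s = 0" by auto
    have "\<exists>s\<ge>-2. s \<le> -1/2 \<and> ?q x s = 0"
      by (rule IVT2'[of "?q x", OF neg_half pos_two _ cont_q[OF x]]) simp_all
    then show "\<exists>s\<in>{-2..-1/2}. ?q x s = 0" by auto
  qed
  show thesis by (rule that[OF lin\<omega> \<omega>T \<omega>w w \<kappa>(1) C(1) R RS cone C(2) pos neg])
qed

end


section \<open>Refocusing\<close>

context spacetime
begin

text \<open>\<open>\<omega>\<close> composed with the chart strictly increases along
  \<open>\<gamma>\<close> within \<open>W\<close> and serves as time function for
  \<open>curve_stays_inside\<close>. Exit and entry points lie only in the closure of
  \<open>U\<close>, hence the requirement that this closure be inside \<open>W\<close>.\<close>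

lemma null_geodesic_stays_inside:
  fixes \<omega> :: "'e \<Rightarrow> real"
  assumes nul: "null_geodesic_on I \<gamma>" and st: "{s..t} \<subseteq> I"
    and U: "causally_convex U" and W: "open W" "closure U \<subseteq> W" "W \<subseteq> fst c" and c: "c \<in> \<A>"
    and \<omega>: "linear \<omega>" and pos: "\<And>r. r \<in> I \<Longrightarrow> \<gamma> r \<in> W \<Longrightarrow> 0 < \<omega> (velocity c I \<gamma> r)"
    and ends: "\<gamma> s \<in> U" "\<gamma> t \<in> U" and r: "r \<in> {s..t}"
  shows "\<gamma> r \<in> U"
proof (rule curve_stays_inside[OF _ W(1,2) _ _ _ _ ends r, where \<tau>="\<lambda>p. \<omega> (snd c p)"])
  note geo = null_geodesic_onD(1)[OF nul]
  have bl: "bounded_linear \<omega>" using \<omega> by (simp add: linear_conv_bounded_linear)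
  show "open U" using U by (simp add: causally_convex_def)
  show "continuous_on {s..t} \<gamma>" using geodesic_continuous_on[OF geo] st continuous_on_subset by blast
  show "continuous_on W (\<lambda>p. \<omega> (snd c p))"
    by (rule bounded_linear.continuous_on[OF bl continuous_on_subset[OF continuous_on_coord[OF c] W(3)]])
  show "connected (\<gamma> ` {a..b} \<inter> U)" if "s \<le> a" "a < b" "b \<le> t" for a b
  proof -
    have "{a..b} \<subseteq> {s..t}" using that by auto
    then have "nonspacelike_curve {a..b} \<gamma>"
      using null_geodesic_nonspacelike_curve[OF nul that(2)] st by blast
    then show ?thesis using U unfolding causally_convex_def by blast
  qed
  let ?\<tau> = "\<lambda>r. \<omega> (snd c (\<gamma> r))"
  show "\<exists>\<eta>>0. \<forall>u\<in>{s..t}. (r - \<eta> < u \<and> u < r \<longrightarrow> ?\<tau> u < ?\<tau> r) \<and>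
      (r < u \<and> u < r + \<eta> \<longrightarrow> ?\<tau> r < ?\<tau> u)"
    if r: "r \<in> {s..t}" "\<gamma> r \<in> W" for r
  proof -
    have rI: "r \<in> I" using r(1) st by blast
    have "(?\<tau> has_vector_derivative \<omega> (velocity c I \<gamma> r)) (at r)"
      by (rule bounded_linear.has_vector_derivative[OF bl geodesic_coord_derivatives(1)[OF geo rI c]])
        (use r W(3) in blast)
    then have der: "(?\<tau> has_real_derivative \<omega> (velocity c I \<gamma> r)) (at r)"
      by (simp add: has_real_derivative_iff_has_vector_derivative)
    obtain d1 where d1: "d1 > 0" "\<forall>h>0. h < d1 \<longrightarrow> ?\<tau> r < ?\<tau> (r + h)"
      using DERIV_pos_inc_right[OF der pos[OF rI r(2)]] by blast
    obtain d2 where d2: "d2 > 0" "\<forall>h>0. h < d2 \<longrightarrow> ?\<tau> (r - h) < ?\<tau> r"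
      using DERIV_pos_inc_left[OF der pos[OF rI r(2)]] by blast
    have "?\<tau> u < ?\<tau> r" if "r - min d1 d2 < u" "u < r" for u
      using d2(2)[rule_format, of "r - u"] that min.cobounded2[of d1 d2] by simp
    moreover have "?\<tau> r < ?\<tau> u" if "r < u" "u < r + min d1 d2" for u
      using d1(2)[rule_format, of "u - r"] that min.cobounded1[of d1 d2] by simp
    ultimately show ?thesis using d1(1) d2(1) by (intro exI[of _ "min d1 d2"]) simp
  qed
qed

text \<open>The quantifiers matter: \<open>W\<close> and \<open>K\<close> are fixed before
  \<open>U\<close>, \<open>y\<close>, \<open>p\<close> and \<open>\<rho>\<close>, so the estimate is
  uniform for all \<open>p\<close> near \<open>x\<close>. The target ball is intersected with
  \<open>U\<close> so that both \<open>y\<close> and the point of return are in \<open>U\<close>;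
  causal convexity then confines the connecting segment to \<open>W\<close>, where the local bounds
  hold.\<close>

lemma focusing_estimate:
  obtains c W K where "c \<in> \<A>" "open W" "x \<in> W" "W \<subseteq> fst c" "K > 0"
    "\<And>U y p \<rho>. causally_convex U \<Longrightarrow> closure U \<subseteq> W \<Longrightarrow> y \<in> U \<Longrightarrow> p \<in> U \<Longrightarrow>
      all_null_geodesics_enter y {z \<in> U. dist (snd c z) (snd c p) < \<rho>} \<Longrightarrow>
      dist (snd c y) (snd c p) \<le> K * \<rho>"
proof -
  obtain c where c: "c \<in> \<A>" "x \<in> fst c" by (rule chart_at)
  interpret coord_metric "codom c" "coord_g c" by (rule coord_metric_chart[OF c(1)])
  define x0 where "x0 = snd c x"
  define T0 where "T0 = T c x"
  define TT where "TT z = T c (inv_coord c z)" for z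
  have x0: "x0 \<in> codom c" unfolding x0_def by (rule coord_in_codom[OF c(2)])
  have gT0: "coord_g c x0 T0 T0 < 0"
    using T_timelike[OF c] coord_g_coord[OF c] by (simp add: timelike_def x0_def T0_def)
  have "continuous_on (codom c) TT" unfolding TT_def
    by (rule continuous_on_compose2[OF T_continuous[OF c(1)] continuous_on_inv_coord[OF c(1)]])
      (use inv_coord_in_dom[OF c(1)] in blast)
  then have contTT: "isCont TT x0" using open_S x0 by (simp add: continuous_on_eq_continuous_at)
  have TTx: "TT x0 = T0" unfolding TT_def x0_def T0_def by (simp add: inv_coord_coord[OF c])
  obtain \<omega> w \<kappa> C R where lin: "linear \<omega>" and \<omega>T: "\<omega> T0 = 1" and \<omega>w: "\<omega> w = 0" and w: "w \<noteq> 0"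
    and \<kappa>: "\<kappa> > 0" and C: "C \<ge> 0" and R: "R > 0" "cball x0 R \<subseteq> codom c"
    and cone: "\<And>z u. z \<in> cball x0 R \<Longrightarrow> coord_g c z u u \<le> 0 \<Longrightarrow> coord_g c z (TT z) u < 0 \<Longrightarrow> \<kappa> * norm u \<le> \<omega> u"
    and CG: "\<And>z u. z \<in> cball x0 R \<Longrightarrow> norm (Gam z u u) \<le> C * (norm u)\<^sup>2"
    and n1: "\<And>z. z \<in> cball x0 R \<Longrightarrow> \<exists>s\<in>{1/2..2}. coord_g c z (T0 + s *\<^sub>R w) (T0 + s *\<^sub>R w) = 0"
    and n2: "\<And>z. z \<in> cball x0 R \<Longrightarrow> \<exists>s\<in>{-2..-1/2}. coord_g c z (T0 + s *\<^sub>R w) (T0 + s *\<^sub>R w) = 0"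
    using local_geometry[OF x0 gT0 contTT TTx dim_ge_2] by blast
  obtain B where B: "B > 0" "\<And>u. \<bar>\<omega> u\<bar> \<le> B * norm u"
    using linear_bounded_pos[OF lin] by auto
  define M where "M = C / \<kappa>\<^sup>2 + B * C / \<kappa>^3"
  have M: "M \<ge> 0" unfolding M_def using C B(1) \<kappa> by simp
  \<comment> \<open>Over a ball of radius \<open>R1\<close> the values of \<open>\<omega>\<close>
    vary by at most \<open>2 * B * R1\<close>. The second bound makes \<open>M\<close> times this
    variation at most \<open>norm w / 4\<close>, the tolerance of
    \<open>transversal_lines_estimate\<close>; \<open>M + 1\<close> keeps the denominator
    positive.\<close>
  define R1 where "R1 = min R (norm w / (8 * B * (M + 1)))"
  have R1: "R1 > 0" "R1 \<le> R" using R(1) w B(1) M by (auto simp: R1_def)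
  have "M * (2 * B * R1) \<le> (M + 1) * (2 * B * (norm w / (8 * B * (M + 1))))"
    using M B(1) R1 by (intro mult_mono) (auto simp: R1_def)
  also have "\<dots> = norm w / 4"
  proof -
    have "m * (2 * B * (n / (8 * B * m))) = n / 4" if "m > 0" for m n
      using that B(1) by (simp add: field_simps)
    from this[of "M + 1"] show ?thesis using M by simp
  qed
  finally have MR: "M * (2 * B * R1) \<le> norm w / 4" .
  define W where "W = snd c -` ball x0 R1 \<inter> fst c"
  have oW: "open W"
    unfolding W_def by (rule open_coord_vimage[OF c(1) open_ball])
  have xW: "x \<in> W" unfolding W_def using R1(1) c(2) by (simp add: x0_def)
  have Wd: "W \<subseteq> fst c" by (auto simp: W_def)
  have Wb: "snd c p \<in> cball x0 R" if "p \<in> W" for p using that R1(2) by (auto simp: W_def)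
  define near_line where "near_line y v z \<longleftrightarrow>
    norm (snd c z - snd c y - \<omega> (snd c z - snd c y) *\<^sub>R v) \<le> norm w / 4 * \<bar>\<omega> (snd c z - snd c y)\<bar>" for y v z
  have line: "near_line y v (\<gamma> t)"
    if nul: "null_geodesic_on I \<gamma>" and 0: "0 \<in> I" "\<gamma> 0 = y" "velocity c I \<gamma> 0 = v" and v: "\<omega> v = 1"
      and t: "t \<in> I" "\<gamma> t \<in> U" and U: "causally_convex U" "closure U \<subseteq> W" and y: "y \<in> U"
    for I \<gamma> y v t U
  proof -
    note geo = null_geodesic_onD(1)[OF nul]
    let ?v = "velocity c I \<gamma>" and ?x = "\<lambda>r. snd c (\<gamma> r)"
    have UW: "U \<subseteq> W" using U(2) closure_subset by blast
    have nulv: "coord_g c (?x r) (?v r) (?v r) = 0" "?v r \<noteq> 0"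
      if "r \<in> I" "\<gamma> r \<in> W" for r
    proof -
      have d: "\<gamma> r \<in> fst c" using that Wd by blast
      show "coord_g c (?x r) (?v r) (?v r) = 0" "?v r \<noteq> 0"
        using null_geodesic_onD(2)[OF nul that(1) c(1) d] coord_g_coord[OF c(1) d] by (simp_all add: null_def)
    qed
    have TTg: "TT (snd c p) = T c p" if "p \<in> W" for p
      unfolding TT_def using inv_coord_coord[OF c(1)] that Wd by (metis subsetD)
    \<comment> \<open>The cone inequality is stated for future-directed vectors; on past-directed
      geodesics it is applied to the negative of the velocity, which is recorded by
      \<open>\<sigma>\<close>.\<close>
    have "\<exists>\<sigma>. \<bar>\<sigma>\<bar> = 1 \<and> (\<forall>r\<in>I. \<gamma> r \<in> W \<longrightarrow> \<kappa> * norm (?v r) \<le> \<sigma> * \<omega> (?v r))"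
      using null_geodesic_orientation[OF nul]
    proof
      assume fut: "\<forall>t\<in>I. \<forall>c\<in>\<A>. \<gamma> t \<in> fst c \<longrightarrow> future_directed c (\<gamma> t) (velocity c I \<gamma> t)"
      have "\<kappa> * norm (?v r) \<le> \<omega> (?v r)" if r: "r \<in> I" "\<gamma> r \<in> W" for r
      proof (rule cone[OF Wb[OF r(2)]])
        have d: "\<gamma> r \<in> fst c" using r Wd by blast
        show "coord_g c (?x r) (TT (?x r)) (?v r) < 0"
          using fut r(1) c(1) d unfolding TTg[OF r(2)] coord_g_coord[OF c(1) d] future_directed_def by blast
      qed (simp add: nulv[OF r])
      then show ?thesis by (intro exI[of _ 1]) simp
    next
      assume past: "\<forall>t\<in>I. \<forall>c\<in>\<A>. \<gamma> t \<in> fst c \<longrightarrow> past_directed c (\<gamma> t) (velocity c I \<gamma> t)"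
      have "\<kappa> * norm (?v r) \<le> - \<omega> (?v r)" if r: "r \<in> I" "\<gamma> r \<in> W" for r
      proof -
        have d: "\<gamma> r \<in> fst c" using r Wd by blast
        note b = bilinear_G[OF subsetD[OF R(2) Wb[OF r(2)]]]
        have "\<kappa> * norm (- ?v r) \<le> \<omega> (- ?v r)"
        proof (rule cone[OF Wb[OF r(2)]])
          have "0 < coord_g c (?x r) (TT (?x r)) (?v r)"
            using past r(1) c(1) d unfolding TTg[OF r(2)] coord_g_coord[OF c(1) d] past_directed_def by blast
          then show "coord_g c (?x r) (TT (?x r)) (- ?v r) < 0"
            by (simp add: bilinear_rneg[OF b])
        qed (simp add: nulv[OF r] bilinear_rneg[OF b] bilinear_lneg[OF b])
        then show ?thesis by (simp add: linear_neg[OF lin])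
      qed
      then show ?thesis by (intro exI[of _ "-1"]) simp
    qed
    then obtain \<sigma> where \<sigma>: "\<bar>\<sigma>\<bar> = 1"
      "\<And>r. r \<in> I \<Longrightarrow> \<gamma> r \<in> W \<Longrightarrow> \<kappa> * norm (?v r) \<le> \<sigma> * \<omega> (?v r)" by blast
    \<comment> \<open>The geodesic may enter the target at a parameter before or after 0, so the
      segment is taken between the smaller and the larger of \<open>0\<close> and
      \<open>t\<close>.\<close>
    define a where "a = min 0 t"
    define b where "b = max 0 t"
    have ab: "a \<in> I" "b \<in> I" "\<gamma> a \<in> U" "\<gamma> b \<in> U" using 0 t y by (auto simp: a_def b_def min_def max_def)
    have "is_interval I" by (rule geodesic_onD(2)[OF geo])
    then have abI: "{a..b} \<subseteq> I" using interval_subset_is_interval[of I a b] ab(1,2) by (simp add: box_real)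
    have inU: "\<gamma> r \<in> U" if r: "r \<in> {a..b}" for r
    proof (rule null_geodesic_stays_inside[OF nul abI U(1) oW U(2) Wd c(1) _ _ ab(3,4) r, where \<omega>="\<lambda>u. \<sigma> * \<omega> u"])
      show "linear (\<lambda>u. \<sigma> * \<omega> u)"
        by (rule linearI) (simp_all add: linear_add[OF lin] linear_cmul[OF lin] algebra_simps)
      fix r assume r: "r \<in> I" "\<gamma> r \<in> W"
      have "0 < \<kappa> * norm (?v r)" using \<kappa> nulv(2)[OF r] by simp
      then show "0 < \<sigma> * \<omega> (?v r)" using \<sigma>(2)[OF r] by linarith
    qed
    have rI: "r \<in> I" "\<gamma> r \<in> W" "\<gamma> r \<in> fst c" if "r \<in> {a..b}" for r
      using abI inU[OF that] that UW Wd by auto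
    have Dbound: "\<bar>\<omega> (?x r) - \<omega> (?x r')\<bar> \<le> 2 * B * R1" if r: "r \<in> {a..b}" "r' \<in> {a..b}" for r r'
    proof -
      have "norm (?x r - ?x r') \<le> 2 * R1"
        using rI(2)[OF r(1)] rI(2)[OF r(2)] dist_triangle_less_add[of "?x r" x0 R1 "?x r'" R1]
        by (simp add: W_def dist_commute dist_norm[symmetric])
      then have "B * norm (?x r - ?x r') \<le> B * (2 * R1)" using B(1) by (intro mult_left_mono) auto
      then show ?thesis using B(2)[of "?x r - ?x r'"] by (simp add: linear_diff[OF lin])
    qed
    have "norm (?x t - ?x 0 - \<omega> (?x t - ?x 0) *\<^sub>R
        (inverse (\<omega> (?v 0)) *\<^sub>R ?v 0))
        \<le> (C / \<kappa>\<^sup>2 + B * C / \<kappa>^3) * (2 * B * R1) * \<bar>\<omega> (?x t - ?x 0)\<bar>"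
    proof (rule nearly_straight[where a=a and b=b and V="?v" and X="?x" and \<sigma>=\<sigma>
          and A="\<lambda>r. - Gam (?x r) (?v r) (?v r)"])
      fix r assume r: "r \<in> {a..b}"
      note rr = rI[OF r]
      show "(?x has_vector_derivative ?v r) (at r)"
        "(?v has_vector_derivative - Gam (?x r) (?v r) (?v r)) (at r)"
        by (rule geodesic_coord_derivatives[OF geo rr(1) c(1) rr(3)])+
      show "\<kappa> * norm (?v r) \<le> \<sigma> * \<omega> (?v r)" by (rule \<sigma>(2)[OF rr(1,2)])
      show "?v r \<noteq> 0" by (rule nulv(2)[OF rr(1,2)])
      show "norm (- Gam (?x r) (?v r) (?v r)) \<le> C * (norm (?v r))\<^sup>2"
        using CG[OF Wb[OF rr(2)]] by simp
    qed (use lin B(2) \<kappa> \<sigma>(1) C Dbound in \<open>auto simp: a_def b_def\<close>)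
    then have "norm (?x t - snd c y - \<omega> (?x t - snd c y) *\<^sub>R v)
        \<le> M * (2 * B * R1) * \<bar>\<omega> (?x t - snd c y)\<bar>"
      by (simp add: 0 v M_def)
    also have "\<dots> \<le> norm w / 4 * \<bar>\<omega> (?x t - snd c y)\<bar>" using MR by (rule mult_right_mono) simp
    finally show ?thesis unfolding near_line_def .
  qed
  define K' where "K' = (norm T0 + 3 * norm w) * (2 * (2 + norm w * B + 2 * (norm T0 + 2 * norm w) * B) / norm w)"
  have K': "K' \<ge> 0" unfolding K'_def using B(1) by simp
  have \<omega>n: "\<omega> (T0 + s *\<^sub>R w) = 1" for s
    by (simp add: linear_add[OF lin] linear_cmul[OF lin] \<omega>T \<omega>w)
  have reach: "\<exists>z. z \<in> U \<and> dist (snd c z) (snd c p) < \<rho> \<and>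
      near_line y (T0 + s *\<^sub>R w) z"
    if U: "causally_convex U" "closure U \<subseteq> W" and y: "y \<in> U" and s: "coord_g c (snd c y) (T0 + s *\<^sub>R w) (T0 + s *\<^sub>R w) = 0"
      and enter: "all_null_geodesics_enter y {z \<in> U. dist (snd c z) (snd c p) < \<rho>}" for U y p \<rho> s
  proof -
    have yd: "y \<in> fst c" using U(2) y Wd closure_subset by blast
    have "T0 + s *\<^sub>R w \<noteq> 0" using \<omega>n[of s] linear_0[OF lin] by force
    then have "null c y (T0 + s *\<^sub>R w)" using s by (simp add: null_def coord_g_coord[OF c(1) yd])
    then obtain I \<gamma> where g: "null_geodesic_on I \<gamma>" "0 \<in> I" "\<gamma> 0 = y" "velocity c I \<gamma> 0 = T0 + s *\<^sub>R w"
      by (rule null_geodesic_through[OF c(1) yd])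
    then have "\<gamma> ` I \<inter> {z \<in> U. dist (snd c z) (snd c p) < \<rho>} \<noteq> {}"
      using enter unfolding all_null_geodesics_enter_def by blast
    then obtain t where t: "t \<in> I" "\<gamma> t \<in> U" "dist (snd c (\<gamma> t)) (snd c p) < \<rho>" by blast
    show ?thesis using line[OF g \<omega>n t(1,2) U y] t(2,3) by blast
  qed
  \<comment> \<open>\<open>K'\<close> bounds the distance from \<open>y\<close> to the point of
    return \<open>z1\<close>; the summand 1 accounts for the distance from \<open>z1\<close> to
    \<open>p\<close>.\<close>
  have "dist (snd c y) (snd c p) \<le> (K' + 1) * \<rho>"
    if U: "causally_convex U" "closure U \<subseteq> W" and y: "y \<in> U"
      and enter: "all_null_geodesics_enter y {z \<in> U. dist (snd c z) (snd c p) < \<rho>}" for U y p \<rho>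
  proof -
    have "y \<in> W" using U(2) y closure_subset by blast
    note yb = Wb[OF this]
    obtain s1 where s1: "s1 \<in> {1/2..2}" "coord_g c (snd c y) (T0 + s1 *\<^sub>R w) (T0 + s1 *\<^sub>R w) = 0"
      using n1[OF yb] by blast
    obtain s2 where s2: "s2 \<in> {-2..-1/2}" "coord_g c (snd c y) (T0 + s2 *\<^sub>R w) (T0 + s2 *\<^sub>R w) = 0"
      using n2[OF yb] by blast
    obtain z1 where z1: "dist (snd c z1) (snd c p) < \<rho>"
      "near_line y (T0 + s1 *\<^sub>R w) z1"
      using reach[OF U y s1(2) enter] by blast
    obtain z2 where z2: "dist (snd c z2) (snd c p) < \<rho>"
      "near_line y (T0 + s2 *\<^sub>R w) z2"
      using reach[OF U y s2(2) enter] by blast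
    have "dist (snd c z1) (snd c z2) < \<rho> + \<rho>"
      by (rule dist_triangle_less_add[OF z1(1) z2(1)])
    then have z12: "norm (snd c z1 - snd c z2) \<le> 2 * \<rho>" by (simp add: dist_norm)
    have "norm (snd c z1 - snd c y) \<le> K' * \<rho>"
      unfolding K'_def 
      by (rule transversal_lines_estimate[OF lin B(2) less_imp_le[OF B(1)]
            s1(1) s2(1) z1(2)[unfolded near_line_def] z2(2)[unfolded near_line_def] z12 w])
    then show ?thesis
      using z1(1) dist_triangle[of "snd c y" "snd c p" "snd c z1"]
      by (simp add: dist_norm norm_minus_commute algebra_simps)
  qed
  then show thesis using that[OF c(1) oW xW Wd, of "K' + 1"] K' by simp
qed

text \<open>Strong causality bounds \<open>U\<close> but not its closure. A closed coordinate ball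
  is put in between: its image \<open>Q\<close> is compact, hence closed in the Hausdorff manifold,
  and lies in \<open>W\<close>.\<close>

lemma causally_convex_closure_within:
  assumes sc: "strongly_causal" and W: "open W" "x \<in> W"
  obtains U where "causally_convex U" "x \<in> U" "closure U \<subseteq> W"
proof -
  obtain c where c: "c \<in> \<A>" "x \<in> fst c" by (rule chart_at)
  have "open (inv_coord c -` W \<inter> codom c)"
    by (rule open_inv_coord_vimage[OF c(1) W(1)])
  moreover have "snd c x \<in> inv_coord c -` W \<inter> codom c"
    using inv_coord_coord[OF c] coord_in_codom[OF c(2)] W(2) by simp
  ultimately obtain r where r: "r > 0" "cball (snd c x) r \<subseteq> inv_coord c -` W \<inter> codom c"
    using open_contains_cball by blast
  define Q where "Q = inv_coord c ` cball (snd c x) r"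
  have "compact Q" unfolding Q_def
    by (rule compact_continuous_image[OF continuous_on_subset[OF continuous_on_inv_coord[OF c(1)]] compact_cball])
      (use r(2) in blast)
  then have Q: "closed Q" "Q \<subseteq> W" using compact_imp_closed r(2) by (auto simp: Q_def)
  define B where "B = snd c -` ball (snd c x) r \<inter> fst c"
  have oB: "open B" unfolding B_def by (rule open_coord_vimage[OF c(1) open_ball])
  have xB: "x \<in> B" unfolding B_def using r(1) c(2) by simp
  have BQ: "B \<subseteq> Q"
  proof
    fix p assume "p \<in> B"
    then have "p = inv_coord c (snd c p)" "snd c p \<in> cball (snd c x) r"
      using inv_coord_coord[OF c(1)] by (auto simp: B_def)
    then show "p \<in> Q" unfolding Q_def by (rule image_eqI)
  qed
  obtain U where U: "causally_convex U" "x \<in> U" "U \<subseteq> B"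
    using sc oB xB unfolding strongly_causal_def strongly_causal_at_def by blast
  have "closure U \<subseteq> Q" using U(3) BQ Q(1) by (intro closure_minimal) auto
  then show thesis using that[OF U(1,2)] Q(2) by blast
qed

lemma all_null_geodesics_enter_mono:
  "all_null_geodesics_enter y U \<Longrightarrow> U \<subseteq> U' \<Longrightarrow> all_null_geodesics_enter y U'"
  unfolding all_null_geodesics_enter_def by blast

text \<open>Non-refocusing at \<open>x\<close> is used through the one neighbourhood
  \<open>V\<close> to which the focusing estimate applies. Whatever neighbourhood \<open>V'\<close>
  is proposed at a point \<open>p\<close> of the resulting \<open>U\<close>, events that focus
  sharply enough near \<open>p\<close> lie in \<open>V\<close> by the choice of \<open>U\<close>,
  and then in \<open>V'\<close> by the estimate.\<close>

lemma closed_refocusing: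
  assumes sc: "strongly_causal"
  shows "closed {x. refocusing_at x}"
  unfolding closed_def
proof (subst open_subopen, rule ballI)
  fix x assume "x \<in> - {x. refocusing_at x}"
  then have x: "\<not> refocusing_at x" by simp
  obtain c W K where c: "c \<in> \<A>" and W: "open W" "x \<in> W" "W \<subseteq> fst c" and K: "K > 0"
    and est: "\<And>U y p \<rho>. causally_convex U \<Longrightarrow> closure U \<subseteq> W \<Longrightarrow> y \<in> U \<Longrightarrow> p \<in> U \<Longrightarrow>
      all_null_geodesics_enter y {z \<in> U. dist (snd c z) (snd c p) < \<rho>} \<Longrightarrow>
      dist (snd c y) (snd c p) \<le> K * \<rho>"
    using focusing_estimate[of x] by blast
  obtain V where V: "causally_convex V" "x \<in> V" "closure V \<subseteq> W"
    by (rule causally_convex_closure_within[OF sc W(1,2)])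
  have oV: "open V" using V(1) by (simp add: causally_convex_def)
  have Vd: "V \<subseteq> fst c" using V(3) W(3) closure_subset[of V] by (meson order_trans)
  have "\<not> (\<forall>U. open U \<and> x \<in> U \<and> U \<subseteq> V \<longrightarrow> (\<exists>y. y \<notin> V \<and> all_null_geodesics_enter y U))"
  proof
    assume "\<forall>U. open U \<and> x \<in> U \<and> U \<subseteq> V \<longrightarrow> (\<exists>y. y \<notin> V \<and> all_null_geodesics_enter y U)"
    with oV V(2) have "refocusing_at x" unfolding refocusing_at_def by (intro exI[of _ V] conjI)
    with x show False by (rule notE)
  qed
  then obtain U where "open U \<and> x \<in> U \<and> U \<subseteq> V" "\<not> (\<exists>y. y \<notin> V \<and> all_null_geodesics_enter y U)"
    by (simp only: not_all not_imp) (elim exE conjE, blast)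
  then have U: "open U" "x \<in> U" "U \<subseteq> V" and noy: "\<And>y. y \<notin> V \<Longrightarrow> \<not> all_null_geodesics_enter y U"
    by blast+
  have "\<not> refocusing_at p" if p: "p \<in> U" for p
  proof
    assume "refocusing_at p"
    then obtain V' where V': "open V'" "p \<in> V'"
      "\<And>Q. open Q \<Longrightarrow> p \<in> Q \<Longrightarrow> Q \<subseteq> V' \<Longrightarrow> \<exists>y. y \<notin> V' \<and> all_null_geodesics_enter y Q"
      unfolding refocusing_at_def by blast
    have pd: "p \<in> fst c" using p U(3) Vd by blast
    have "open (inv_coord c -` V' \<inter> codom c)"
      by (rule open_inv_coord_vimage[OF c V'(1)])
    moreover have "snd c p \<in> inv_coord c -` V' \<inter> codom c"
      using inv_coord_coord[OF c pd] coord_in_codom[OF pd] V'(2) by simp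
    ultimately obtain \<delta> where \<delta>: "\<delta> > 0" "ball (snd c p) \<delta> \<subseteq> inv_coord c -` V' \<inter> codom c"
      using open_contains_ball by blast
    \<comment> \<open>Chosen so that \<open>K * \<rho>\<close> is half of \<open>\<delta>\<close>:
      an event that the estimate places within \<open>K * \<rho>\<close> of \<open>p\<close> lies in
      the coordinate ball contained in \<open>V'\<close>.\<close>
    define \<rho> where "\<rho> = \<delta> / (2 * K)"
    have \<rho>: "\<rho> > 0" "K * \<rho> < \<delta>" using \<delta>(1) K by (auto simp: \<rho>_def)
    \<comment> \<open>Each factor has its task: \<open>V'\<close> makes \<open>Q\<close> admissible
      for refocusing at \<open>p\<close>, \<open>U\<close> forces the focusing event into
      \<open>V\<close>, and the coordinate ball supplies the hypothesis of the estimate.\<close>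
    define Q where "Q = (snd c -` ball (snd c p) \<rho> \<inter> fst c) \<inter> (U \<inter> V')"
    have "open (snd c -` ball (snd c p) \<rho> \<inter> fst c)"
      by (rule open_coord_vimage[OF c open_ball])
    then have "open Q" unfolding Q_def using U(1) V'(1) by blast
    moreover have "p \<in> Q" unfolding Q_def using p V'(2) pd \<rho>(1) by simp
    moreover have "Q \<subseteq> V'" unfolding Q_def by blast
    ultimately obtain y where y: "y \<notin> V'" "all_null_geodesics_enter y Q" using V'(3) by blast
    have "Q \<subseteq> U" unfolding Q_def by blast
    then have yV: "y \<in> V" using noy all_null_geodesics_enter_mono[OF y(2)] by blast
    have pV: "p \<in> V" using p U(3) by blast
    have "Q \<subseteq> {z \<in> V. dist (snd c z) (snd c p) < \<rho>}"
      unfolding Q_def using U(3) by (auto simp: dist_commute)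
    then have "dist (snd c y) (snd c p) \<le> K * \<rho>"
      using est[OF V(1,3) yV pV] all_null_geodesics_enter_mono[OF y(2)] by blast
    then have "snd c y \<in> ball (snd c p) \<delta>" using \<rho>(2) by (simp add: dist_commute)
    then have "inv_coord c (snd c y) \<in> V'" using \<delta>(2) by blast
    then show False using y(1) inv_coord_coord[OF c] yV Vd by (metis subsetD)
  qed
  then show "\<exists>Q. open Q \<and> x \<in> Q \<and> Q \<subseteq> - {x. refocusing_at x}" using U(1,2) by blast
qed

end

theorem theorem5p7:
  fixes \<A> :: "('a::{t2_space, second_countable_topology}, 'e::euclidean_space) chart set"
    and g :: "('a, 'e) chart \<Rightarrow> 'a \<Rightarrow> 'e \<Rightarrow> 'e \<Rightarrow> real"
    and T :: "('a, 'e) chart \<Rightarrow> 'a \<Rightarrow> 'e"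
  assumes "spacetime \<A> g T"
    and "spacetime.strongly_causal \<A> g T"
  shows "closed {x. lorentz_manifold.refocusing_at \<A> g x}"
  using spacetime.closed_refocusing[OF assms] .

end
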